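(* Let $A$ be a truncated discrete valuation ring of length $a$ ($1\le a\le\infty$) with maximal ideal $\mathfrak m$, let $R=A[x_1,\dots,x_n]$, let $L=Re_1\oplus\cdots\oplus Re_r$ be a free $R$-module of rank $r\ge 1$, and let $M$ be a non-zero $R$-submodule of $L$. Fix a term order on $\mathbb X_{e}$, let $G=\{g_1,\dots,g_t\}$ be a homogeneous Gröbner basis for the graded $\operatorname{gr}(R)$-submodule $\operatorname{gr}(M)\subset\operatorname{gr}(L)$, and write $c_j=\operatorname{lc}(g_j)\in\operatorname{gr}(A)$ and $X_j=\operatorname{lp}(g_j)\in\mathbb X_e$. For $X\in\mathbb X_e$ put $$m_X=\begin{cases}\min\{v(c_j)\ :\ X_j\mid X\}&\text{if there exists } j \text{ with } X_j\mid X,\\ a&\text{otherwise.}\end{cases}$$ Then the following conditions are equivalent: (a) $L/M$ is flat over $A$; (b) $\{m_X : X\in\mathbb X_e\}\subset\{0,a\}$; (c) for any $j$, there exists $j'$ such that $c_{j'}$ is a unit in $\operatorname{gr}(A)$ and $X_{j'}\mid X_j$. If moreover the Gröbner basis $G$ is minimal, these conditions are also equivalent to: (c') the leading coefficient $c_j$ of $g_j$ is a unit in $\operatorname{gr}(A)$ for every $1\le j\le t$.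
   Context: All rings are commutative. A truncated discrete valuation ring (tdvr) of finite length $a\ge1$ is an Artinian local ring whose maximal ideal is generated by one element and whose length as a module over itself is $a$; by convention a discrete valuation ring (not necessarily complete) is called a tdvr of length $a=\infty$. Associated graded objects (with respect to $\mathfrak m$-adic filtrations): $\operatorname{gr}(A)=\bigoplus_{0\le i<a}\mathfrak m^i/\mathfrak m^{i+1}$; $\operatorname{gr}(R)=\bigoplus_{0\le i<a}\mathfrak m^iR/\mathfrak m^{i+1}R$, which is identified with the polynomial ring $\operatorname{gr}(A)[x_1,\dots,x_n]$; $\operatorname{gr}(L)=\bigoplus_{0\le i<a}\mathfrak m^iL/\mathfrak m^{i+1}L$, which is identified with the free $\operatorname{gr}(R)$-module with basis $e_1,\dots,e_r$; and $\operatorname{gr}(M)=\bigoplus_{0\le i<a}(M\cap\mathfrak m^iL)/(M\cap\mathfrak m^{i+1}L)$, a graded $\operatorname{gr}(R)$-submodule of $\operatorname{gr}(L)$. For a non-zero homogeneous element $c\in\mathfrak m^i/\mathfrak m^{i+1}$ of $\operatorname{gr}(A)$, put $v(c)=i$. An element of $\operatorname{gr}(L)$ is homogeneous if it is a non-zero element of some $\mathfrak m^iL/\mathfrak m^{i+1}L$; a Gröbner basis is homogeneous if all its elements are homogeneous (then each $c_j$ is a homogeneous element of $\operatorname{gr}(A)$). Gröbner basis notions, for a Noetherian ring $B$ (here $B=\operatorname{gr}(A)$) and the free module $F=\bigoplus_l B[x_1,\dots,x_n]e_l$ (here $F=\operatorname{gr}(L)$): $\mathbb X=\{x_1^{m_1}\cdots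 x_n^{m_n}: m_i\in\mathbb Z_{\ge0}\}$ and $\mathbb X_e=\{\boldsymbol{x}e_l : \boldsymbol{x}\in\mathbb X,\ 1\le l\le r\}$, a $B$-basis of $F$. A term order is a total order $<$ on $\mathbb X_e$ such that $X<\boldsymbol{x}X$ for all $X\in\mathbb X_e$ and $1\ne\boldsymbol{x}\in\mathbb X$, and $X<Y$ implies $\boldsymbol{x}X<\boldsymbol{x}Y$ for all $\boldsymbol{x}\in\mathbb X$. For $X,Y\in\mathbb X_e$, $X\mid Y$ means $Y=\boldsymbol{x}X$ for some $\boldsymbol{x}\in\mathbb X$. For $0\ne f=a_1X_1+\cdots+a_sX_s\in F$ with $a_i\in B\setminus\{0\}$ and $X_1>\cdots>X_s$ in $\mathbb X_e$, put $\operatorname{lp}(f)=X_1$, $\operatorname{lc}(f)=a_1$, $\operatorname{lt}(f)=a_1X_1$. For a subset $S\subset F$, $\operatorname{Lt}(S)$ is the submodule of $F$ generated by the leading terms of the non-zero elements of $S$. A Gröbner basis for a non-zero submodule $N\subset F$ is a finite subset $G\subset N\setminus\{0\}$ with $\operatorname{Lt}(G)=\operatorname{Lt}(N)$. Reduction: for $S=\{f_1,\dots,f_s\}\subset F\setminus\{0\}$ finite and $f\neq0$, write $f\to_S h$ if $h=f-\sum_i a_i\boldsymbol{x}_if_i$ for some $a_i\in B$, $\boldsymbol{x}_i\in\mathbb X$ such that $\operatorname{lp}(f)=\boldsymbol{x}_i\operatorname{lp}(f_i)$ whenever $a_i\ne0$ and $\operatorname{lt}(f)=\sum_i a_i\boldsymbol{x}_i\operatorname{lt}(f_i)$.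 The element $f$ can be strictly reduced with respect to $S$ if some finite chain of such steps leads from $f$ to an $h$ with $h=0$ or $\operatorname{lp}(h)<\operatorname{lp}(f)$. A Gröbner basis $G$ is minimal if no $g\in G$ can be strictly reduced with respect to $G\setminus\{g\}$. *)

theory Defs
  imports
    "HOL-Library.Extended_Nat"
    "HOL-Library.Multiset"
    "HOL-Algebra.Free_Abelian_Groups"
    "HOL-Algebra.Ideal_Product"
    "HOL-Algebra.Ring_Divisibility"
begin

section \<open>Modules\<close>

text \<open>
  A module over \<open>A\<close> is a record satisfying the locale \<^locale>\<open>module\<close>.  Its ring fields
  \<open>mult\<close> and \<open>one\<close> play no role and are left \<open>undefined\<close> below.
\<close>

definition regular_module :: "('a, 'e) ring_scheme \<Rightarrow> ('a, 'a) module" where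
  "regular_module A =
    \<lparr>carrier = carrier A, monoid.mult = undefined, one = undefined,
     ring.zero = \<zero>\<^bsub>A\<^esub>, add = add A, smult = monoid.mult A\<rparr>"

definition restrict_scalars ::
    "('a \<Rightarrow> 'b) \<Rightarrow> ('b, 'c, 'e) module_scheme \<Rightarrow> ('a, 'c) module" where
  "restrict_scalars h N =
    \<lparr>carrier = carrier N, monoid.mult = undefined, one = undefined,
     ring.zero = \<zero>\<^bsub>N\<^esub>, add = add N, smult = (\<lambda>a x. h a \<odot>\<^bsub>N\<^esub> x)\<rparr>"

definition quotient_module ::
    "('a, 'c, 'e) module_scheme \<Rightarrow> 'c set \<Rightarrow> ('a, 'c set) module" where
  "quotient_module N H =
    \<lparr>carrier = a_rcosets\<^bsub>N\<^esub> H, monoid.mult = undefined, one = undefined,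
     ring.zero = H, add = set_add N, smult = (\<lambda>a C. \<Union>x\<in>C. H +>\<^bsub>N\<^esub> (a \<odot>\<^bsub>N\<^esub> x))\<rparr>"

text \<open>The free module \<open>R e\<^sub>1 \<oplus> \<dots> \<oplus> R e\<^sub>r\<close>; elements are extended by \<open>\<zero>\<close> outside \<open>{1..r}\<close>.\<close>

definition free_module :: "('a, 'e) ring_scheme \<Rightarrow> nat \<Rightarrow> ('a, nat \<Rightarrow> 'a) module" where
  "free_module R r =
    \<lparr>carrier = {f. (\<forall>l\<in>{1..r}. f l \<in> carrier R) \<and> (\<forall>l. l \<notin> {1..r} \<longrightarrow> f l = \<zero>\<^bsub>R\<^esub>)},
     monoid.mult = undefined, one = undefined,
     ring.zero = (\<lambda>l. \<zero>\<^bsub>R\<^esub>), add = (\<lambda>f g l. f l \<oplus>\<^bsub>R\<^esub> g l), smult = (\<lambda>p f l. p \<otimes>\<^bsub>R\<^esub> f l)\<rparr>"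

definition module_span ::
    "('a, 'e) ring_scheme \<Rightarrow> ('a, 'c, 'g) module_scheme \<Rightarrow> 'c set \<Rightarrow> 'c set" where
  "module_span A N S = (\<lambda>H. submodule H A N) hull S"

definition ideal_smult ::
    "('a, 'e) ring_scheme \<Rightarrow> 'a set \<Rightarrow> ('a, 'c, 'g) module_scheme \<Rightarrow> 'c set" where
  "ideal_smult A I N = module_span A N {a \<odot>\<^bsub>N\<^esub> x | a x. a \<in> I \<and> x \<in> carrier N}"

definition module_hom ::
    "('a, 'e) ring_scheme \<Rightarrow> ('a, 'c, 'g) module_scheme \<Rightarrow> ('a, 'd, 'h) module_scheme
      \<Rightarrow> ('c \<Rightarrow> 'd) set" where
  "module_hom A N N' =
    {f \<in> hom (add_monoid N) (add_monoid N').
       \<forall>a\<in>carrier A. \<forall>x\<in>carrier N. f (a \<odot>\<^bsub>N\<^esub> x) = a \<odot>\<^bsub>N'\<^esub> f x}"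

definition module_length :: "('a, 'e) ring_scheme \<Rightarrow> ('a, 'c, 'g) module_scheme \<Rightarrow> enat" where
  "module_length A N =
    Sup {enat k | k. \<exists>S. (\<forall>i\<le>k. submodule (S i) A N) \<and> (\<forall>i<k. S i \<subset> S (Suc i))}"


section \<open>Tensor products and flatness\<close>

text \<open>
  \<open>N \<otimes> T\<close> is the free abelian group on the pairs \<open>(x, y)\<close> modulo the bilinearity relations.
\<close>

definition tensor_relations ::
    "('a, 'e) ring_scheme \<Rightarrow> ('a, 'c, 'g) module_scheme \<Rightarrow> ('a, 'd, 'h) module_scheme
      \<Rightarrow> ('c \<times> 'd \<Rightarrow>\<^sub>0 int) set" where
  "tensor_relations A N T =
     {frag_of (x \<oplus>\<^bsub>N\<^esub> x', y) - frag_of (x, y) - frag_of (x', y) | x x' y.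
        x \<in> carrier N \<and> x' \<in> carrier N \<and> y \<in> carrier T} \<union>
     {frag_of (x, y \<oplus>\<^bsub>T\<^esub> y') - frag_of (x, y) - frag_of (x, y') | x y y'.
        x \<in> carrier N \<and> y \<in> carrier T \<and> y' \<in> carrier T} \<union>
     {frag_of (b \<odot>\<^bsub>N\<^esub> x, y) - frag_of (x, b \<odot>\<^bsub>T\<^esub> y) | b x y.
        b \<in> carrier A \<and> x \<in> carrier N \<and> y \<in> carrier T}"

definition tensor_kernel ::
    "('a, 'e) ring_scheme \<Rightarrow> ('a, 'c, 'g) module_scheme \<Rightarrow> ('a, 'd, 'h) module_scheme
      \<Rightarrow> ('c \<times> 'd \<Rightarrow>\<^sub>0 int) set" where
  "tensor_kernel A N T =
     generate (free_Abelian_group (carrier N \<times> carrier T)) (tensor_relations A N T)"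

definition tensor_product ::
    "('a, 'e) ring_scheme \<Rightarrow> ('a, 'c, 'g) module_scheme \<Rightarrow> ('a, 'd, 'h) module_scheme
      \<Rightarrow> ('c \<times> 'd \<Rightarrow>\<^sub>0 int) set monoid" where
  "tensor_product A N T = free_Abelian_group (carrier N \<times> carrier T) Mod tensor_kernel A N T"

text \<open>The map \<open>f \<otimes> id : N' \<otimes> T \<rightarrow> N \<otimes> T\<close> induced by \<open>f : N' \<rightarrow> N\<close>.\<close>

definition tensor_map ::
    "('a, 'e) ring_scheme \<Rightarrow> ('a, 'c, 'g) module_scheme \<Rightarrow> ('a, 'd, 'h) module_scheme
      \<Rightarrow> ('b \<Rightarrow> 'c) \<Rightarrow> ('b \<times> 'd \<Rightarrow>\<^sub>0 int) set \<Rightarrow> ('c \<times> 'd \<Rightarrow>\<^sub>0 int) set" where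
  "tensor_map A N T f C =
     (\<Union>z\<in>C. tensor_kernel A N T #>\<^bsub>free_Abelian_group (carrier N \<times> carrier T)\<^esub>
               frag_extend (\<lambda>(x, y). frag_of (f x, y)) z)"

text \<open>
  Flatness: tensoring with \<open>T\<close> preserves injectivity.  HOL cannot quantify over all types, so the
  type \<open>'u\<close> in which the test modules \<open>N'\<close>, \<open>N\<close> live is a parameter; a result proved for all
  sufficiently large \<open>'u\<close> is about flatness in the usual sense.  To keep the universe from being
  too small to contain the ideals of \<open>A\<close>, use it with \<open>TYPE('a + 'u)\<close>, \<open>'u\<close> arbitrary.
\<close>

definition flat_module ::
    "'u itself \<Rightarrow> ('a, 'e) ring_scheme \<Rightarrow> ('a, 'd, 'h) module_scheme \<Rightarrow> bool" where
  "flat_module U A T \<longleftrightarrow> module A T \<and>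
     (\<forall>(N' :: ('a, 'u) module) (N :: ('a, 'u) module) f.
        module A N' \<and> module A N \<and> f \<in> module_hom A N' N \<and> inj_on f (carrier N') \<longrightarrow>
        inj_on (tensor_map A N T f) (carrier (tensor_product A N' T)))"


section \<open>Truncated discrete valuation rings\<close>

definition local_ring :: "('a, 'e) ring_scheme \<Rightarrow> 'a set \<Rightarrow> bool" where
  "local_ring A \<mm> \<longleftrightarrow> cring A \<and> maximalideal \<mm> A \<and> (\<forall>J. maximalideal J A \<longrightarrow> J = \<mm>)"

definition artinian_ring :: "('a, 'e) ring_scheme \<Rightarrow> bool" where
  "artinian_ring A \<longleftrightarrow> ring A \<and>
     (\<forall>I. (\<forall>i::nat. ideal (I i) A \<and> I (Suc i) \<subseteq> I i) \<longrightarrow> (\<exists>k. \<forall>i\<ge>k. I i = I k))"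

definition dvr :: "('a, 'e) ring_scheme \<Rightarrow> 'a set \<Rightarrow> bool" where
  "dvr A \<mm> \<longleftrightarrow> principal_domain A \<and> local_ring A \<mm> \<and> \<mm> \<noteq> {\<zero>\<^bsub>A\<^esub>}"

text \<open>\<open>tdvr A \<mm> a\<close>: \<open>A\<close> is a truncated discrete valuation ring of length \<open>a\<close> with maximal ideal \<open>\<mm>\<close>.\<close>

definition tdvr :: "('a, 'e) ring_scheme \<Rightarrow> 'a set \<Rightarrow> enat \<Rightarrow> bool" where
  "tdvr A \<mm> a \<longleftrightarrow>
     (if a = \<infinity> then dvr A \<mm>
      else artinian_ring A \<and> local_ring A \<mm> \<and> (\<exists>t\<in>carrier A. \<mm> = PIdl\<^bsub>A\<^esub> t) \<and>
           module_length A (regular_module A) = a)"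


section \<open>Polynomial rings, terms and term orders\<close>

text \<open>
  The monomial \<open>x\<^sub>1^m\<^sub>1 \<cdots> x\<^sub>n^m\<^sub>n\<close> is the multiset over \<open>{1..n}\<close> with multiplicities \<open>m\<^sub>i\<close>; the
  product of monomials is the sum of multisets.  A polynomial is its coefficient function.
\<close>

definition monomials :: "nat \<Rightarrow> nat multiset set" where
  "monomials n = {u. set_mset u \<subseteq> {1..n}}"

definition mpoly_ring :: "('a, 'e) ring_scheme \<Rightarrow> nat \<Rightarrow> (nat multiset \<Rightarrow> 'a) ring" where
  "mpoly_ring A n =
    \<lparr>carrier = {p. (\<forall>u. p u \<in> carrier A) \<and> finite {u. p u \<noteq> \<zero>\<^bsub>A\<^esub>} \<and>
                   (\<forall>u. u \<notin> monomials n \<longrightarrow> p u = \<zero>\<^bsub>A\<^esub>)},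
     monoid.mult = (\<lambda>p q w. \<Oplus>\<^bsub>A\<^esub>u\<in>{u. u \<subseteq># w}. p u \<otimes>\<^bsub>A\<^esub> q (w - u)),
     one = (\<lambda>u. if u = {#} then \<one>\<^bsub>A\<^esub> else \<zero>\<^bsub>A\<^esub>),
     ring.zero = (\<lambda>u. \<zero>\<^bsub>A\<^esub>),
     add = (\<lambda>p q u. p u \<oplus>\<^bsub>A\<^esub> q u)\<rparr>"

definition poly_monom :: "('a, 'e) ring_scheme \<Rightarrow> 'a \<Rightarrow> nat multiset \<Rightarrow> (nat multiset \<Rightarrow> 'a)" where
  "poly_monom A c u = (\<lambda>w. if w = u then c else \<zero>\<^bsub>A\<^esub>)"

definition poly_const :: "('a, 'e) ring_scheme \<Rightarrow> 'a \<Rightarrow> (nat multiset \<Rightarrow> 'a)" where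
  "poly_const A c = poly_monom A c {#}"

definition free_poly_module ::
    "('a, 'e) ring_scheme \<Rightarrow> nat \<Rightarrow> nat \<Rightarrow> (nat multiset \<Rightarrow> 'a, nat \<Rightarrow> nat multiset \<Rightarrow> 'a) module" where
  "free_poly_module A n r = free_module (mpoly_ring A n) r"

text \<open>The element \<open>u e\<^sub>l\<close> of \<open>\<bbbX>\<^sub>e\<close> is the pair \<open>(u, l)\<close>.\<close>

type_synonym mterm = "nat multiset \<times> nat"

definition mterms :: "nat \<Rightarrow> nat \<Rightarrow> mterm set" where
  "mterms n r = monomials n \<times> {1..r}"

definition mterm_mult :: "nat multiset \<Rightarrow> mterm \<Rightarrow> mterm" where
  "mterm_mult u X = (u + fst X, snd X)"

definition mterm_dvd :: "nat \<Rightarrow> mterm \<Rightarrow> mterm \<Rightarrow> bool" where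
  "mterm_dvd n X Y \<longleftrightarrow> (\<exists>u\<in>monomials n. Y = mterm_mult u X)"

text \<open>\<open>(X, Y) \<in> ord\<close> is read as \<open>X < Y\<close>.\<close>

definition term_order :: "nat \<Rightarrow> nat \<Rightarrow> mterm rel \<Rightarrow> bool" where
  "term_order n r ord \<longleftrightarrow>
     ord \<subseteq> mterms n r \<times> mterms n r \<and>
     strict_linear_order_on (mterms n r) ord \<and>
     (\<forall>X\<in>mterms n r. \<forall>u\<in>monomials n. u \<noteq> {#} \<longrightarrow> (X, mterm_mult u X) \<in> ord) \<and>
     (\<forall>X Y. (X, Y) \<in> ord \<longrightarrow> (\<forall>u\<in>monomials n. (mterm_mult u X, mterm_mult u Y) \<in> ord))"


section \<open>Groebner bases over a ring\<close>

definition mcoeff :: "(nat \<Rightarrow> nat multiset \<Rightarrow> 'b) \<Rightarrow> mterm \<Rightarrow> 'b" where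
  "mcoeff f X = f (snd X) (fst X)"

definition support ::
    "('b, 'e) ring_scheme \<Rightarrow> nat \<Rightarrow> nat \<Rightarrow> (nat \<Rightarrow> nat multiset \<Rightarrow> 'b) \<Rightarrow> mterm set" where
  "support B n r f = {X \<in> mterms n r. mcoeff f X \<noteq> \<zero>\<^bsub>B\<^esub>}"

definition lp ::
    "('b, 'e) ring_scheme \<Rightarrow> nat \<Rightarrow> nat \<Rightarrow> mterm rel \<Rightarrow> (nat \<Rightarrow> nat multiset \<Rightarrow> 'b) \<Rightarrow> mterm" where
  "lp B n r ord f =
     (THE X. X \<in> support B n r f \<and> (\<forall>Y\<in>support B n r f. Y \<noteq> X \<longrightarrow> (Y, X) \<in> ord))"

definition lc ::
    "('b, 'e) ring_scheme \<Rightarrow> nat \<Rightarrow> nat \<Rightarrow> mterm rel \<Rightarrow> (nat \<Rightarrow> nat multiset \<Rightarrow> 'b) \<Rightarrow> 'b" where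
  "lc B n r ord f = mcoeff f (lp B n r ord f)"

definition scaled_term ::
    "('b, 'e) ring_scheme \<Rightarrow> 'b \<Rightarrow> mterm \<Rightarrow> (nat \<Rightarrow> nat multiset \<Rightarrow> 'b)" where
  "scaled_term B c X = (\<lambda>l u. if (u, l) = X then c else \<zero>\<^bsub>B\<^esub>)"

definition lt ::
    "('b, 'e) ring_scheme \<Rightarrow> nat \<Rightarrow> nat \<Rightarrow> mterm rel \<Rightarrow> (nat \<Rightarrow> nat multiset \<Rightarrow> 'b)
      \<Rightarrow> (nat \<Rightarrow> nat multiset \<Rightarrow> 'b)" where
  "lt B n r ord f = scaled_term B (lc B n r ord f) (lp B n r ord f)"

definition Lt ::
    "('b, 'e) ring_scheme \<Rightarrow> nat \<Rightarrow> nat \<Rightarrow> mterm rel \<Rightarrow> (nat \<Rightarrow> nat multiset \<Rightarrow> 'b) set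
      \<Rightarrow> (nat \<Rightarrow> nat multiset \<Rightarrow> 'b) set" where
  "Lt B n r ord S =
     module_span (mpoly_ring B n) (free_poly_module B n r)
       (lt B n r ord ` (S - {\<zero>\<^bsub>free_poly_module B n r\<^esub>}))"

definition groebner_basis ::
    "('b, 'e) ring_scheme \<Rightarrow> nat \<Rightarrow> nat \<Rightarrow> mterm rel \<Rightarrow> (nat \<Rightarrow> nat multiset \<Rightarrow> 'b) set
      \<Rightarrow> (nat \<Rightarrow> nat multiset \<Rightarrow> 'b) set \<Rightarrow> bool" where
  "groebner_basis B n r ord N G \<longleftrightarrow>
     finite G \<and> G \<subseteq> N - {\<zero>\<^bsub>free_poly_module B n r\<^esub>} \<and> Lt B n r ord G = Lt B n r ord N"

text \<open>The relation \<open>f \<rightarrow>\<^sub>S h\<close>, for a finite set \<open>S\<close> of non-zero elements.\<close>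

definition reduces_to ::
    "('b, 'e) ring_scheme \<Rightarrow> nat \<Rightarrow> nat \<Rightarrow> mterm rel \<Rightarrow> (nat \<Rightarrow> nat multiset \<Rightarrow> 'b) set
      \<Rightarrow> (nat \<Rightarrow> nat multiset \<Rightarrow> 'b) \<Rightarrow> (nat \<Rightarrow> nat multiset \<Rightarrow> 'b) \<Rightarrow> bool" where
  "reduces_to B n r ord S f h \<longleftrightarrow>
     (let F = free_poly_module B n r in
       f \<in> carrier F \<and> f \<noteq> \<zero>\<^bsub>F\<^esub> \<and>
       (\<exists>c u. (\<forall>s\<in>S. c s \<in> carrier B \<and> u s \<in> monomials n \<and>
                  (c s \<noteq> \<zero>\<^bsub>B\<^esub> \<longrightarrow> lp B n r ord f = mterm_mult (u s) (lp B n r ord s))) \<and>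
              lt B n r ord f = (\<Oplus>\<^bsub>F\<^esub>s\<in>S. poly_monom B (c s) (u s) \<odot>\<^bsub>F\<^esub> lt B n r ord s) \<and>
              h = f \<ominus>\<^bsub>F\<^esub> (\<Oplus>\<^bsub>F\<^esub>s\<in>S. poly_monom B (c s) (u s) \<odot>\<^bsub>F\<^esub> s)))"

definition strictly_reducible ::
    "('b, 'e) ring_scheme \<Rightarrow> nat \<Rightarrow> nat \<Rightarrow> mterm rel \<Rightarrow> (nat \<Rightarrow> nat multiset \<Rightarrow> 'b) set
      \<Rightarrow> (nat \<Rightarrow> nat multiset \<Rightarrow> 'b) \<Rightarrow> bool" where
  "strictly_reducible B n r ord S f \<longleftrightarrow>
     (\<exists>h. (reduces_to B n r ord S)\<^sup>*\<^sup>* f h \<and>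
          (h = \<zero>\<^bsub>free_poly_module B n r\<^esub> \<or> (lp B n r ord h, lp B n r ord f) \<in> ord))"

definition minimal_basis ::
    "('b, 'e) ring_scheme \<Rightarrow> nat \<Rightarrow> nat \<Rightarrow> mterm rel \<Rightarrow> (nat \<Rightarrow> nat multiset \<Rightarrow> 'b) set \<Rightarrow> bool" where
  "minimal_basis B n r ord G \<longleftrightarrow> (\<forall>g\<in>G. \<not> strictly_reducible B n r ord (G - {g}) g)"


section \<open>Associated graded objects\<close>

text \<open>
  For a descending filtration \<open>Fil\<close> of an abelian group \<open>N\<close>, an element of
  \<open>\<Oplus>\<^sub>i Fil i / Fil (i + 1)\<close> is the family \<open>\<xi>\<close> of its components, each a coset of \<open>Fil (i + 1)\<close>.
  The index \<open>i\<close> runs over all naturals: if \<open>A\<close> has finite length \<open>a\<close>, then the powers of the maximal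
  ideal of exponent \<open>i \<ge> a\<close> vanish and so do the components of \<open>\<xi>\<close> there.
\<close>

definition gr_carrier :: "('c, 'e) ring_scheme \<Rightarrow> (nat \<Rightarrow> 'c set) \<Rightarrow> (nat \<Rightarrow> 'c set) set" where
  "gr_carrier N Fil =
     {\<xi>. (\<forall>i. \<xi> i \<in> (\<lambda>x. Fil (Suc i) +>\<^bsub>N\<^esub> x) ` Fil i) \<and> finite {i. \<xi> i \<noteq> Fil (Suc i)}}"

text \<open>\<open>\<Oplus>\<^sub>i (M \<inter> Fil i) / (M \<inter> Fil (i + 1))\<close>, as a subset of \<open>\<Oplus>\<^sub>i Fil i / Fil (i + 1)\<close>.\<close>

definition gr_sub ::
    "('c, 'e) ring_scheme \<Rightarrow> (nat \<Rightarrow> 'c set) \<Rightarrow> 'c set \<Rightarrow> (nat \<Rightarrow> 'c set) set" where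
  "gr_sub N Fil M =
     {\<xi> \<in> gr_carrier N Fil. \<forall>i. \<xi> i \<in> (\<lambda>x. Fil (Suc i) +>\<^bsub>N\<^esub> x) ` (M \<inter> Fil i)}"

definition gr_homogeneous ::
    "('c, 'e) ring_scheme \<Rightarrow> (nat \<Rightarrow> 'c set) \<Rightarrow> (nat \<Rightarrow> 'c set) set" where
  "gr_homogeneous N Fil =
     {\<xi> \<in> gr_carrier N Fil. \<exists>i. \<xi> i \<noteq> Fil (Suc i) \<and> (\<forall>k. k \<noteq> i \<longrightarrow> \<xi> k = Fil (Suc k))}"

primrec ideal_power :: "('a, 'e) ring_scheme \<Rightarrow> 'a set \<Rightarrow> nat \<Rightarrow> 'a set" where
  "ideal_power A I 0 = carrier A"
| "ideal_power A I (Suc i) = I \<cdot>\<^bsub>A\<^esub> ideal_power A I i"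

text \<open>
  In the product, the component of degree \<open>k\<close> is the sum of the products of the cosets \<open>\<xi> i\<close> and
  \<open>\<eta> (k - i)\<close>; all choices of representatives \<open>x\<close>, \<open>y\<close> give the same coset.
\<close>

definition gr_ring :: "('a, 'e) ring_scheme \<Rightarrow> 'a set \<Rightarrow> (nat \<Rightarrow> 'a set) ring" where
  "gr_ring A \<mm> =
    \<lparr>carrier = gr_carrier A (ideal_power A \<mm>),
     monoid.mult = (\<lambda>\<xi> \<eta> k. \<Union>{ideal_power A \<mm> (Suc k) +>\<^bsub>A\<^esub> (\<Oplus>\<^bsub>A\<^esub>i\<in>{..k}. x i \<otimes>\<^bsub>A\<^esub> y (k - i)) | x y.
                         (\<forall>i. x i \<in> \<xi> i) \<and> (\<forall>i. y i \<in> \<eta> i)}),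
     one = (\<lambda>i. ideal_power A \<mm> (Suc i) +>\<^bsub>A\<^esub> (if i = 0 then \<one>\<^bsub>A\<^esub> else \<zero>\<^bsub>A\<^esub>)),
     ring.zero = (\<lambda>i. ideal_power A \<mm> (Suc i)),
     add = (\<lambda>\<xi> \<eta> i. \<xi> i <+>\<^bsub>A\<^esub> \<eta> i)\<rparr>"

text \<open>The degree of a non-zero homogeneous element of \<open>gr(A)\<close>.\<close>

definition gr_val :: "('a, 'e) ring_scheme \<Rightarrow> 'a set \<Rightarrow> (nat \<Rightarrow> 'a set) \<Rightarrow> nat" where
  "gr_val A \<mm> c = (THE i. c i \<noteq> ideal_power A \<mm> (Suc i))"

text \<open>The submodules \<open>\<mm>\<^sup>i L\<close> of \<open>L = free_poly_module A n r\<close>.\<close>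

definition madic_fil ::
    "('a, 'e) ring_scheme \<Rightarrow> 'a set \<Rightarrow> nat \<Rightarrow> nat \<Rightarrow> nat \<Rightarrow> (nat \<Rightarrow> nat multiset \<Rightarrow> 'a) set" where
  "madic_fil A \<mm> n r i =
     ideal_smult A (ideal_power A \<mm> i) (restrict_scalars (poly_const A) (free_poly_module A n r))"

text \<open>
  The identification of \<open>gr(L)\<close> with the free module over \<open>gr(A)[x\<^sub>1, \<dots>, x\<^sub>n] = gr(R)\<close> of rank \<open>r\<close>:
  the coefficient of \<open>\<xi>\<close> at \<open>u e\<^sub>l\<close> has as component of degree \<open>i\<close> the class modulo \<open>\<mm>\<^sup>i\<^sup>+\<^sup>1\<close>
  of the coefficients at \<open>u e\<^sub>l\<close> of the elements of the coset \<open>\<xi> i\<close>.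
\<close>

definition gr_ident ::
    "('a, 'e) ring_scheme \<Rightarrow> 'a set \<Rightarrow> nat \<Rightarrow> nat \<Rightarrow> (nat \<Rightarrow> (nat \<Rightarrow> nat multiset \<Rightarrow> 'a) set)
      \<Rightarrow> (nat \<Rightarrow> nat multiset \<Rightarrow> (nat \<Rightarrow> 'a set))" where
  "gr_ident A \<mm> n r \<xi> =
     (\<lambda>l u. if (u, l) \<in> mterms n r then (\<lambda>i. (\<lambda>f. f l u) ` \<xi> i) else \<zero>\<^bsub>gr_ring A \<mm>\<^esub>)"

definition gr_submodule ::
    "('a, 'e) ring_scheme \<Rightarrow> 'a set \<Rightarrow> nat \<Rightarrow> nat \<Rightarrow> (nat \<Rightarrow> nat multiset \<Rightarrow> 'a) set
      \<Rightarrow> (nat \<Rightarrow> nat multiset \<Rightarrow> (nat \<Rightarrow> 'a set)) set" where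
  "gr_submodule A \<mm> n r M =
     gr_ident A \<mm> n r ` gr_sub (free_poly_module A n r) (madic_fil A \<mm> n r) M"

definition gr_free_homogeneous ::
    "('a, 'e) ring_scheme \<Rightarrow> 'a set \<Rightarrow> nat \<Rightarrow> nat
      \<Rightarrow> (nat \<Rightarrow> nat multiset \<Rightarrow> (nat \<Rightarrow> 'a set)) set" where
  "gr_free_homogeneous A \<mm> n r =
     gr_ident A \<mm> n r ` gr_homogeneous (free_poly_module A n r) (madic_fil A \<mm> n r)"

text \<open>The number \<open>m\<^sub>X\<close> attached to a finite set \<open>G\<close> of homogeneous elements.\<close>

definition min_val ::
    "('a, 'e) ring_scheme \<Rightarrow> 'a set \<Rightarrow> enat \<Rightarrow> nat \<Rightarrow> nat \<Rightarrow> mterm rel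
      \<Rightarrow> (nat \<Rightarrow> nat multiset \<Rightarrow> (nat \<Rightarrow> 'a set)) set \<Rightarrow> mterm \<Rightarrow> enat" where
  "min_val A \<mm> a n r ord G X =
     (let B = gr_ring A \<mm> in
       if \<exists>g\<in>G. mterm_dvd n (lp B n r ord g) X
       then Min {enat (gr_val A \<mm> (lc B n r ord g)) | g. g \<in> G \<and> mterm_dvd n (lp B n r ord g) X}
       else a)"

end

theory Submission
  imports Defs
begin

text \<open>
  Let \<open>t\<close> generate \<open>\<mm>\<close>; every non-zero element of \<open>A\<close> is a power of \<open>t\<close> times a unit.
  The quotient \<open>L/M\<close> is flat if and only if \<open>M\<close> is pure: \<open>M \<inter> t\<^sup>i L = t\<^sup>i M\<close> for all \<open>i\<close>.  Testing flatness
  on the inclusion of \<open>t\<^sup>i A\<close> in \<open>A\<close> gives purity.  Conversely, \<open>L\<close> being free, \<open>N \<otimes> L/M\<close> is the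
  quotient of the module of finitely supported families in \<open>N\<close>, indexed by the terms, by \<open>N \<cdot> M\<close>,
  and for a submodule \<open>N'\<close> of \<open>N\<close> Gaussian elimination with pivots of least valuation shows that an
  element of \<open>N \<cdot> M\<close> with coordinates in \<open>N'\<close> lies in \<open>N' \<cdot> M\<close> if \<open>M\<close> is pure.

  If \<open>M\<close> is pure, then \<open>f = t\<^sup>i f' \<in> M\<close> with \<open>f' \<in> M\<close> has the same leading power product in degree \<open>i\<close> as
  \<open>f'\<close> in degree \<open>0\<close>; thus the leading power products of \<open>gr(M)\<close> are those of its part of degree \<open>0\<close>,
  which is condition (c).  Conversely, under (c) reduction by basis elements of degree \<open>0\<close> gives
  \<open>M \<inter> t\<^sup>i L \<subseteq> t\<^sup>i M + t\<^sup>i\<^sup>+\<^sup>1 L\<close>.  Iterating, \<open>f \<in> M \<inter> t\<^sup>i L\<close> lies in \<open>t\<^sup>i M + t\<^sup>i\<^sup>+\<^sup>k L\<close> for every \<open>k\<close>,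
  and purity follows because the chain of the submodules \<open>{y. t\<^sup>k y \<in> M}\<close> becomes stationary, by
  Dickson's lemma for terms together with the valuation of their coefficients.
\<close>

section \<open>Local rings with principal maximal ideal\<close>

text \<open>Discrete valuation rings and truncated ones are treated alike: \<open>t\<close> may be
  nilpotent, so factors \<open>t^i\<close> cannot be cancelled, and the substitute is that
  \<open>t^i \<in> t^(i+1) A\<close> forces \<open>t^i = 0\<close>. Of the length \<open>a\<close>
  only \<open>t^a = 0\<close> is retained, in the finite case; it tells \<open>a\<close> apart from
  the valuations \<open>i\<close> of leading coefficients, for which \<open>t^i \<noteq> 0\<close>.
  Flatness is a statement about arbitrary injections of modules, and the direction from purity makes
  no reduction to ideals; hence the elimination takes place in an arbitrary module. Least valuation
  of the pivot matters because purity can then divide its row by \<open>t^e\<close> without leaving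
  \<open>M\<close>, which produces a unit coordinate. Condition (c) speaks of units of gr(A), and a
  non-zero homogeneous element is a unit exactly in degree 0. One upper bound for
  \<open>Lt(G)\<close> is used with two sets of coefficients to be ignored: the zero element alone,
  which yields divisibility by some leading power product, and the elements without component of
  degree 0, which yields divisibility by one with a unit coefficient.\<close>

locale principal_local_ring = cring A for A (structure) +
  fixes t
  assumes t_closed [simp, intro]: "t \<in> carrier A"
    and one_notin: "\<one> \<notin> PIdl t"
    and unit_if_notin: "x \<in> carrier A \<Longrightarrow> x \<notin> PIdl t \<Longrightarrow> x \<in> Units A"

text \<open>The common ground of both cases of \<open>tdvr\<close>: \<open>t\<close> may be zero (a
  field), nilpotent, or a prime element of a discrete valuation ring.\<close>

locale uniserial_ring = principal_local_ring +
  assumes factor: "x \<in> carrier A \<Longrightarrow> x \<noteq> \<zero> \<Longrightarrow> \<exists>i::nat. \<exists>u\<in>Units A. x = t [^] i \<otimes> u"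

lemma (in cring) mem_cgenideal_iff: "x \<in> PIdl y \<longleftrightarrow> (\<exists>z\<in>carrier R. x = y \<otimes> z)" if "y \<in> carrier R"
  using that by (auto simp: cgenideal_def m_comm)

context principal_local_ring
begin

lemma mem_power_iff: "x \<in> PIdl (t [^] (i::nat)) \<longleftrightarrow> (\<exists>z\<in>carrier A. x = t [^] i \<otimes> z)"
  by (simp add: mem_cgenideal_iff)

lemma power_ideal: "ideal (PIdl (t [^] (i::nat))) A"
  by (simp add: cgenideal_ideal)

lemma power_antimono: "i \<le> j \<Longrightarrow> PIdl (t [^] (j::nat)) \<subseteq> PIdl (t [^] (i::nat))"
proof
  fix x assume "i \<le> j" "x \<in> PIdl (t [^] j)"
  then obtain z where z: "z \<in> carrier A" "x = t [^] j \<otimes> z" by (auto simp: mem_power_iff)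
  have "t [^] j = t [^] i \<otimes> t [^] (j - i)" using \<open>i \<le> j\<close> by (simp add: nat_pow_mult)
  then have "x = t [^] i \<otimes> (t [^] (j - i) \<otimes> z)" using z by (simp add: m_assoc)
  then show "x \<in> PIdl (t [^] i)" using z by (auto simp: mem_power_iff)
qed

lemma power_mult_mem: "x \<in> PIdl (t [^] (i::nat)) \<Longrightarrow> y \<in> PIdl (t [^] (j::nat)) \<Longrightarrow> x \<otimes> y \<in> PIdl (t [^] (i + j))"
proof -
  assume "x \<in> PIdl (t [^] (i::nat))" "y \<in> PIdl (t [^] (j::nat))"
  then obtain z w where "z \<in> carrier A" "x = t [^] i \<otimes> z" "w \<in> carrier A" "y = t [^] j \<otimes> w"
    by (auto simp: mem_power_iff)
  moreover then have "x \<otimes> y = t [^] (i + j) \<otimes> (z \<otimes> w)"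
    by (simp add: nat_pow_mult[symmetric] m_ac)
  ultimately show ?thesis by (auto simp: mem_power_iff)
qed

lemma power_mem_carrier: "x \<in> PIdl (t [^] (i::nat)) \<Longrightarrow> x \<in> carrier A"
  by (auto simp: mem_power_iff)

lemma power_add_mem: "x \<in> PIdl (t [^] (i::nat)) \<Longrightarrow> y \<in> PIdl (t [^] i) \<Longrightarrow> x \<oplus> y \<in> PIdl (t [^] i)"
  by (rule additive_subgroup.a_closed[OF ideal.axioms(1)[OF power_ideal]])

lemma power_minus_mem: "x \<in> PIdl (t [^] (i::nat)) \<Longrightarrow> \<ominus> x \<in> PIdl (t [^] i)"
  by (rule additive_subgroup.a_inv_closed[OF ideal.axioms(1)[OF power_ideal]])

lemma power_mult_l: "x \<in> carrier A \<Longrightarrow> y \<in> PIdl (t [^] (i::nat)) \<Longrightarrow> x \<otimes> y \<in> PIdl (t [^] i)"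
  by (rule ideal.I_l_closed[OF power_ideal])

lemma power_mult_r: "x \<in> carrier A \<Longrightarrow> y \<in> PIdl (t [^] (i::nat)) \<Longrightarrow> y \<otimes> x \<in> PIdl (t [^] i)"
  by (rule ideal.I_r_closed[OF power_ideal])

lemma zero_mem_power [simp]: "\<zero> \<in> PIdl (t [^] (i::nat))"
  by (simp add: additive_subgroup.zero_closed ideal.axioms(1) power_ideal)

lemma unit_iff: "x \<in> Units A \<longleftrightarrow> x \<in> carrier A \<and> x \<notin> PIdl t"
proof
  assume x: "x \<in> Units A"
  show "x \<in> carrier A \<and> x \<notin> PIdl t"
  proof (intro conjI notI)
    assume "x \<in> PIdl t"
    then obtain z where "z \<in> carrier A" "x = t \<otimes> z" by (auto simp: mem_cgenideal_iff)
    then have "\<one> = t \<otimes> (z \<otimes> inv x)" using x by (metis Units_inv_closed Units_r_inv m_assoc t_closed)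
    then show False using one_notin \<open>z \<in> carrier A\<close> x by (auto simp: mem_cgenideal_iff)
  qed (use x in auto)
qed (use unit_if_notin in blast)

lemma one_minus_unit: "z \<in> carrier A \<Longrightarrow> \<one> \<ominus> t \<otimes> z \<in> Units A"
proof -
  assume z: "z \<in> carrier A"
  have "\<one> \<ominus> t \<otimes> z \<notin> PIdl t"
  proof
    assume "\<one> \<ominus> t \<otimes> z \<in> PIdl t"
    moreover have "t \<otimes> z \<in> PIdl t" using z by (auto simp: mem_cgenideal_iff)
    ultimately have "(\<one> \<ominus> t \<otimes> z) \<oplus> t \<otimes> z \<in> PIdl t"
      using power_add_mem[of _ 1] by simp
    moreover have "(\<one> \<ominus> t \<otimes> z) \<oplus> t \<otimes> z = \<one>" using z by (simp add: a_minus_def a_assoc l_neg)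
    ultimately show False using one_notin by simp
  qed
  then show ?thesis using z by (simp add: unit_iff)
qed

text \<open>Nakayama's lemma for \<open>t^i A\<close>: if \<open>t^i = t^i t z\<close>, then the
  unit \<open>1 - t z\<close> annihilates \<open>t^i\<close>.\<close>

lemma power_eq_zero: "t [^] (i::nat) \<in> PIdl (t [^] Suc i) \<Longrightarrow> t [^] i = \<zero>"
proof -
  assume "t [^] (i::nat) \<in> PIdl (t [^] Suc i)"
  then obtain z where z: "z \<in> carrier A" "t [^] i = t [^] i \<otimes> (t \<otimes> z)"
    by (metis mem_power_iff m_assoc nat_pow_Suc nat_pow_closed t_closed)
  then have "t [^] i \<otimes> (\<one> \<ominus> t \<otimes> z) = \<zero>"
    by (simp add: a_minus_def r_distr r_minus r_neg flip: z(2))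
  then have "t [^] i \<otimes> (\<one> \<ominus> t \<otimes> z) \<otimes> inv (\<one> \<ominus> t \<otimes> z) = \<zero>"
    using one_minus_unit[OF z(1)] by simp
  then show ?thesis using one_minus_unit[OF z(1)]
    by (metis Units_closed Units_inv_closed Units_r_inv m_assoc nat_pow_closed r_one t_closed)
qed

lemma unit_if_not_mem:
  assumes "x \<in> carrier A" "t [^] (i::nat) \<otimes> x \<notin> PIdl (t [^] Suc i)"
  shows "x \<in> Units A"
proof -
  have "x \<notin> PIdl t"
  proof
    assume "x \<in> PIdl t"
    then have "t [^] i \<otimes> x \<in> PIdl (t [^] (i + 1))"
      using power_mult_mem[of "t [^] i" i x 1] by (auto simp: cgenideal_self)
    then show False using assms by simp
  qed
  then show ?thesis using assms unit_iff by blast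
qed

text \<open>Multiplication by the inverse of \<open>u\<close> would put \<open>t^i\<close> itself
  into \<open>t^(i+1) A\<close>. With the preceding lemma: if \<open>t^i \<noteq> 0\<close>, the
  class of \<open>t^i x\<close> in degree \<open>i\<close> is non-zero exactly if \<open>x\<close>
  is a unit.\<close>

lemma unit_times_not_mem:
  assumes "u \<in> Units A" "t [^] (i::nat) \<noteq> \<zero>"
  shows "t [^] i \<otimes> u \<notin> PIdl (t [^] Suc i)"
proof
  assume "t [^] i \<otimes> u \<in> PIdl (t [^] Suc i)"
  then have "(t [^] i \<otimes> u) \<otimes> inv u \<in> PIdl (t [^] Suc i)"
    using assms(1) power_mult_r by blast
  then have "t [^] i \<in> PIdl (t [^] Suc i)" using assms(1) by (simp add: m_assoc Units_closed)
  then show False using power_eq_zero assms by blast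
qed

lemma ideal_power_eq: "ideal_power A (PIdl t) i = PIdl (t [^] i)"
proof (induction i)
  case 0
  then show ?case by (simp add: mem_cgenideal_iff set_eq_iff)
next
  case (Suc i)
  have "(PIdl t) \<cdot> (PIdl (t [^] i)) = Idl ((PIdl t) <#> (PIdl (t [^] i)))"
    by (simp add: ideal_prod_eq_genideal cgenideal_ideal)
  also have "\<dots> = PIdl (t [^] Suc i)"
    by (simp add: cgenideal_prod m_comm) (metis cgenideal_ideal genideal_minimal genideal_self
      additive_subgroup.a_subset ideal.axioms(1) m_closed nat_pow_closed subset_antisym subset_refl t_closed)
  finally show ?case using Suc by simp
qed

text \<open>The least \<open>k\<close> with \<open>x \<notin> t^k A\<close> is positive because
  \<open>t^0 A = A\<close>. So \<open>x = t^(k-1) y\<close>, and \<open>y\<close> is a unit since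
  otherwise \<open>x\<close> would lie in \<open>t^k A\<close>.\<close>

lemma factor_if_notin_power:
  assumes "x \<in> carrier A" "x \<notin> PIdl (t [^] (j::nat))"
  shows "\<exists>i::nat. \<exists>u\<in>Units A. x = t [^] i \<otimes> u"
proof -
  define k where "k = (LEAST j::nat. x \<notin> PIdl (t [^] j))"
  have k: "x \<notin> PIdl (t [^] k)" unfolding k_def by (rule LeastI) fact
  have "x \<in> PIdl (t [^] (0::nat))" using assms(1) by (simp add: mem_cgenideal_iff)
  then obtain i where i: "k = Suc i" using k by (cases k) auto
  then have "x \<in> PIdl (t [^] i)" using not_less_Least[of i "\<lambda>j. x \<notin> PIdl (t [^] j)"] by (auto simp: k_def)
  then obtain y where y: "y \<in> carrier A" "x = t [^] i \<otimes> y" by (auto simp: mem_power_iff)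
  then have "y \<in> Units A" using k unit_if_not_mem i by auto
  then show ?thesis using y by blast
qed

end

section \<open>From truncated discrete valuation rings to uniserial rings\<close>

lemma (in cring) exists_maximalideal:
  assumes "x \<in> carrier R" "x \<notin> Units R"
  shows "\<exists>J. maximalideal J R \<and> x \<in> J"
proof -
  \<comment> \<open>Zorn's lemma is applied to the proper ideals containing \<open>x\<close>; a
    maximal one is a maximal ideal because every proper ideal above it is again in
    \<open>S\<close>.\<close>
  define S where "S = {I. ideal I R \<and> x \<in> I \<and> \<one> \<notin> I}"
  have "\<one> \<notin> PIdl x" using assms by (auto simp: mem_cgenideal_iff Units_def m_comm)
  then have "PIdl x \<in> S" using assms(1) by (simp add: S_def cgenideal_ideal cgenideal_self)
  moreover have "\<Union>C \<in> S" if "C \<noteq> {}" "subset.chain S C" for C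
  proof -
    have "subset.chain {I. ideal I R} C" using that by (auto simp: pred_on.chain_def S_def)
    then have "ideal (\<Union>C) R" using chain_Union_is_ideal[of C] that(1) by simp
    then show ?thesis using that by (auto simp: pred_on.chain_def S_def)
  qed
  ultimately obtain J where J: "J \<in> S" "\<And>I. I \<in> S \<Longrightarrow> J \<subseteq> I \<Longrightarrow> I = J"
    using subset_Zorn_nonempty[of S] by blast
  have "maximalideal J R"
  proof (rule maximalidealI)
    show "ideal J R" "carrier R \<noteq> J" using J(1) by (auto simp: S_def)
    fix I assume I: "ideal I R" "J \<subseteq> I" "I \<subseteq> carrier R"
    show "I = J \<or> I = carrier R"
    proof (cases "\<one> \<in> I")
      case True then show ?thesis using I(1) ideal.one_imp_carrier by blast
    next
      case False then show ?thesis using I J by (auto simp: S_def)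
    qed
  qed
  then show ?thesis using J(1) by (auto simp: S_def)
qed

lemma local_ring_principal:
  assumes "local_ring A \<mm>" "t \<in> carrier A" "\<mm> = PIdl\<^bsub>A\<^esub> t"
  shows "principal_local_ring A t"
proof -
  interpret cring A using assms(1) by (simp add: local_ring_def)
  interpret maximalideal \<mm> A using assms(1) by (simp add: local_ring_def)
  show ?thesis
  proof unfold_locales
    show "\<one>\<^bsub>A\<^esub> \<notin> PIdl\<^bsub>A\<^esub> t" using I_notcarr one_imp_carrier assms(3) by blast
    show "x \<in> Units A" if "x \<in> carrier A" "x \<notin> PIdl\<^bsub>A\<^esub> t" for x
      using exists_maximalideal[OF that(1)] that(2) assms(1,3) by (auto simp: local_ring_def)
  qed fact
qed

text \<open>The two additive monoids may be records of different types, so they cannot simply be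
  equated; being a subgroup depends on these three fields only.\<close>

lemma subgroup_add_monoid_cong:
  assumes "carrier N = carrier N'" "add N = add N'" "\<zero>\<^bsub>N\<^esub> = \<zero>\<^bsub>N'\<^esub>"
  shows "subgroup H (add_monoid N) \<longleftrightarrow> subgroup H (add_monoid N')"
  using assms by (simp add: subgroup_def m_inv_def)

text \<open>If \<open>t^a\<close> were non-zero, the powers from \<open>t^(a+1) A\<close> up to
  \<open>t^0 A = A\<close> would form a strict chain with \<open>a + 1\<close> inclusions.\<close>

lemma (in principal_local_ring) power_length_eq_zero:
  assumes "module_length A (regular_module A) = enat a"
  shows "t [^] a = \<zero>"
proof (rule ccontr)
  assume nz: "t [^] a \<noteq> \<zero>"
  define S where "S i = PIdl (t [^] (Suc a - i))" for i
  have mono: "t [^] j \<noteq> \<zero>" if "j \<le> a" for j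
  proof
    assume "t [^] j = \<zero>"
    then have "t [^] j \<otimes> t [^] (a - j) = \<zero>" by simp
    then show False using nz that by (simp add: nat_pow_mult)
  qed
  have "submodule (S i) A (regular_module A)" for i
  proof -
    have "subgroup (S i) (add_monoid A)"
      using power_ideal[of "Suc a - i"] by (simp add: S_def ideal_def additive_subgroup_def)
    then have "subgroup (S i) (add_monoid (regular_module A))"
      by (subst subgroup_add_monoid_cong[where N' = A]) (auto simp: regular_module_def)
    then show ?thesis
      by (auto simp: submodule_def submodule_axioms_def regular_module_def S_def power_mult_l)
  qed
  moreover have "S i \<subset> S (Suc i)" if "i < Suc a" for i
  proof -
    define j where "j = a - i"
    have j: "Suc a - i = Suc j" "Suc a - Suc i = j" "j \<le> a" using that by (auto simp: j_def)
    have "PIdl (t [^] Suc j) \<subset> PIdl (t [^] j)"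
      using power_antimono[of j "Suc j"] power_eq_zero[of j] mono[OF j(3)] cgenideal_self[of "t [^] j"] by auto
    then show ?thesis unfolding S_def j .
  qed
  ultimately have "enat (Suc a) \<le> module_length A (regular_module A)"
    unfolding module_length_def by (intro Sup_upper) blast
  then show False using assms by simp
qed

text \<open>If \<open>x = t^j y_j\<close> for all \<open>j\<close>, cancellation gives
  \<open>y_j = t y_(j+1)\<close>, so the ideals generated by the \<open>y_j\<close> ascend. The
  union of this chain is one of its members, say the one of \<open>y_k\<close>; hence
  \<open>y_(k+1) = y_k c = t c y_(k+1)\<close>, and \<open>t\<close> would be a unit.\<close>

lemma dvr_not_in_all_powers:
  fixes A (structure)
  assumes "principal_domain A" "principal_local_ring A t" "t \<noteq> \<zero>" "x \<in> carrier A" "x \<noteq> \<zero>"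
  shows "\<exists>j::nat. x \<notin> PIdl (t [^] j)"
proof (rule ccontr)
  interpret principal_domain A by fact
  interpret principal_local_ring A t by fact
  assume "\<not> ?thesis"
  then have "\<forall>j::nat. \<exists>z\<in>carrier A. x = t [^] j \<otimes> z" by (simp add: mem_power_iff)
  then obtain y where y: "\<And>j. y j \<in> carrier A" "\<And>j::nat. x = t [^] j \<otimes> y j" by metis
  have step: "y j = t \<otimes> y (Suc j)" for j
  proof -
    have "t [^] j \<otimes> y j = t [^] j \<otimes> (t \<otimes> y (Suc j))"
      using y(2)[of j] y(2)[of "Suc j"] y(1) by (simp add: m_assoc)
    moreover have "t [^] j \<noteq> \<zero>" using y(2)[of j] y(1)[of j] assms(5) by auto
    ultimately show ?thesis using y(1) m_lcancel by (meson m_closed nat_pow_closed t_closed)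
  qed
  have up: "PIdl (y j) \<subseteq> PIdl (y (Suc j))" for j
    using step[of j] y(1) by (auto simp: mem_cgenideal_iff) (metis m_assoc m_closed m_comm t_closed)
  define C where "C = range (\<lambda>j. PIdl (y j))"
  have "subset.chain {I. ideal I A} C"
    unfolding C_def pred_on.chain_def
  proof (intro conjI ballI subsetI)
    fix I J assume "I \<in> range (\<lambda>j. PIdl (y j))" "J \<in> range (\<lambda>j. PIdl (y j))"
    then obtain j l where "I = PIdl (y j)" "J = PIdl (y l)" by auto
    then show "(\<subset>)\<^sup>=\<^sup>= I J \<or> (\<subset>)\<^sup>=\<^sup>= J I"
      using lift_Suc_mono_le[of "\<lambda>j. PIdl (y j)", OF up] nat_le_linear[of j l] by blast
  qed (use y(1) in \<open>auto simp: cgenideal_ideal\<close>)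
  then have "\<Union>C \<in> C" by (rule ideal_chain_is_trivial[rotated]) (simp add: C_def)
  then obtain k where "\<Union>C = PIdl (y k)" by (auto simp: C_def)
  moreover have "y (Suc k) \<in> \<Union>C" using y(1) cgenideal_self by (force simp: C_def)
  ultimately obtain c where c: "c \<in> carrier A" "y (Suc k) = y k \<otimes> c"
    using y(1) by (auto simp: mem_cgenideal_iff)
  have nz: "y (Suc k) \<noteq> \<zero>" using y(2)[of "Suc k"] assms(5) by auto
  have "y (Suc k) \<otimes> \<one> = y (Suc k) \<otimes> (t \<otimes> c)"
    using c step[of k] y(1) by (metis m_assoc m_comm r_one t_closed)
  then have "\<one> = t \<otimes> c" using nz y(1) c(1) m_lcancel by (meson m_closed one_closed t_closed)
  then show False using one_notin c(1) by (auto simp: mem_cgenideal_iff)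
qed

text \<open>For finite length every non-zero \<open>x\<close> lies outside \<open>t^a A = 0\<close>;
  for infinite length the preceding lemma supplies a power of \<open>t\<close> whose ideal does not
  contain \<open>x\<close>.\<close>

lemma tdvr_uniserial:
  assumes "tdvr A \<mm> a"
  obtains t where "uniserial_ring A t" "\<mm> = PIdl\<^bsub>A\<^esub> t" "\<And>i. enat i = a \<Longrightarrow> t [^]\<^bsub>A\<^esub> i = \<zero>\<^bsub>A\<^esub>"
proof (cases a)
  case (enat k)
  then obtain t where t: "t \<in> carrier A" "\<mm> = PIdl\<^bsub>A\<^esub> t"
    and A: "local_ring A \<mm>" "module_length A (regular_module A) = enat k"
    using assms by (auto simp: tdvr_def)
  interpret principal_local_ring A t using A(1) t by (rule local_ring_principal)
  have z: "t [^]\<^bsub>A\<^esub> k = \<zero>\<^bsub>A\<^esub>" using A(2) by (rule power_length_eq_zero)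
  have "uniserial_ring A t"
    by unfold_locales (use z in \<open>auto simp: mem_cgenideal_iff intro!: factor_if_notin_power[where j = k]\<close>)
  then show ?thesis using that t(2) z enat by auto
next
  case infinity
  then have A: "principal_domain A" "local_ring A \<mm>" "\<mm> \<noteq> {\<zero>\<^bsub>A\<^esub>}" using assms by (auto simp: tdvr_def dvr_def)
  then interpret principal_domain A by simp
  have "ideal \<mm> A" using A(2) by (simp add: local_ring_def maximalideal_def)
  then obtain t where t: "t \<in> carrier A" "\<mm> = PIdl\<^bsub>A\<^esub> t" using exists_gen by blast
  interpret principal_local_ring A t using A(2) t by (rule local_ring_principal)
  have "t \<noteq> \<zero>\<^bsub>A\<^esub>" using A(3) t(2) by (force simp: cgenideal_def)
  then have "uniserial_ring A t"
    using dvr_not_in_all_powers[OF A(1) principal_local_ring_axioms] factor_if_notin_power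
    by unfold_locales blast
  then show ?thesis using that t(2) infinity by auto
qed

section \<open>Quotient modules\<close>

lemma quotient_module_simps [simp]:
  "carrier (quotient_module L M) = a_rcosets\<^bsub>L\<^esub> M"
  "\<zero>\<^bsub>quotient_module L M\<^esub> = M"
  "C \<oplus>\<^bsub>quotient_module L M\<^esub> D = C <+>\<^bsub>L\<^esub> D"
  by (simp_all add: quotient_module_def)

locale module_with_submodule = module A L for A (structure) and L +
  fixes M
  assumes submodule: "submodule M A L"
begin

lemma additive: "additive_subgroup M L"
  using submodule by (simp add: additive_subgroup_def submodule_def)

sublocale quot: abelian_subgroup M L
  using additive abelian_subgroupI3 M.abelian_group_axioms by blast

lemmas sub_subset = submoduleE(1)[OF submodule]
  and sub_smult = submoduleE(4)[OF submodule]
  and sub_add = submoduleE(5)[OF submodule]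
  and sub_minus = submoduleE(6)[OF submodule]

lemma sub_carrier: "m \<in> M \<Longrightarrow> m \<in> carrier L" using sub_subset by auto

abbreviation cls where "cls x \<equiv> M +>\<^bsub>L\<^esub> x"

lemma cls_closed [simp]: "x \<in> carrier L \<Longrightarrow> cls x \<in> a_rcosets\<^bsub>L\<^esub> M"
  using M.a_rcosetsI sub_subset by blast

lemma cls_cases: "C \<in> a_rcosets\<^bsub>L\<^esub> M \<Longrightarrow> \<exists>x\<in>carrier L. C = cls x"
  by (auto simp: A_RCOSETS_def')

lemma cls_eq_iff: "x \<in> carrier L \<Longrightarrow> y \<in> carrier L \<Longrightarrow> cls x = cls y \<longleftrightarrow> x \<ominus>\<^bsub>L\<^esub> y \<in> M"
  using quot.a_rcos_module[of y x] quot.a_rcos_self[of x] quot.a_repr_independence'[of x y]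
  by (auto simp: M.minus_eq)

lemma cls_add: "x \<in> carrier L \<Longrightarrow> y \<in> carrier L \<Longrightarrow> cls x <+>\<^bsub>L\<^esub> cls y = cls (x \<oplus>\<^bsub>L\<^esub> y)"
  by (rule quot.a_rcos_sum)

lemma cls_sub: "m \<in> M \<Longrightarrow> cls m = M"
  using M.a_coset_join2 quot.a_subgroup sub_carrier by blast

text \<open>The definition takes a union over all representatives; they contribute the same coset
  because \<open>a (y - x) \<in> M\<close>.\<close>

lemma cls_smult [simp]:
  assumes "a \<in> carrier A" "x \<in> carrier L"
  shows "a \<odot>\<^bsub>quotient_module L M\<^esub> cls x = cls (a \<odot>\<^bsub>L\<^esub> x)"
proof -
  have "cls (a \<odot>\<^bsub>L\<^esub> y) = cls (a \<odot>\<^bsub>L\<^esub> x)" if "y \<in> cls x" for y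
  proof -
    have y: "y \<in> carrier L" using that assms quot.a_elemrcos_carrier by blast
    then have "y \<ominus>\<^bsub>L\<^esub> x \<in> M" using that assms(2) quot.a_rcos_module[of x y] by (simp add: M.minus_eq)
    then have "a \<odot>\<^bsub>L\<^esub> (y \<ominus>\<^bsub>L\<^esub> x) \<in> M" using assms(1) sub_smult by blast
    moreover have "a \<odot>\<^bsub>L\<^esub> (y \<ominus>\<^bsub>L\<^esub> x) = a \<odot>\<^bsub>L\<^esub> y \<ominus>\<^bsub>L\<^esub> a \<odot>\<^bsub>L\<^esub> x"
      using assms y by (simp add: a_minus_def smult_r_distr smult_r_minus)
    ultimately show ?thesis using assms y cls_eq_iff by simp
  qed
  moreover have "cls x \<noteq> {}" using quot.a_rcos_self[OF assms(2)] by blast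
  ultimately show ?thesis unfolding quotient_module_def by (simp add: SUP_eq_const)
qed

lemma quotient_module: "module A (quotient_module L M)"
proof (rule moduleI)
  show "cring A" by (rule R.cring_axioms)
  show "abelian_group (quotient_module L M)"
  proof (rule abelian_groupI)
    fix C assume "C \<in> carrier (quotient_module L M)"
    then obtain x where "x \<in> carrier L" "C = cls x" using cls_cases by auto
    then show "\<exists>D\<in>carrier (quotient_module L M). D \<oplus>\<^bsub>quotient_module L M\<^esub> C = \<zero>\<^bsub>quotient_module L M\<^esub>"
      by (intro bexI[of _ "cls (\<ominus>\<^bsub>L\<^esub> x)"]) (simp_all add: cls_add M.l_neg cls_sub)
    show "\<zero>\<^bsub>quotient_module L M\<^esub> \<oplus>\<^bsub>quotient_module L M\<^esub> C = C"
      using \<open>C \<in> _\<close> by (simp add: quot.rcosets_add_eq)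
  qed (auto dest!: cls_cases simp: cls_add M.a_ac quot.a_subgroup_in_rcosets)
qed (auto dest!: cls_cases simp: cls_add smult_l_distr smult_r_distr smult_assoc1)

end

section \<open>The kernel defining a tensor product\<close>

locale two_modules = N: module A N + T: module A T for A (structure) and N :: "('a, 'b, 'g) module_scheme" and T :: "('a, 'c, 'h) module_scheme"
begin

abbreviation FAG where "FAG \<equiv> free_Abelian_group (carrier N \<times> carrier T)"
abbreviation K where "K \<equiv> tensor_kernel A N T"

lemma relations_subset: "tensor_relations A N T \<subseteq> carrier FAG"
  unfolding tensor_relations_def
  by (auto dest!: subsetD[OF keys_diff])

lemma kernel_subgroup: "subgroup K FAG"
  unfolding tensor_kernel_def using relations_subset by (simp add: group.generate_is_subgroup)

lemma kernel_zero [simp]: "0 \<in> K"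
  using subgroup.one_closed[OF kernel_subgroup] by simp

lemma kernel_keys: "z \<in> K \<Longrightarrow> Poly_Mapping.keys z \<subseteq> carrier N \<times> carrier T"
  using subsetD[OF subgroup.subset[OF kernel_subgroup]] by simp

lemma kernel_add: "z \<in> K \<Longrightarrow> w \<in> K \<Longrightarrow> z + w \<in> K"
  using subgroup.m_closed[OF kernel_subgroup] by simp

lemma kernel_uminus: "z \<in> K \<Longrightarrow> - z \<in> K"
  using subgroup.m_inv_closed[OF kernel_subgroup] kernel_keys by fastforce

lemma kernel_diff: "z \<in> K \<Longrightarrow> w \<in> K \<Longrightarrow> z - w \<in> K"
  using kernel_add[of z "- w"] kernel_uminus by simp

text \<open>From here on, differences in \<open>K\<close> play the role of equalities between
  tensors.\<close>

lemma kernel_cong: "z - w \<in> K \<Longrightarrow> z \<in> K \<longleftrightarrow> w \<in> K"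
  using kernel_add[of "z - w" w] kernel_diff[of z "z - w"] by auto

lemma kernel_sum: "(\<And>i. i \<in> I \<Longrightarrow> z i \<in> K) \<Longrightarrow> sum z I \<in> K"
  by (induction I rule: infinite_finite_induct) (auto intro: kernel_add)

lemma kernel_add_left:
  "x \<in> carrier N \<Longrightarrow> x' \<in> carrier N \<Longrightarrow> y \<in> carrier T \<Longrightarrow>
    frag_of (x \<oplus>\<^bsub>N\<^esub> x', y) - frag_of (x, y) - frag_of (x', y) \<in> K"
  unfolding tensor_kernel_def tensor_relations_def by (rule generate.incl) blast

lemma kernel_add_right:
  "x \<in> carrier N \<Longrightarrow> y \<in> carrier T \<Longrightarrow> y' \<in> carrier T \<Longrightarrow>
    frag_of (x, y \<oplus>\<^bsub>T\<^esub> y') - frag_of (x, y) - frag_of (x, y') \<in> K"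
  unfolding tensor_kernel_def tensor_relations_def by (rule generate.incl) blast

lemma kernel_smult:
  "b \<in> carrier A \<Longrightarrow> x \<in> carrier N \<Longrightarrow> y \<in> carrier T \<Longrightarrow>
    frag_of (b \<odot>\<^bsub>N\<^esub> x, y) - frag_of (x, b \<odot>\<^bsub>T\<^esub> y) \<in> K"
  unfolding tensor_kernel_def tensor_relations_def by (rule generate.incl) blast

lemma kernel_zero_left: "y \<in> carrier T \<Longrightarrow> frag_of (\<zero>\<^bsub>N\<^esub>, y) \<in> K"
  using kernel_uminus[OF kernel_add_left[of "\<zero>\<^bsub>N\<^esub>" "\<zero>\<^bsub>N\<^esub>" y]] by simp

lemma kernel_zero_right: "x \<in> carrier N \<Longrightarrow> frag_of (x, \<zero>\<^bsub>T\<^esub>) \<in> K"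
  using kernel_uminus[OF kernel_add_right[of x "\<zero>\<^bsub>T\<^esub>" "\<zero>\<^bsub>T\<^esub>"]] by simp

lemma kernel_minus_left:
  assumes "x \<in> carrier N" "x' \<in> carrier N" "y \<in> carrier T"
  shows "frag_of (x \<ominus>\<^bsub>N\<^esub> x', y) - frag_of (x, y) + frag_of (x', y) \<in> K"
proof -
  have "(x \<ominus>\<^bsub>N\<^esub> x') \<oplus>\<^bsub>N\<^esub> x' = x" using assms by (simp add: N.M.minus_eq N.M.a_assoc N.M.l_neg)
  then have "frag_of (x, y) - frag_of (x \<ominus>\<^bsub>N\<^esub> x', y) - frag_of (x', y) \<in> K"
    using kernel_add_left[of "x \<ominus>\<^bsub>N\<^esub> x'" x' y] assms by simp
  from kernel_uminus[OF this] show ?thesis by (simp add: algebra_simps)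
qed

text \<open>Each summand costs one additivity relation and one relation moving the scalar across.
  The lemma transfers the coordinates of an element of the right factor to the left factor.\<close>

lemma kernel_sum_right:
  assumes "finite F" "x \<in> carrier N" "g \<in> F \<rightarrow> carrier A" "e \<in> F \<rightarrow> carrier T"
  shows "frag_of (x, \<Oplus>\<^bsub>T\<^esub>i\<in>F. g i \<odot>\<^bsub>T\<^esub> e i) - (\<Sum>i\<in>F. frag_of (g i \<odot>\<^bsub>N\<^esub> x, e i)) \<in> K"
  using assms(1,3,4)
proof (induction F)
  case empty
  then show ?case using kernel_zero_right[OF assms(2)] by simp
next
  case (insert j F)
  let ?s = "\<Oplus>\<^bsub>T\<^esub>i\<in>F. g i \<odot>\<^bsub>T\<^esub> e i"
  have c: "g j \<in> carrier A" "e j \<in> carrier T" "?s \<in> carrier T"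
    using insert by (auto intro!: T.M.finsum_closed)
  have "frag_of (x, g j \<odot>\<^bsub>T\<^esub> e j \<oplus>\<^bsub>T\<^esub> ?s) - frag_of (x, g j \<odot>\<^bsub>T\<^esub> e j) - frag_of (x, ?s) \<in> K"
    using c assms(2) by (intro kernel_add_right) auto
  moreover have "frag_of (g j \<odot>\<^bsub>N\<^esub> x, e j) - frag_of (x, g j \<odot>\<^bsub>T\<^esub> e j) \<in> K"
    using c assms(2) by (intro kernel_smult) auto
  moreover have "frag_of (x, ?s) - (\<Sum>i\<in>F. frag_of (g i \<odot>\<^bsub>N\<^esub> x, e i)) \<in> K"
    using insert by auto
  ultimately have *: "(frag_of (x, g j \<odot>\<^bsub>T\<^esub> e j \<oplus>\<^bsub>T\<^esub> ?s) - frag_of (x, g j \<odot>\<^bsub>T\<^esub> e j) - frag_of (x, ?s))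
     - (frag_of (g j \<odot>\<^bsub>N\<^esub> x, e j) - frag_of (x, g j \<odot>\<^bsub>T\<^esub> e j)) + (frag_of (x, ?s) - (\<Sum>i\<in>F. frag_of (g i \<odot>\<^bsub>N\<^esub> x, e i))) \<in> K"
    by (rule kernel_add[OF kernel_diff])
  have eq: "a - b - s - (c - b) + (s - d) = a - (c + d)" for a b c d s :: "('b \<times> 'c) \<Rightarrow>\<^sub>0 int"
    by (simp add: algebra_simps)
  have "(\<Oplus>\<^bsub>T\<^esub>i\<in>insert j F. g i \<odot>\<^bsub>T\<^esub> e i) = g j \<odot>\<^bsub>T\<^esub> e j \<oplus>\<^bsub>T\<^esub> ?s"
    using insert c by (intro T.M.finsum_insert) auto
  moreover have "(\<Sum>i\<in>insert j F. frag_of (g i \<odot>\<^bsub>N\<^esub> x, e i)) = frag_of (g j \<odot>\<^bsub>N\<^esub> x, e j) + (\<Sum>i\<in>F. frag_of (g i \<odot>\<^bsub>N\<^esub> x, e i))"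
    using insert.hyps by simp
  ultimately show ?case using *[unfolded eq] by simp
qed

lemma rcoset_eq: "K #>\<^bsub>FAG\<^esub> z = (\<lambda>k. k + z) ` K"
  by (auto simp: r_coset_def)

lemma rcoset_eq_iff: "K #>\<^bsub>FAG\<^esub> z = K #>\<^bsub>FAG\<^esub> w \<longleftrightarrow> z - w \<in> K"
proof
  assume "K #>\<^bsub>FAG\<^esub> z = K #>\<^bsub>FAG\<^esub> w"
  moreover have "z \<in> K #>\<^bsub>FAG\<^esub> z" unfolding rcoset_eq by (rule image_eqI[of _ _ 0]) auto
  ultimately show "z - w \<in> K" by (auto simp: rcoset_eq)
next
  have *: "K #>\<^bsub>FAG\<^esub> z \<subseteq> K #>\<^bsub>FAG\<^esub> w" if "z - w \<in> K" for z w
  proof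
    fix v assume "v \<in> K #>\<^bsub>FAG\<^esub> z"
    then obtain k where "k \<in> K" "v = (k + (z - w)) + w" by (auto simp: rcoset_eq)
    then show "v \<in> K #>\<^bsub>FAG\<^esub> w" unfolding rcoset_eq using kernel_add[OF _ that] by blast
  qed
  assume "z - w \<in> K"
  then show "K #>\<^bsub>FAG\<^esub> z = K #>\<^bsub>FAG\<^esub> w"
    using * kernel_uminus[of "z - w"] by (metis minus_diff_eq subset_antisym)
qed

end

lemma module_homD:
  assumes "f \<in> module_hom A N' N" "x \<in> carrier N'"
  shows "f x \<in> carrier N" "y \<in> carrier N' \<Longrightarrow> f (x \<oplus>\<^bsub>N'\<^esub> y) = f x \<oplus>\<^bsub>N\<^esub> f y"
    "b \<in> carrier A \<Longrightarrow> f (b \<odot>\<^bsub>N'\<^esub> x) = b \<odot>\<^bsub>N\<^esub> f x"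
  using assms by (auto simp: module_hom_def hom_def)

text \<open>\<open>F\<close> sends relations to relations, so the induced map is well defined and
  additive on cosets; for such a map injectivity means trivial kernel. The flatness proofs then work
  with kernels only and mention no coset of \<open>K\<close>.\<close>

lemma tensor_inj_iff:
  assumes "module A N'" "module A N" "module A T" "f \<in> module_hom A N' N"
  defines "F \<equiv> frag_extend (\<lambda>(x, y). frag_of (f x, y))"
  shows "inj_on (tensor_map A N T f) (carrier (tensor_product A N' T)) \<longleftrightarrow>
    (\<forall>z. Poly_Mapping.keys z \<subseteq> carrier N' \<times> carrier T \<longrightarrow> F z \<in> tensor_kernel A N T \<longrightarrow> z \<in> tensor_kernel A N' T)"
proof -
  interpret D: two_modules A N' T using assms by (simp add: two_modules_def)
  interpret C: two_modules A N T using assms by (simp add: two_modules_def)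
  have F_rel: "F z \<in> C.K" if "z \<in> tensor_relations A N' T" for z
    using that unfolding tensor_relations_def
    by (auto simp: F_def frag_extend_diff module_homD[OF assms(4)]
        intro!: C.kernel_add_left C.kernel_add_right C.kernel_smult module_homD(1)[OF assms(4)])
  have F_ker: "F z \<in> C.K" if "z \<in> D.K" for z
    using that unfolding tensor_kernel_def[of A N' T]
  proof induction
    case (inv h)
    then have "Poly_Mapping.keys h \<subseteq> carrier N' \<times> carrier T"
      using subsetD[OF D.relations_subset inv] by simp
    then show ?case using C.kernel_uminus[OF F_rel[OF inv]] by (simp add: F_def frag_extend_minus)
  qed (auto simp: F_def frag_extend_add C.kernel_add F_rel[unfolded F_def])
  \<comment> \<open>All members of the coset of \<open>z\<close> contribute the same coset to the
    union in \<open>tensor_map\<close>, since \<open>F\<close> maps kernel to kernel.\<close>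
  have map: "tensor_map A N T f (D.K #>\<^bsub>D.FAG\<^esub> z) = C.K #>\<^bsub>C.FAG\<^esub> F z" for z
  proof -
    have "C.K #>\<^bsub>C.FAG\<^esub> F (k + z) = C.K #>\<^bsub>C.FAG\<^esub> F z" if "k \<in> D.K" for k
      using F_ker[OF that] by (simp add: C.rcoset_eq_iff F_def frag_extend_add)
    then have "(\<Union>w\<in>D.K #>\<^bsub>D.FAG\<^esub> z. C.K #>\<^bsub>C.FAG\<^esub> F w) = C.K #>\<^bsub>C.FAG\<^esub> F z"
      by (intro SUP_eq_const) (use D.kernel_zero in \<open>auto simp: D.rcoset_eq simp del: D.kernel_zero\<close>)
    then show ?thesis by (simp add: tensor_map_def F_def)
  qed
  have carr: "carrier (tensor_product A N' T) = (\<lambda>z. D.K #>\<^bsub>D.FAG\<^esub> z) ` {z. Poly_Mapping.keys z \<subseteq> carrier N' \<times> carrier T}"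
    by (auto simp: tensor_product_def FactGroup_def RCOSETS_def)
  have diff: "F (z - w) = F z - F w" for z w by (simp add: F_def frag_extend_diff)
  show ?thesis
  proof (intro iffI allI impI)
    fix z assume inj: "inj_on (tensor_map A N T f) (carrier (tensor_product A N' T))"
      and z: "Poly_Mapping.keys z \<subseteq> carrier N' \<times> carrier T" "F z \<in> C.K"
    have "tensor_map A N T f (D.K #>\<^bsub>D.FAG\<^esub> z) = tensor_map A N T f (D.K #>\<^bsub>D.FAG\<^esub> 0)"
      using z(2) by (simp add: map C.rcoset_eq_iff diff[symmetric])
    then have "D.K #>\<^bsub>D.FAG\<^esub> z = D.K #>\<^bsub>D.FAG\<^esub> 0"
      using inj z(1) by (auto simp: carr inj_on_def)
    then show "z \<in> D.K" by (simp add: D.rcoset_eq_iff)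
  next
    assume *: "\<forall>z. Poly_Mapping.keys z \<subseteq> carrier N' \<times> carrier T \<longrightarrow> F z \<in> C.K \<longrightarrow> z \<in> D.K"
    show "inj_on (tensor_map A N T f) (carrier (tensor_product A N' T))"
    proof (rule inj_onI)
      fix X Y assume "X \<in> carrier (tensor_product A N' T)" "Y \<in> carrier (tensor_product A N' T)"
        and eq: "tensor_map A N T f X = tensor_map A N T f Y"
      then obtain z w where z: "X = D.K #>\<^bsub>D.FAG\<^esub> z" "Poly_Mapping.keys z \<subseteq> carrier N' \<times> carrier T"
        "Y = D.K #>\<^bsub>D.FAG\<^esub> w" "Poly_Mapping.keys w \<subseteq> carrier N' \<times> carrier T" by (auto simp: carr)
      have "F (z - w) \<in> C.K" using eq by (simp add: z map C.rcoset_eq_iff diff)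
      moreover have "Poly_Mapping.keys (z - w) \<subseteq> carrier N' \<times> carrier T"
        using z keys_diff[of z w] by blast
      ultimately show "X = Y" using * by (simp add: z D.rcoset_eq_iff)
    qed
  qed
qed

section \<open>Flatness of quotients of modules with coordinates\<close>

lemma (in abelian_group) a_inv_zero [simp]: "\<ominus> \<zero> = \<zero>"
  using l_neg[of \<zero>] by simp

text \<open>The axioms are those of a dual basis: generators \<open>b\<close> with linear coordinate
  functions \<open>co\<close>. In \<open>expansion\<close> the set \<open>F\<close> may exceed the
  support, so that several elements can be expanded over one finite set.\<close>

locale coordinate_module = module A L for A (structure) and L :: "('a, 'l, 'g) module_scheme" +
  fixes E :: "'i set" and b :: "'i \<Rightarrow> 'l" and co :: "'l \<Rightarrow> 'i \<Rightarrow> 'a"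
  assumes co_closed [simp]: "x \<in> carrier L \<Longrightarrow> i \<in> E \<Longrightarrow> co x i \<in> carrier A"
    and b_closed [simp]: "i \<in> E \<Longrightarrow> b i \<in> carrier L"
    and co_add [simp]: "x \<in> carrier L \<Longrightarrow> y \<in> carrier L \<Longrightarrow> i \<in> E \<Longrightarrow> co (x \<oplus>\<^bsub>L\<^esub> y) i = co x i \<oplus> co y i"
    and co_smult [simp]: "c \<in> carrier A \<Longrightarrow> x \<in> carrier L \<Longrightarrow> i \<in> E \<Longrightarrow> co (c \<odot>\<^bsub>L\<^esub> x) i = c \<otimes> co x i"
    and co_finite: "x \<in> carrier L \<Longrightarrow> finite {i \<in> E. co x i \<noteq> \<zero>}"
    and expansion: "x \<in> carrier L \<Longrightarrow> finite F \<Longrightarrow> {i \<in> E. co x i \<noteq> \<zero>} \<subseteq> F \<Longrightarrow> F \<subseteq> E \<Longrightarrow>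
      x = (\<Oplus>\<^bsub>L\<^esub>i\<in>F. co x i \<odot>\<^bsub>L\<^esub> b i)"
begin

lemma co_zero [simp]: "i \<in> E \<Longrightarrow> co \<zero>\<^bsub>L\<^esub> i = \<zero>"
  using co_smult[of \<zero> "\<zero>\<^bsub>L\<^esub>" i] by simp

lemma co_minus [simp]: "x \<in> carrier L \<Longrightarrow> i \<in> E \<Longrightarrow> co (\<ominus>\<^bsub>L\<^esub> x) i = \<ominus> co x i"
  using co_smult[of "\<ominus> \<one>" x i] by (simp add: smult_l_minus R.l_minus)

lemma co_diff [simp]: "x \<in> carrier L \<Longrightarrow> y \<in> carrier L \<Longrightarrow> i \<in> E \<Longrightarrow> co (x \<ominus>\<^bsub>L\<^esub> y) i = co x i \<ominus> co y i"
  by (simp add: a_minus_def)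

lemma co_inject:
  assumes "x \<in> carrier L" "y \<in> carrier L" "\<And>i. i \<in> E \<Longrightarrow> co x i = co y i"
  shows "x = y"
proof -
  have "x \<ominus>\<^bsub>L\<^esub> y = \<zero>\<^bsub>L\<^esub>"
    using expansion[of "x \<ominus>\<^bsub>L\<^esub> y" "{}"] assms by (simp add: R.r_neg R.minus_eq)
  moreover have "x = (x \<ominus>\<^bsub>L\<^esub> y) \<oplus>\<^bsub>L\<^esub> y" using assms by (simp add: M.minus_eq M.a_assoc M.l_neg)
  ultimately show ?thesis using assms by simp
qed

end

text \<open>The coordinates, with values in \<open>N\<close>, of \<open>\<Sum>\<^sub>j x\<^sub>j \<otimes> m\<^sub>j\<close>, where the list consists of the pairs \<open>(x\<^sub>j, m\<^sub>j)\<close>.\<close>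

primrec coord_sum :: "('a, 'c, 'g) module_scheme \<Rightarrow> ('l \<Rightarrow> 'i \<Rightarrow> 'a) \<Rightarrow> ('c \<times> 'l) list \<Rightarrow> 'i \<Rightarrow> 'c" where
  "coord_sum N co [] i = \<zero>\<^bsub>N\<^esub>"
| "coord_sum N co (p # ps) i = co (snd p) i \<odot>\<^bsub>N\<^esub> fst p \<oplus>\<^bsub>N\<^esub> coord_sum N co ps i"

locale coordinate_quotient = coordinate_module A L E b co + module_with_submodule A L M
  for A (structure) and L :: "('a, 'l, 'g) module_scheme" and E :: "'i set" and b and co and M
begin

abbreviation Q where "Q \<equiv> quotient_module L M"

lemma finsum_cls:
  assumes "finite F" "g \<in> F \<rightarrow> carrier L"
  shows "(\<Oplus>\<^bsub>Q\<^esub>i\<in>F. cls (g i)) = cls (\<Oplus>\<^bsub>L\<^esub>i\<in>F. g i)"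
  using assms
proof (induction F)
  case empty
  then show ?case
    using module.axioms(2)[OF quotient_module] cls_sub[of "\<zero>\<^bsub>L\<^esub>"] quot.zero_closed
    by (simp add: abelian_monoid.finsum_empty abelian_group.axioms)
next
  case (insert j F)
  interpret Q: abelian_group Q using module.axioms(2)[OF quotient_module] .
  have "(\<Oplus>\<^bsub>Q\<^esub>i\<in>insert j F. cls (g i)) = cls (g j) \<oplus>\<^bsub>Q\<^esub> (\<Oplus>\<^bsub>Q\<^esub>i\<in>F. cls (g i))"
    using insert by (intro Q.finsum_insert) (auto simp: Pi_iff)
  also have "\<dots> = cls (g j \<oplus>\<^bsub>L\<^esub> (\<Oplus>\<^bsub>L\<^esub>i\<in>F. g i))"
    using insert by (simp add: cls_add Pi_iff)
  finally show ?case using insert by (simp add: Pi_iff)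
qed

text \<open>An arbitrary section of the projection, not linear in general. Its defects of linearity
  lie in \<open>M\<close>, and through them elements of \<open>M\<close> enter the coordinates of
  the tensor relations.\<close>

definition rep where "rep C = (SOME x. x \<in> carrier L \<and> C = cls x)"

lemma rep: "C \<in> a_rcosets\<^bsub>L\<^esub> M \<Longrightarrow> rep C \<in> carrier L" "C \<in> a_rcosets\<^bsub>L\<^esub> M \<Longrightarrow> cls (rep C) = C"
  unfolding rep_def using someI_ex[of "\<lambda>x. x \<in> carrier L \<and> C = cls x"] cls_cases[of C] by auto

end

section \<open>Coordinates of tensors with a quotient module\<close>

locale coordinate_quotient_tensor =
  coordinate_quotient A L E b co M + N: module A N
  for A (structure) and L :: "('a, 'l, 'g) module_scheme" and E :: "'i set" and b and co and M
    and N :: "('a, 'c, 'h) module_scheme"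
begin

sublocale T: two_modules A N "quotient_module L M"
  unfolding two_modules_def using N.module_axioms quotient_module by blast

lemma coord_sum_closed [simp]:
  "set ps \<subseteq> carrier N \<times> carrier L \<Longrightarrow> i \<in> E \<Longrightarrow> coord_sum N co ps i \<in> carrier N"
  by (induction ps) auto

lemma coord_sum_append:
  "set ps \<subseteq> carrier N \<times> carrier L \<Longrightarrow> set qs \<subseteq> carrier N \<times> carrier L \<Longrightarrow> i \<in> E \<Longrightarrow>
    coord_sum N co (ps @ qs) i = coord_sum N co ps i \<oplus>\<^bsub>N\<^esub> coord_sum N co qs i"
  by (induction ps) (auto simp: N.M.a_assoc)

lemma coord_sum_uminus:
  "set ps \<subseteq> carrier N \<times> carrier L \<Longrightarrow> i \<in> E \<Longrightarrow>
    coord_sum N co (map (\<lambda>(x, m). (\<ominus>\<^bsub>N\<^esub> x, m)) ps) i = \<ominus>\<^bsub>N\<^esub> coord_sum N co ps i"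
  by (induction ps) (auto simp: N.smult_r_minus N.M.minus_add N.M.a_inv_zero)

text \<open>The coordinates of a tensor depend on the choice of representatives, so they are defined
  on the free abelian group, before the relations are divided out; there the universal property
  requires no compatibility.\<close>

definition is_coord_hom where
  "is_coord_hom \<phi> \<longleftrightarrow> (\<forall>i\<in>E. \<phi> i \<in> hom T.FAG (add_monoid N) \<and>
     (\<forall>x\<in>carrier N. \<forall>y\<in>a_rcosets\<^bsub>L\<^esub> M. \<phi> i (frag_of (x, y)) = co (rep y) i \<odot>\<^bsub>N\<^esub> x))"

lemma coord_hom_exists: "\<exists>\<phi>. is_coord_hom \<phi>"
proof -
  have "\<exists>h\<in>hom T.FAG (add_monoid N). \<forall>x\<in>carrier N. \<forall>y\<in>a_rcosets\<^bsub>L\<^esub> M. h (frag_of (x, y)) = co (rep y) i \<odot>\<^bsub>N\<^esub> x"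
    if "i \<in> E" for i
  proof -
    have "(\<lambda>(x, y). co (rep y) i \<odot>\<^bsub>N\<^esub> x) ` (carrier N \<times> carrier Q) \<subseteq> carrier (add_monoid N)"
      using that by (auto simp: rep)
    from comm_group.free_Abelian_group_universal[OF N.M.a_comm_group this] obtain h where
      "h \<in> hom T.FAG (add_monoid N)"
      "\<And>p. p \<in> carrier N \<times> carrier Q \<Longrightarrow> h (frag_of p) = (case p of (x, y) \<Rightarrow> co (rep y) i \<odot>\<^bsub>N\<^esub> x)"
      by blast
    then show ?thesis by (intro bexI[of _ h]) auto
  qed
  then obtain \<phi> where "\<forall>i\<in>E. \<phi> i \<in> hom T.FAG (add_monoid N) \<and>
     (\<forall>x\<in>carrier N. \<forall>y\<in>a_rcosets\<^bsub>L\<^esub> M. \<phi> i (frag_of (x, y)) = co (rep y) i \<odot>\<^bsub>N\<^esub> x)" by metis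
  then show ?thesis unfolding is_coord_hom_def by blast
qed

context
  fixes \<phi> assumes coord_hom: "is_coord_hom \<phi>"
begin

lemma group_hom: "i \<in> E \<Longrightarrow> group_hom T.FAG (add_monoid N) (\<phi> i)"
  using coord_hom N.M.a_group by (simp add: is_coord_hom_def group_hom_def group_hom_axioms_def)

lemma coord_hom_of:
  "i \<in> E \<Longrightarrow> x \<in> carrier N \<Longrightarrow> y \<in> a_rcosets\<^bsub>L\<^esub> M \<Longrightarrow> \<phi> i (frag_of (x, y)) = co (rep y) i \<odot>\<^bsub>N\<^esub> x"
  using coord_hom by (simp add: is_coord_hom_def)

lemma coord_hom_closed:
  "i \<in> E \<Longrightarrow> Poly_Mapping.keys z \<subseteq> carrier N \<times> a_rcosets\<^bsub>L\<^esub> M \<Longrightarrow> \<phi> i z \<in> carrier N"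
  using group_hom.hom_closed[OF group_hom] by fastforce

lemma coord_hom_zero: "i \<in> E \<Longrightarrow> \<phi> i 0 = \<zero>\<^bsub>N\<^esub>"
  using group_hom.hom_one[OF group_hom] by simp

lemma coord_hom_add:
  "i \<in> E \<Longrightarrow> Poly_Mapping.keys z \<subseteq> carrier N \<times> a_rcosets\<^bsub>L\<^esub> M \<Longrightarrow> Poly_Mapping.keys w \<subseteq> carrier N \<times> a_rcosets\<^bsub>L\<^esub> M \<Longrightarrow>
    \<phi> i (z + w) = \<phi> i z \<oplus>\<^bsub>N\<^esub> \<phi> i w"
  using group_hom.hom_mult[OF group_hom, of i z w] by simp

lemma coord_hom_uminus:
  "i \<in> E \<Longrightarrow> Poly_Mapping.keys z \<subseteq> carrier N \<times> a_rcosets\<^bsub>L\<^esub> M \<Longrightarrow> \<phi> i (- z) = \<ominus>\<^bsub>N\<^esub> \<phi> i z"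
  using group_hom.hom_inv[OF group_hom, of i z] by (simp add: a_inv_def)

lemma coord_hom_diff:
  "i \<in> E \<Longrightarrow> Poly_Mapping.keys z \<subseteq> carrier N \<times> a_rcosets\<^bsub>L\<^esub> M \<Longrightarrow> Poly_Mapping.keys w \<subseteq> carrier N \<times> a_rcosets\<^bsub>L\<^esub> M \<Longrightarrow>
    \<phi> i (z - w) = \<phi> i z \<ominus>\<^bsub>N\<^esub> \<phi> i w"
  using coord_hom_add[of i z "- w"] by (simp add: coord_hom_uminus N.M.minus_eq)

text \<open>A relation of additivity in the left factor has coordinates zero. The other two kinds
  have those of \<open>x \<otimes> m\<close>, where \<open>m \<in> M\<close> is the defect of
  \<open>rep\<close> at a sum or at a scalar multiple. Inverses and sums in the subgroup become sign
  changes and concatenations of lists.\<close>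

lemma kernel_imp_coord_sum:
  assumes "z \<in> T.K"
  shows "\<exists>ps. set ps \<subseteq> carrier N \<times> M \<and> (\<forall>i\<in>E. \<phi> i z = coord_sum N co ps i)"
proof -
  have keys_diff3: "Poly_Mapping.keys (frag_of p - frag_of q - frag_of s) \<subseteq> S"
    if "p \<in> S" "q \<in> S" "s \<in> S" for p q s :: "'c \<times> 'l set" and S
    using that keys_diff[of "frag_of p - frag_of q" "frag_of s"] keys_diff[of "frag_of p" "frag_of q"] by auto
  have rel: "\<exists>ps. set ps \<subseteq> carrier N \<times> M \<and> (\<forall>i\<in>E. \<phi> i z = coord_sum N co ps i)"
    if "z \<in> tensor_relations A N Q" for z
    using that unfolding tensor_relations_def
  proof (elim UnE CollectE exE conjE)
    fix x x' y assume z: "z = frag_of (x \<oplus>\<^bsub>N\<^esub> x', y) - frag_of (x, y) - frag_of (x', y)"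
      "x \<in> carrier N" "x' \<in> carrier N" "y \<in> carrier Q"
    then have "\<phi> i z = \<zero>\<^bsub>N\<^esub>" if "i \<in> E" for i
      using that keys_diff[of "frag_of (x \<oplus>\<^bsub>N\<^esub> x', y)" "frag_of (x, y)"]
      by (subst z(1), subst coord_hom_diff) 
        (auto simp: coord_hom_diff coord_hom_of rep N.smult_r_distr N.M.minus_eq N.M.a_ac N.M.r_neg
          N.M.r_neg1 N.M.r_neg2)
    then show ?thesis by (intro exI[of _ "[]"]) auto
  next
    fix x y y' assume z: "z = frag_of (x, y \<oplus>\<^bsub>Q\<^esub> y') - frag_of (x, y) - frag_of (x, y')"
      "x \<in> carrier N" "y \<in> carrier Q" "y' \<in> carrier Q"
    let ?y = "y \<oplus>\<^bsub>Q\<^esub> y'"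
    have y: "?y \<in> a_rcosets\<^bsub>L\<^esub> M" using z(3,4) cls_cases by (auto simp: cls_add) (metis cls_add cls_cases cls_closed M.add.m_closed)
    define m where "m = rep ?y \<ominus>\<^bsub>L\<^esub> (rep y \<oplus>\<^bsub>L\<^esub> rep y')"
    have "cls (rep ?y) = cls (rep y \<oplus>\<^bsub>L\<^esub> rep y')"
      using y z(3,4) by (simp add: rep cls_add[symmetric])
    moreover have "rep ?y \<in> carrier L" "rep y \<oplus>\<^bsub>L\<^esub> rep y' \<in> carrier L"
      using rep(1)[OF y] z(3,4) by (auto simp: rep)
    ultimately have m: "m \<in> M" using cls_eq_iff unfolding m_def by blast
    have "\<phi> i z = co m i \<odot>\<^bsub>N\<^esub> x" if "i \<in> E" for i
    proof -
      have "\<phi> i z = \<phi> i (frag_of (x, ?y)) \<ominus>\<^bsub>N\<^esub> \<phi> i (frag_of (x, y)) \<ominus>\<^bsub>N\<^esub> \<phi> i (frag_of (x, y'))"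
        using that z(2-) y keys_diff[of "frag_of (x, ?y)" "frag_of (x, y)"]
        by (subst z(1), subst coord_hom_diff) (auto simp: coord_hom_diff)
      also have "\<dots> = co (rep ?y) i \<odot>\<^bsub>N\<^esub> x \<ominus>\<^bsub>N\<^esub> co (rep y) i \<odot>\<^bsub>N\<^esub> x \<ominus>\<^bsub>N\<^esub> co (rep y') i \<odot>\<^bsub>N\<^esub> x"
        using that y z(2-) by (simp add: coord_hom_of del: quotient_module_simps(3))
      also have "\<dots> = co m i \<odot>\<^bsub>N\<^esub> x"
        using that y z(2-) by (simp add: m_def rep N.smult_l_distr N.smult_l_minus a_minus_def R.minus_add N.M.a_assoc del: quotient_module_simps(3))
      finally show ?thesis .
    qed
    then show ?thesis using m z(2) sub_carrier by (intro exI[of _ "[(x, m)]"]) auto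
  next
    fix c x y assume z: "z = frag_of (c \<odot>\<^bsub>N\<^esub> x, y) - frag_of (x, c \<odot>\<^bsub>Q\<^esub> y)"
      "c \<in> carrier A" "x \<in> carrier N" "y \<in> carrier Q"
    let ?y = "c \<odot>\<^bsub>Q\<^esub> y"
    have "?y = cls (c \<odot>\<^bsub>L\<^esub> rep y)" using z rep[of y] by (metis cls_smult quotient_module_simps(1))
    then have y: "?y \<in> a_rcosets\<^bsub>L\<^esub> M" "cls (c \<odot>\<^bsub>L\<^esub> rep y) = cls (rep ?y)" using z rep by simp_all
    define m where "m = c \<odot>\<^bsub>L\<^esub> rep y \<ominus>\<^bsub>L\<^esub> rep ?y"
    have "c \<odot>\<^bsub>L\<^esub> rep y \<in> carrier L" "rep ?y \<in> carrier L" using y(1) z by (auto simp: rep)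
    then have m: "m \<in> M" using cls_eq_iff y(2) unfolding m_def by blast
    have "\<phi> i z = co m i \<odot>\<^bsub>N\<^esub> x" if "i \<in> E" for i
    proof -
      have "\<phi> i z = \<phi> i (frag_of (c \<odot>\<^bsub>N\<^esub> x, y)) \<ominus>\<^bsub>N\<^esub> \<phi> i (frag_of (x, ?y))"
        using that z(2-) y by (subst z(1), subst coord_hom_diff) auto
      also have "\<dots> = co m i \<odot>\<^bsub>N\<^esub> x"
        using that y z(2-) by (simp add: coord_hom_of m_def rep N.smult_l_distr N.smult_l_minus a_minus_def R.m_comm flip: N.smult_assoc1)
      finally show ?thesis .
    qed
    then show ?thesis using m z(3) sub_carrier by (intro exI[of _ "[(x, m)]"]) auto
  qed
  have sub: "set ps \<subseteq> carrier N \<times> carrier L" if "set ps \<subseteq> carrier N \<times> M" for ps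
    using that sub_subset by blast
  show ?thesis using assms unfolding tensor_kernel_def
  proof induction
    case one
    then show ?case by (intro exI[of _ "[]"]) (simp add: coord_hom_zero)
  next
    case (incl h)
    then show ?case by (rule rel)
  next
    case (inv h)
    then obtain ps where ps: "set ps \<subseteq> carrier N \<times> M" "\<forall>i\<in>E. \<phi> i h = coord_sum N co ps i" using rel by blast
    have k: "Poly_Mapping.keys h \<subseteq> carrier N \<times> carrier Q"
      using subsetD[OF T.relations_subset inv] by simp
    show ?case
      using ps k coord_sum_uminus[OF sub[OF ps(1)]]
      by (intro exI[of _ "map (\<lambda>(x, m). (\<ominus>\<^bsub>N\<^esub> x, m)) ps"]) (auto simp: coord_hom_uminus)
  next
    case (eng h1 h2)
    then obtain ps qs where *: "set ps \<subseteq> carrier N \<times> M" "\<forall>i\<in>E. \<phi> i h1 = coord_sum N co ps i"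
      "set qs \<subseteq> carrier N \<times> M" "\<forall>i\<in>E. \<phi> i h2 = coord_sum N co qs i" by blast
    have "Poly_Mapping.keys h1 \<subseteq> carrier N \<times> carrier Q" "Poly_Mapping.keys h2 \<subseteq> carrier N \<times> carrier Q"
      using T.kernel_keys eng by (auto simp: tensor_kernel_def)
    then show ?case using * coord_sum_append[OF sub[OF *(1)] sub[OF *(3)]]
      by (intro exI[of _ "ps @ qs"]) (auto simp: coord_hom_add)
  qed
qed

end

end

context coordinate_quotient_tensor
begin

lemma kernel_expand:
  assumes "x \<in> carrier N" "y \<in> carrier L" "finite F" "{i \<in> E. co y i \<noteq> \<zero>} \<subseteq> F" "F \<subseteq> E"
  shows "frag_of (x, cls y) - (\<Sum>i\<in>F. frag_of (co y i \<odot>\<^bsub>N\<^esub> x, cls (b i))) \<in> T.K"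
proof -
  have "(\<Oplus>\<^bsub>Q\<^esub>i\<in>F. co y i \<odot>\<^bsub>Q\<^esub> cls (b i)) = (\<Oplus>\<^bsub>Q\<^esub>i\<in>F. cls (co y i \<odot>\<^bsub>L\<^esub> b i))"
    using assms module.axioms(2)[OF quotient_module]
    by (intro abelian_monoid.finsum_cong' abelian_group.axioms(1)) auto
  also have "\<dots> = cls (\<Oplus>\<^bsub>L\<^esub>i\<in>F. co y i \<odot>\<^bsub>L\<^esub> b i)"
    using assms by (intro finsum_cls) auto
  also have "\<dots> = cls y" using expansion[OF assms(2-5)] by simp
  finally have "(\<Oplus>\<^bsub>Q\<^esub>i\<in>F. co y i \<odot>\<^bsub>Q\<^esub> cls (b i)) = cls y" .
  moreover have "co y \<in> F \<rightarrow> carrier A" "(\<lambda>i. cls (b i)) \<in> F \<rightarrow> carrier Q" using assms by auto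
  ultimately show ?thesis
    using T.kernel_sum_right[of F x "co y" "\<lambda>i. cls (b i)"] assms(1,3) by simp
qed

text \<open>Each \<open>x \<otimes> m\<close> with \<open>m \<in> M\<close> vanishes in the tensor
  product, hence so does its expansion, which is valid for every finite \<open>F\<close> containing
  the support of \<open>m\<close>. The filter of finite subsets combines the supports of all pairs
  without naming a common bound.\<close>

lemma eventually_kernel_coord_sum:
  assumes "set ps \<subseteq> carrier N \<times> M"
  shows "\<forall>\<^sub>F F in finite_subsets_at_top E. (\<Sum>i\<in>F. frag_of (coord_sum N co ps i, cls (b i))) \<in> T.K"
  using assms
proof (induction ps)
  case Nil
  then show ?case
    by (intro eventually_finite_subsets_at_top_weakI) (auto intro!: T.kernel_sum T.kernel_zero_left)
next
  case (Cons p ps)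
  obtain x m where p: "p = (x, m)" "x \<in> carrier N" "m \<in> M" using Cons.prems by (cases p) auto
  have ps: "set ps \<subseteq> carrier N \<times> carrier L" using Cons.prems sub_subset by auto
  have "\<forall>\<^sub>F F in finite_subsets_at_top E. finite F \<and> F \<subseteq> E \<and> {i \<in> E. co m i \<noteq> \<zero>} \<subseteq> F"
    unfolding eventually_finite_subsets_at_top using co_finite[of m] p(3) sub_carrier
    by (intro exI[of _ "{i \<in> E. co m i \<noteq> \<zero>}"]) auto
  moreover have "\<forall>\<^sub>F F in finite_subsets_at_top E. (\<Sum>i\<in>F. frag_of (coord_sum N co ps i, cls (b i))) \<in> T.K"
    using Cons by simp
  ultimately show ?case
  proof eventually_elim
    case prems: (elim F)
    then have F: "finite F" "F \<subseteq> E" "{i \<in> E. co m i \<noteq> \<zero>} \<subseteq> F" by auto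
    let ?s = "coord_sum N co ps" and ?e = "\<lambda>i. cls (b i)"
    have "frag_of (x, cls m) \<in> T.K" using T.kernel_zero_right[OF p(2)] p(3) by (simp add: cls_sub)
    then have 1: "(\<Sum>i\<in>F. frag_of (co m i \<odot>\<^bsub>N\<^esub> x, ?e i)) \<in> T.K"
      using T.kernel_diff[OF _ kernel_expand[OF p(2) sub_carrier[OF p(3)] F(1,3,2)]] by fastforce
    have "(\<Sum>i\<in>F. frag_of (co m i \<odot>\<^bsub>N\<^esub> x \<oplus>\<^bsub>N\<^esub> ?s i, ?e i) - frag_of (co m i \<odot>\<^bsub>N\<^esub> x, ?e i) - frag_of (?s i, ?e i)) \<in> T.K"
      using F(2) p ps sub_carrier by (intro T.kernel_sum T.kernel_add_left) auto
    then have "(\<Sum>i\<in>F. frag_of (co m i \<odot>\<^bsub>N\<^esub> x \<oplus>\<^bsub>N\<^esub> ?s i, ?e i)) - (\<Sum>i\<in>F. frag_of (co m i \<odot>\<^bsub>N\<^esub> x, ?e i)) - (\<Sum>i\<in>F. frag_of (?s i, ?e i)) \<in> T.K"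
      by (simp add: sum_subtractf)
    moreover have "(\<Sum>i\<in>F. frag_of (?s i, ?e i)) \<in> T.K" using prems by simp
    ultimately have "(\<Sum>i\<in>F. frag_of (co m i \<odot>\<^bsub>N\<^esub> x \<oplus>\<^bsub>N\<^esub> ?s i, ?e i)) \<in> T.K"
      using 1 T.kernel_cong by blast
    then show ?case by (simp add: p)
  qed
qed

context
  fixes \<phi> assumes coord_hom: "is_coord_hom \<phi>"
begin

text \<open>A tensor is recovered from its coordinates. By \<open>kernel_minus_left\<close> the
  claim passes to differences, so it suffices to treat a generator \<open>(x, y)\<close>, where it
  is the expansion of \<open>rep y\<close>.\<close>

lemma eventually_kernel_expand:
  assumes "Poly_Mapping.keys z \<subseteq> carrier N \<times> carrier Q"
  shows "\<forall>\<^sub>F F in finite_subsets_at_top E. z - (\<Sum>i\<in>F. frag_of (\<phi> i z, cls (b i))) \<in> T.K"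
  using assms
proof (induction z rule: free_Abelian_group_induct[consumes 1, case_names zero diff of])
  case zero
  show ?case
  proof (rule eventually_finite_subsets_at_top_weakI)
    fix F assume "F \<subseteq> E"
    then have "(\<Sum>i\<in>F. frag_of (\<phi> i 0, cls (b i))) = (\<Sum>i\<in>F. frag_of (\<zero>\<^bsub>N\<^esub>, cls (b i)))"
      by (intro sum.cong) (auto simp: coord_hom_zero[OF coord_hom])
    moreover have "(\<Sum>i\<in>F. frag_of (\<zero>\<^bsub>N\<^esub>, cls (b i))) \<in> T.K"
      using \<open>F \<subseteq> E\<close> by (intro T.kernel_sum T.kernel_zero_left) auto
    ultimately show "0 - (\<Sum>i\<in>F. frag_of (\<phi> i 0, cls (b i))) \<in> T.K"
      using T.kernel_uminus by simp
  qed
next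
  case (diff z w)
  note z = diff(1)[simplified quotient_module_simps] diff(2)[simplified quotient_module_simps]
  have "\<forall>\<^sub>F F in finite_subsets_at_top E. finite F \<and> F \<subseteq> E"
    by (intro eventually_finite_subsets_at_top_weakI) auto
  with diff(3,4) show ?case
  proof eventually_elim
    case (elim F)
    let ?e = "\<lambda>i. cls (b i)"
    have "(\<Sum>i\<in>F. frag_of (\<phi> i z \<ominus>\<^bsub>N\<^esub> \<phi> i w, ?e i) - frag_of (\<phi> i z, ?e i) + frag_of (\<phi> i w, ?e i)) \<in> T.K"
      using elim z coord_hom_closed[OF coord_hom] by (intro T.kernel_sum T.kernel_minus_left) auto
    also have "(\<Sum>i\<in>F. frag_of (\<phi> i z \<ominus>\<^bsub>N\<^esub> \<phi> i w, ?e i) - frag_of (\<phi> i z, ?e i) + frag_of (\<phi> i w, ?e i)) =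
      (\<Sum>i\<in>F. frag_of (\<phi> i (z - w), ?e i) - frag_of (\<phi> i z, ?e i) + frag_of (\<phi> i w, ?e i))"
      using elim z by (intro sum.cong) (auto simp: coord_hom_diff[OF coord_hom])
    finally have "(\<Sum>i\<in>F. frag_of (\<phi> i (z - w), ?e i)) - (\<Sum>i\<in>F. frag_of (\<phi> i z, ?e i)) + (\<Sum>i\<in>F. frag_of (\<phi> i w, ?e i)) \<in> T.K"
      by (simp add: sum.distrib sum_subtractf)
    then have *: "(z - (\<Sum>i\<in>F. frag_of (\<phi> i z, ?e i))) - (w - (\<Sum>i\<in>F. frag_of (\<phi> i w, ?e i))) -
      ((\<Sum>i\<in>F. frag_of (\<phi> i (z - w), ?e i)) - (\<Sum>i\<in>F. frag_of (\<phi> i z, ?e i)) + (\<Sum>i\<in>F. frag_of (\<phi> i w, ?e i))) \<in> T.K"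
      using elim by (intro T.kernel_diff[OF T.kernel_diff]) auto
    have "(z - p) - (w - q) - (r - p + q) = (z - w) - r" for p q r :: "('c \<times> 'l set) \<Rightarrow>\<^sub>0 int"
      by (simp add: algebra_simps)
    then show ?case using * by simp
  qed
next
  case (of p)
  then obtain x y where p: "p = (x, y)" "x \<in> carrier N" "y \<in> a_rcosets\<^bsub>L\<^esub> M" by auto
  then have y: "rep y \<in> carrier L" "cls (rep y) = y" by (simp_all add: rep)
  have "\<forall>\<^sub>F F in finite_subsets_at_top E. finite F \<and> F \<subseteq> E \<and> {i \<in> E. co (rep y) i \<noteq> \<zero>} \<subseteq> F"
    unfolding eventually_finite_subsets_at_top using co_finite[OF y(1)]
    by (intro exI[of _ "{i \<in> E. co (rep y) i \<noteq> \<zero>}"]) auto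
  then show ?case
  proof eventually_elim
    case (elim F)
    then have "frag_of (x, y) - (\<Sum>i\<in>F. frag_of (co (rep y) i \<odot>\<^bsub>N\<^esub> x, cls (b i))) \<in> T.K"
      using kernel_expand[OF p(2) y(1), of F] by (simp add: y(2))
    also have "(\<Sum>i\<in>F. frag_of (co (rep y) i \<odot>\<^bsub>N\<^esub> x, cls (b i))) = (\<Sum>i\<in>F. frag_of (\<phi> i (frag_of p), cls (b i)))"
      using elim p by (intro sum.cong) (auto simp: coord_hom_of[OF coord_hom])
    finally show ?case by (simp add: p)
  qed
qed

text \<open>Together with \<open>kernel_imp_coord_sum\<close> this describes the tensor product as
  coordinate families in \<open>N\<close> modulo those of the sums of \<open>x \<otimes> m\<close>
  with \<open>m \<in> M\<close>.\<close>

lemma coord_sum_imp_kernel: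
  assumes "Poly_Mapping.keys z \<subseteq> carrier N \<times> carrier Q" "set ps \<subseteq> carrier N \<times> M"
    "\<And>i. i \<in> E \<Longrightarrow> \<phi> i z = coord_sum N co ps i"
  shows "z \<in> T.K"
proof -
  have "\<forall>\<^sub>F F in finite_subsets_at_top E. F \<subseteq> E"
    by (intro eventually_finite_subsets_at_top_weakI) auto
  with eventually_kernel_expand[OF assms(1)] eventually_kernel_coord_sum[OF assms(2)]
  have "\<forall>\<^sub>F F in finite_subsets_at_top E. z \<in> T.K"
  proof eventually_elim
    case (elim F)
    then have "(\<Sum>i\<in>F. frag_of (\<phi> i z, cls (b i))) = (\<Sum>i\<in>F. frag_of (coord_sum N co ps i, cls (b i)))"
      using assms(3) by (intro sum.cong) auto
    then show ?case using elim T.kernel_cong[OF elim(1)] by simp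
  qed
  \<comment> \<open>The claim does not depend on \<open>F\<close>, and the filter is proper.\<close>
  then show ?thesis by (auto simp: eventually_finite_subsets_at_top)
qed

end

end

section \<open>Purity and flatness over a uniserial ring\<close>

locale uniserial_coordinate_quotient =
  coordinate_quotient A L E b co M + uniserial_ring A t
  for A (structure) and L :: "('a, 'l, 'g) module_scheme" and E :: "'i set" and b and co and M and t
begin

text \<open>All coordinates lying in \<open>t^e A\<close> means membership in \<open>t^e L\<close>,
  so that purity becomes a condition on coordinates.\<close>

definition pure where
  "pure \<longleftrightarrow> (\<forall>e. \<forall>m\<in>M. (\<forall>i\<in>E. co m i \<in> PIdl (t [^] (e::nat))) \<longrightarrow> (\<exists>m'\<in>M. m = t [^] e \<odot>\<^bsub>L\<^esub> m'))"

lemma pureD: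
  "pure \<Longrightarrow> m \<in> M \<Longrightarrow> (\<And>i. i \<in> E \<Longrightarrow> co m i \<in> PIdl (t [^] (e::nat))) \<Longrightarrow> \<exists>m'\<in>M. m = t [^] e \<odot>\<^bsub>L\<^esub> m'"
  unfolding pure_def by blast

text \<open>The multiple \<open>co m X \<otimes> v\<close> of \<open>m'\<close> is subtracted from
  every \<open>m\<close> of the list. Weighted with the \<open>x\<close>, the subtracted parts add
  up to \<open>m'\<close> weighted with \<open>v\<close> times the coordinate \<open>X\<close> of
  the whole sum. That coordinate is known to lie in the submodule, in contrast to the single
  \<open>x\<close>.\<close>

lemma coord_sum_elimination:
  assumes "module A N" "set ps \<subseteq> carrier N \<times> M" "m' \<in> M" "X \<in> E" "i \<in> E" "v \<in> carrier A"
  shows "coord_sum N co ps i = (co m' i \<otimes> v) \<odot>\<^bsub>N\<^esub> coord_sum N co ps X \<oplus>\<^bsub>N\<^esub>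
    coord_sum N co (map (\<lambda>(x, m). (x, m \<ominus>\<^bsub>L\<^esub> (co m X \<otimes> v) \<odot>\<^bsub>L\<^esub> m')) ps) i"
proof -
  interpret coordinate_quotient_tensor A L E b co M N
    using assms(1) coordinate_quotient_axioms by (simp add: coordinate_quotient_tensor_def)
  show ?thesis using assms(2)
  proof (induction ps)
    case Nil
    then show ?case using assms sub_carrier by simp
  next
    case (Cons p ps)
    obtain x m where p: "p = (x, m)" "x \<in> carrier N" "m \<in> M" using Cons.prems by (cases p) auto
    have c: "m \<in> carrier L" "m' \<in> carrier L" using p assms sub_carrier by auto
    have ps: "set ps \<subseteq> carrier N \<times> carrier L" using Cons.prems sub_subset by auto
    let ?g = "\<lambda>(x, m). (x, m \<ominus>\<^bsub>L\<^esub> (co m X \<otimes> v) \<odot>\<^bsub>L\<^esub> m')"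
    have ps': "set (map ?g ps) \<subseteq> carrier N \<times> carrier L" using ps c assms by auto
    let ?s = "coord_sum N co ps" and ?s' = "coord_sum N co (map ?g ps) i" and ?k = "co m' i \<otimes> v"
    have cl: "?s X \<in> carrier N" "?s' \<in> carrier N" "?k \<in> carrier A" "co m X \<in> carrier A" "co m i \<in> carrier A"
      using ps ps' c assms coord_sum_closed by auto
    have IH: "?s i = ?k \<odot>\<^bsub>N\<^esub> ?s X \<oplus>\<^bsub>N\<^esub> ?s'" using Cons by simp
    have 1: "co m i \<odot>\<^bsub>N\<^esub> x = (?k \<otimes> co m X) \<odot>\<^bsub>N\<^esub> x \<oplus>\<^bsub>N\<^esub> (co m i \<ominus> ?k \<otimes> co m X) \<odot>\<^bsub>N\<^esub> x"
    proof -
      have "co m i = ?k \<otimes> co m X \<oplus> (co m i \<ominus> ?k \<otimes> co m X)"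
        using cl by (simp add: R.minus_eq R.a_lcomm R.r_neg)
      then have "co m i \<odot>\<^bsub>N\<^esub> x = (?k \<otimes> co m X \<oplus> (co m i \<ominus> ?k \<otimes> co m X)) \<odot>\<^bsub>N\<^esub> x" by (rule arg_cong)
      also have "\<dots> = (?k \<otimes> co m X) \<odot>\<^bsub>N\<^esub> x \<oplus>\<^bsub>N\<^esub> (co m i \<ominus> ?k \<otimes> co m X) \<odot>\<^bsub>N\<^esub> x"
        using cl p(2) by (intro N.smult_l_distr) auto
      finally show ?thesis .
    qed
    have 2: "co (m \<ominus>\<^bsub>L\<^esub> (co m X \<otimes> v) \<odot>\<^bsub>L\<^esub> m') i = co m i \<ominus> ?k \<otimes> co m X"
      using c assms by (simp add: R.m_ac)
    have "coord_sum N co (p # ps) i = co m i \<odot>\<^bsub>N\<^esub> x \<oplus>\<^bsub>N\<^esub> (?k \<odot>\<^bsub>N\<^esub> ?s X \<oplus>\<^bsub>N\<^esub> ?s')"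
      by (simp add: p IH)
    also have "\<dots> = ((?k \<otimes> co m X) \<odot>\<^bsub>N\<^esub> x \<oplus>\<^bsub>N\<^esub> ?k \<odot>\<^bsub>N\<^esub> ?s X) \<oplus>\<^bsub>N\<^esub> ((co m i \<ominus> ?k \<otimes> co m X) \<odot>\<^bsub>N\<^esub> x \<oplus>\<^bsub>N\<^esub> ?s')"
      unfolding 1 using cl p by (simp add: N.M.a_ac)
    also have "\<dots> = ?k \<odot>\<^bsub>N\<^esub> (co m X \<odot>\<^bsub>N\<^esub> x \<oplus>\<^bsub>N\<^esub> ?s X) \<oplus>\<^bsub>N\<^esub> ((co m i \<ominus> ?k \<otimes> co m X) \<odot>\<^bsub>N\<^esub> x \<oplus>\<^bsub>N\<^esub> ?s')"
      using cl p by (simp add: N.smult_r_distr N.smult_assoc1)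
    finally show ?case by (simp add: p 2 del: co_diff)
  qed
qed

text \<open>
  Gaussian elimination: an \<open>m\<close> having a coordinate of least valuation \<open>e\<close> is \<open>t\<^sup>e m'\<close> with \<open>m' \<in> M\<close>
  having a coordinate that is a unit, and the corresponding coordinate of the sum is the coefficient
  with which \<open>m'\<close> has to be subtracted in order to eliminate \<open>m\<close>.
\<close>

lemma pure_coord_sum:
  assumes pure "module A N" "submodule N' A N"
    and "set ps \<subseteq> carrier N \<times> M" "\<And>i. i \<in> E \<Longrightarrow> coord_sum N co ps i \<in> N'"
  shows "\<exists>qs. set qs \<subseteq> N' \<times> M \<and> (\<forall>i\<in>E. coord_sum N co ps i = coord_sum N co qs i)"
  using assms(4,5)
proof (induction "length ps" arbitrary: ps rule: less_induct)
  case less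
  interpret coordinate_quotient_tensor A L E b co M N
    using assms(2) coordinate_quotient_axioms by (simp add: coordinate_quotient_tensor_def)
  note N' = N.submoduleE[OF assms(3)]
  have psL: "set ps \<subseteq> carrier N \<times> carrier L" using less.prems sub_subset by blast
  show ?case
  proof (cases "\<forall>p\<in>set ps. \<forall>i\<in>E. co (snd p) i = \<zero>")
    case True
    then have "coord_sum N co ps i = \<zero>\<^bsub>N\<^esub>" if "i \<in> E" for i
      using psL that by (induction ps) auto
    then show ?thesis by (intro exI[of _ "[]"]) auto
  next
    case False
    \<comment> \<open>The valuations of the non-zero coordinates of all the \<open>m\<close> in the
      list.\<close>
    define S where "S j \<longleftrightarrow> (\<exists>p\<in>set ps. \<exists>i\<in>E. \<exists>u\<in>Units A. co (snd p) i = t [^] j \<otimes> u \<and> co (snd p) i \<noteq> \<zero>)" for j :: nat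
    have in_S: "\<exists>j u. u \<in> Units A \<and> co (snd p) i = t [^] j \<otimes> u \<and> S j" if pi: "p \<in> set ps" "i \<in> E" "co (snd p) i \<noteq> \<zero>" for p i
    proof -
      have "co (snd p) i \<in> carrier A" using pi psL by auto
      then obtain j :: nat and u where ju: "u \<in> Units A" "co (snd p) i = t [^] j \<otimes> u"
        using factor pi(3) by blast
      then have "S j" unfolding S_def using pi by blast
      then show ?thesis using ju by blast
    qed
    then have "\<exists>j. S j" using False by blast
    define e where "e = (LEAST j. S j)"
    have "S e" unfolding e_def using \<open>\<exists>j. S j\<close> by (rule LeastI_ex)
    then obtain p X u where p: "p \<in> set ps" "X \<in> E" "u \<in> Units A" "co (snd p) X = t [^] e \<otimes> u" "co (snd p) X \<noteq> \<zero>"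
      unfolding S_def by blast
    obtain x1 m1 where xm: "p = (x1, m1)" "x1 \<in> carrier N" "m1 \<in> M" using p(1) less.prems(1) by (cases p) auto
    have "co m1 i \<in> PIdl (t [^] e)" if i: "i \<in> E" for i
    proof (cases "co m1 i = \<zero>")
      case False
      then obtain j v where j: "v \<in> Units A" "co m1 i = t [^] j \<otimes> v" "S j" using in_S[OF p(1) i] xm by auto
      then have "e \<le> j" by (simp add: e_def Least_le)
      then show ?thesis using j power_antimono[of e j] by (auto simp: mem_power_iff subset_iff)
    qed auto
    then obtain m' where m': "m' \<in> M" "m1 = t [^] e \<odot>\<^bsub>L\<^esub> m'" using pureD assms(1) xm(3) by blast
    have c: "m1 \<in> carrier L" "m' \<in> carrier L" using xm m' sub_carrier by auto
    define w where "w = co m' X"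
    \<comment> \<open>The pivot coordinate is non-zero, hence so is \<open>t^e\<close>; this is what
      makes \<open>w\<close> a unit in \<open>t^e w = t^e u\<close>, where \<open>t^e\<close> cannot
      be cancelled.\<close>
    have te: "t [^] e \<noteq> \<zero>" using p(3,4,5) by auto
    have w1: "t [^] e \<otimes> w = t [^] e \<otimes> u" using p(2,4) c xm m'(2) by (simp add: w_def)
    then have "w \<in> Units A"
      using unit_if_not_mem[of w e] unit_times_not_mem[OF p(3) te] c p(2) by (simp add: w_def)
    then have w: "w \<in> carrier A" "inv w \<in> carrier A" "w \<otimes> inv w = \<one>" by auto
    let ?g = "\<lambda>(x, m). (x, m \<ominus>\<^bsub>L\<^esub> (co m X \<otimes> inv w) \<odot>\<^bsub>L\<^esub> m')"
    obtain ps1 ps2 where ps: "ps = ps1 @ (x1, m1) # ps2" using p(1) xm(1) by (meson split_list)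
    have sets: "set ps1 \<subseteq> carrier N \<times> carrier L" "set ps2 \<subseteq> carrier N \<times> carrier L" using psL ps by auto
    have gM: "set (map ?g qs) \<subseteq> carrier N \<times> M" if "set qs \<subseteq> carrier N \<times> M" for qs
      using that m' p(2) w sub_carrier by (auto simp: a_minus_def intro!: sub_add sub_minus sub_smult)
    have gps: "set (map ?g (ps1 @ ps2)) \<subseteq> carrier N \<times> M" using less.prems(1) ps by (intro gM) auto
    have gL: "set (map ?g ps1) \<subseteq> carrier N \<times> carrier L" "set (map ?g ps2) \<subseteq> carrier N \<times> carrier L"
      using gps sub_subset by auto
    \<comment> \<open>The new left factor is a multiple of the coordinate \<open>X\<close> of the
      given sum, and therefore an element of \<open>N'\<close>.\<close>
    define y where "y = inv w \<odot>\<^bsub>N\<^esub> coord_sum N co ps X"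
    have y: "y \<in> N'" "y \<in> carrier N" using N' w less.prems(2)[OF p(2)] by (auto simp: y_def)
    have eq: "coord_sum N co ps i = co m' i \<odot>\<^bsub>N\<^esub> y \<oplus>\<^bsub>N\<^esub> coord_sum N co (map ?g (ps1 @ ps2)) i" if i: "i \<in> E" for i
    proof -
      have "m1 \<ominus>\<^bsub>L\<^esub> (co m1 X \<otimes> inv w) \<odot>\<^bsub>L\<^esub> m' = \<zero>\<^bsub>L\<^esub>"
      proof -
        have "co m1 X \<otimes> inv w = t [^] e" using p(2) c w by (simp add: m'(2) w_def[symmetric] R.m_assoc)
        then show ?thesis using m' c by (simp add: M.r_neg M.minus_eq)
      qed
      then have "coord_sum N co (map ?g ps) i = coord_sum N co (map ?g (ps1 @ ps2)) i"
        using i gL xm coord_sum_append[OF gL i] coord_sum_append[of "map ?g ps1" "map ?g ((x1, m1) # ps2)" i]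
        by (simp add: ps)
      moreover have "(co m' i \<otimes> inv w) \<odot>\<^bsub>N\<^esub> coord_sum N co ps X = co m' i \<odot>\<^bsub>N\<^esub> y"
        using i c w p(2) psL by (simp add: y_def N.smult_assoc1)
      ultimately show ?thesis
        using coord_sum_elimination[OF assms(2) less.prems(1) m'(1) p(2) i w(2)] by simp
    qed
    have "coord_sum N co (map ?g (ps1 @ ps2)) i \<in> N'" if i: "i \<in> E" for i
    proof -
      have s: "coord_sum N co (map ?g (ps1 @ ps2)) i \<in> carrier N"
        using gps sub_subset i by (intro coord_sum_closed) auto
      have "co m' i \<odot>\<^bsub>N\<^esub> y \<in> N'" using N' y c i by auto
      then have "\<ominus>\<^bsub>N\<^esub> (co m' i \<odot>\<^bsub>N\<^esub> y) \<oplus>\<^bsub>N\<^esub> coord_sum N co ps i \<in> N'"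
        using N' less.prems(2)[OF i] by auto
      then show ?thesis using s y c i by (simp add: eq N.M.r_neg1 N.M.r_neg2)
    qed
    from less.hyps[OF _ gps this] obtain qs where qs: "set qs \<subseteq> N' \<times> M"
      "\<forall>i\<in>E. coord_sum N co (map ?g (ps1 @ ps2)) i = coord_sum N co qs i"
      by (auto simp: ps)
    then show ?thesis using y m' eq by (intro exI[of _ "(y, m') # qs"]) auto
  qed
qed

text \<open>The injection \<open>f\<close> identifies \<open>N'\<close> with its image in
  \<open>N\<close>. The coordinates of an element that dies in \<open>N \<otimes> L/M\<close> are
  rewritten by elimination with left factors in this image, and these are pulled back along
  \<open>f\<close>.\<close>

lemma pure_imp_flat:
  assumes pure
  shows "flat_module U A Q"
  unfolding flat_module_def
proof (intro conjI allI impI, rule quotient_module)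
  fix N' N :: "('a, 'v) module" and f
  assume "module A N' \<and> module A N \<and> f \<in> module_hom A N' N \<and> inj_on f (carrier N')"
  then have mods: "module A N'" "module A N" and f: "f \<in> module_hom A N' N" "inj_on f (carrier N')" by auto
  note hom = module_homD[OF f(1)]
  interpret D: coordinate_quotient_tensor A L E b co M N'
    using mods coordinate_quotient_axioms by (simp add: coordinate_quotient_tensor_def)
  interpret C: coordinate_quotient_tensor A L E b co M N
    using mods coordinate_quotient_axioms by (simp add: coordinate_quotient_tensor_def)
  obtain \<phi> \<phi>' where \<phi>: "C.is_coord_hom \<phi>" "D.is_coord_hom \<phi>'"
    using C.coord_hom_exists D.coord_hom_exists by blast
  have f_zero: "f \<zero>\<^bsub>N'\<^esub> = \<zero>\<^bsub>N\<^esub>"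
    using hom(3)[of "\<zero>\<^bsub>N'\<^esub>" \<zero>] hom(1)[of "\<zero>\<^bsub>N'\<^esub>"] by simp
  have f_minus: "f (\<ominus>\<^bsub>N'\<^esub> x) = \<ominus>\<^bsub>N\<^esub> f x" if "x \<in> carrier N'" for x
    using hom(3)[of x "\<ominus> \<one>"] hom(1) that by (simp add: C.N.smult_l_minus D.N.smult_l_minus)
  define F where "F = frag_extend (\<lambda>(x, y :: 'l set). frag_of (f x, y))"
  have keys_F: "Poly_Mapping.keys (F z) \<subseteq> carrier N \<times> carrier Q"
    if "Poly_Mapping.keys z \<subseteq> carrier N' \<times> carrier Q" for z
  proof
    fix q assume "q \<in> Poly_Mapping.keys (F z)"
    then obtain x y where "(x, y) \<in> Poly_Mapping.keys z" "q = (f x, y)"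
      using subsetD[OF keys_frag_extend] by (fastforce simp: F_def)
    then show "q \<in> carrier N \<times> carrier Q" using that hom(1) by auto
  qed
  \<comment> \<open>Coordinates are natural in the module because both families use the same
    representatives: \<open>rep\<close> depends on \<open>L\<close> and \<open>M\<close>
    only.\<close>
  have nat: "\<phi> i (F z) = f (\<phi>' i z)" if "Poly_Mapping.keys z \<subseteq> carrier N' \<times> carrier Q" "i \<in> E" for z i
    using that(1)
  proof (induction z rule: free_Abelian_group_induct[consumes 1, case_names zero diff of])
    case zero
    then show ?case
      using that(2) by (simp add: F_def C.coord_hom_zero[OF \<phi>(1)] D.coord_hom_zero[OF \<phi>(2)] f_zero)
  next
    case (diff z w)
    have "F (z - w) = F z - F w" by (simp add: F_def frag_extend_diff)
    moreover have "\<phi>' i z \<in> carrier N'" "\<phi>' i w \<in> carrier N'"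
      using that(2) diff D.coord_hom_closed[OF \<phi>(2)] by auto
    ultimately show ?case
      using that(2) diff keys_F[OF diff(1)] keys_F[OF diff(2)]
      by (simp add: C.coord_hom_diff[OF \<phi>(1)] D.coord_hom_diff[OF \<phi>(2)] a_minus_def hom f_minus)
  next
    case (of p)
    then show ?case
      using that(2) by (auto simp: F_def C.coord_hom_of[OF \<phi>(1)] D.coord_hom_of[OF \<phi>(2)] hom rep)
  qed
  have im: "submodule (f ` carrier N') A N"
  proof (rule C.N.submoduleI)
    show "f ` carrier N' \<subseteq> carrier N" using hom(1) by auto
    show "\<zero>\<^bsub>N\<^esub> \<in> f ` carrier N'" using f_zero by (metis D.N.M.zero_closed imageI)
    show "\<ominus>\<^bsub>N\<^esub> y \<in> f ` carrier N'" if "y \<in> f ` carrier N'" for y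
      using that f_minus by (auto simp flip: f_minus)
    show "y \<oplus>\<^bsub>N\<^esub> y' \<in> f ` carrier N'" if "y \<in> f ` carrier N'" "y' \<in> f ` carrier N'" for y y'
      using that by (auto simp flip: hom(2))
    show "c \<odot>\<^bsub>N\<^esub> y \<in> f ` carrier N'" if "c \<in> carrier A" "y \<in> f ` carrier N'" for c y
      using that by (auto simp flip: hom(3))
  qed
  have "z \<in> D.T.K" if z: "Poly_Mapping.keys z \<subseteq> carrier N' \<times> carrier Q" "F z \<in> C.T.K" for z
  proof -
    obtain ps where ps: "set ps \<subseteq> carrier N \<times> M" "\<forall>i\<in>E. \<phi> i (F z) = coord_sum N co ps i"
      using C.kernel_imp_coord_sum[OF \<phi>(1) z(2)] by blast
    have cl: "\<phi>' i z \<in> carrier N'" if "i \<in> E" for i using z(1) that D.coord_hom_closed[OF \<phi>(2)] by simp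
    have "coord_sum N co ps i = f (\<phi>' i z)" if "i \<in> E" for i using that ps(2) nat[OF z(1)] by simp
    then have "coord_sum N co ps i \<in> f ` carrier N'" if "i \<in> E" for i using that cl by simp
    then obtain qs where qs: "set qs \<subseteq> f ` carrier N' \<times> M" "\<forall>i\<in>E. coord_sum N co ps i = coord_sum N co qs i"
      using pure_coord_sum[OF assms mods(2) im ps(1)] by blast
    define qs' where "qs' = map (\<lambda>(y, m). (inv_into (carrier N') f y, m)) qs"
    have qs': "set qs' \<subseteq> carrier N' \<times> M" using qs(1) by (auto simp: qs'_def inv_into_into)
    have "coord_sum N co qs i = f (coord_sum N' co qs' i)" if i: "i \<in> E" for i
      using qs(1) unfolding qs'_def
    proof (induction qs)
      case (Cons q qs)
      then obtain x m where q: "q = (f x, m)" "x \<in> carrier N'" "m \<in> M" by auto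
      have "set (map (\<lambda>(y, m). (inv_into (carrier N') f y, m)) qs) \<subseteq> carrier N' \<times> carrier L"
        using Cons.prems sub_subset by (auto simp: inv_into_into)
      then show ?case
        using Cons q i f(2) sub_carrier by (simp add: hom D.coord_sum_closed)
    qed (simp add: f_zero)
    then have "f (\<phi>' i z) = f (coord_sum N' co qs' i)" if "i \<in> E" for i
      using that qs(2) ps(2) nat[OF z(1)] by simp
    then have "\<phi>' i z = coord_sum N' co qs' i" if "i \<in> E" for i
    proof (rule inj_onD[OF f(2)])
      show "coord_sum N' co qs' i \<in> carrier N'"
        using that qs' sub_subset by (intro D.coord_sum_closed) auto
    qed (use that cl in auto)
    then show ?thesis using D.coord_sum_imp_kernel[OF \<phi>(2) z(1) qs'] by blast
  qed
  then show "inj_on (tensor_map A N Q f) (carrier (tensor_product A N' Q))"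
    using tensor_inj_iff[OF mods quotient_module f(1)] by (simp add: F_def)
qed

end

text \<open>A copy of the ideal \<open>J\<close> inside the sum type in which the test modules of
  the flatness condition live.\<close>

definition inl_module :: "('a, 'e) ring_scheme \<Rightarrow> 'a set \<Rightarrow> ('a, 'a + 'u) module" where
  "inl_module A J = \<lparr>carrier = Inl ` J, monoid.mult = undefined, one = undefined,
     ring.zero = Inl \<zero>\<^bsub>A\<^esub>, add = (\<lambda>x y. Inl (projl x \<oplus>\<^bsub>A\<^esub> projl y)),
     smult = (\<lambda>c x. Inl (c \<otimes>\<^bsub>A\<^esub> projl x))\<rparr>"

lemma inl_module_simps [simp]:
  "carrier (inl_module A J) = Inl ` J"
  "\<zero>\<^bsub>inl_module A J\<^esub> = Inl \<zero>\<^bsub>A\<^esub>"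
  "x \<oplus>\<^bsub>inl_module A J\<^esub> y = Inl (projl x \<oplus>\<^bsub>A\<^esub> projl y)"
  "c \<odot>\<^bsub>inl_module A J\<^esub> x = Inl (c \<otimes>\<^bsub>A\<^esub> projl x)"
  by (simp_all add: inl_module_def)

lemma (in cring) inl_module: "ideal J R \<Longrightarrow> module R (inl_module R J)"
proof -
  assume "ideal J R"
  then interpret ideal J R .
  show ?thesis
  proof (rule moduleI)
    show "abelian_group (inl_module R J)"
    proof (rule abelian_groupI)
      fix x assume "x \<in> carrier (inl_module R J)"
      then obtain a where "a \<in> J" "x = Inl a" by auto
      then show "\<exists>y\<in>carrier (inl_module R J). y \<oplus>\<^bsub>inl_module R J\<^esub> x = \<zero>\<^bsub>inl_module R J\<^esub>"
        by (intro bexI[of _ "Inl (\<ominus> a)"]) (auto simp: l_neg)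
    qed (auto simp: a_ac)
  qed (auto simp: l_distr r_distr m_assoc I_l_closed cring_axioms)
qed

context uniserial_coordinate_quotient
begin

text \<open>Write \<open>m = t^e l\<close>. In \<open>A \<otimes> L/M\<close> the tensor
  \<open>t^e \<otimes> l\<close> equals \<open>1 \<otimes> m = 0\<close>, so by flatness it vanishes
  already in \<open>t^e A \<otimes> L/M\<close>. There all left factors are multiples of
  \<open>t^e\<close>, so its coordinates are those of \<open>t^e m''\<close> for some
  \<open>m'' \<in> M\<close>.\<close>

lemma flat_imp_pure:
  assumes flat: "flat_module TYPE('a + 'u) A Q"
  shows pure
  unfolding pure_def
proof (intro allI ballI impI)
  fix e :: nat and m assume m: "m \<in> M" "\<forall>i\<in>E. co m i \<in> PIdl (t [^] e)"
  define J where "J = PIdl (t [^] e)"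
  define N' where "N' = (inl_module A J :: ('a, 'a + 'u) module)"
  define N where "N = (inl_module A (carrier A) :: ('a, 'a + 'u) module)"
  have mods: "module A N'" "module A N"
    using inl_module[OF power_ideal] inl_module[OF R.oneideal] by (simp_all add: J_def N_def N'_def)
  have teJ: "t [^] e \<in> J" by (simp add: J_def R.cgenideal_self)
  have JA: "J \<subseteq> carrier A" unfolding J_def using power_mem_carrier by blast
  interpret D: coordinate_quotient_tensor A L E b co M N'
    using mods coordinate_quotient_axioms by (simp add: coordinate_quotient_tensor_def)
  interpret C: coordinate_quotient_tensor A L E b co M N
    using mods coordinate_quotient_axioms by (simp add: coordinate_quotient_tensor_def)
  have id: "id \<in> module_hom A N' N"
    using JA by (auto simp: module_hom_def hom_def N_def N'_def)
  have mL: "m \<in> carrier L" using m(1) sub_carrier by blast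
  have "\<forall>i\<in>E. \<exists>c\<in>carrier A. co m i = t [^] e \<otimes> c" using m(2) by (simp add: mem_power_iff)
  then obtain c where c: "\<And>i. i \<in> E \<Longrightarrow> c i \<in> carrier A" "\<And>i. i \<in> E \<Longrightarrow> co m i = t [^] e \<otimes> c i" by metis
  define F where "F = {i \<in> E. co m i \<noteq> \<zero>}"
  have F: "finite F" "F \<subseteq> E" using co_finite[OF mL] by (auto simp: F_def)
  define l where "l = (\<Oplus>\<^bsub>L\<^esub>i\<in>F. c i \<odot>\<^bsub>L\<^esub> b i)"
  have l: "l \<in> carrier L" unfolding l_def using F c by (intro M.finsum_closed) auto
  have ml: "m = t [^] e \<odot>\<^bsub>L\<^esub> l"
  proof -
    have "t [^] e \<odot>\<^bsub>L\<^esub> l = (\<Oplus>\<^bsub>L\<^esub>i\<in>F. t [^] e \<odot>\<^bsub>L\<^esub> (c i \<odot>\<^bsub>L\<^esub> b i))"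
      unfolding l_def using F c by (intro finsum_smult_ldistr) auto
    also have "\<dots> = (\<Oplus>\<^bsub>L\<^esub>i\<in>F. co m i \<odot>\<^bsub>L\<^esub> b i)"
      using F c by (intro M.finsum_cong') (auto simp: smult_assoc1)
    also have "\<dots> = m" using expansion[OF mL F(1) _ F(2)] by (simp add: F_def)
    finally show ?thesis by simp
  qed
  define z where "z = frag_of (Inl (t [^] e) :: 'a + 'u, cls l)"
  have "frag_of (t [^] e \<odot>\<^bsub>N\<^esub> Inl \<one>, cls l) - frag_of (Inl \<one>, t [^] e \<odot>\<^bsub>Q\<^esub> cls l) \<in> C.T.K"
    using l by (intro C.T.kernel_smult) (auto simp: N_def)
  moreover have "t [^] e \<odot>\<^bsub>Q\<^esub> cls l = \<zero>\<^bsub>Q\<^esub>" using l m(1) by (simp add: ml[symmetric] cls_sub)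
  moreover have "frag_of (Inl \<one>, \<zero>\<^bsub>Q\<^esub>) \<in> C.T.K" by (intro C.T.kernel_zero_right) (simp add: N_def)
  ultimately have "z \<in> C.T.K" using C.T.kernel_cong by (simp add: z_def N_def)
  moreover have "inj_on (tensor_map A N Q id) (carrier (tensor_product A N' Q))"
    using flat mods id unfolding flat_module_def by auto
  moreover have "Poly_Mapping.keys z \<subseteq> carrier N' \<times> carrier Q" using teJ l by (simp add: z_def N'_def)
  moreover have "frag_extend (\<lambda>(x, y). frag_of (id x, y)) z = z" by (simp add: z_def)
  ultimately have z: "z \<in> D.T.K"
    using tensor_inj_iff[OF mods quotient_module id] by metis
  obtain \<phi> where \<phi>: "D.is_coord_hom \<phi>" using D.coord_hom_exists by blast
  obtain ps where ps: "set ps \<subseteq> carrier N' \<times> M" "\<forall>i\<in>E. \<phi> i z = coord_sum N' co ps i"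
    using D.kernel_imp_coord_sum[OF \<phi> z] by blast
  have "\<exists>m''\<in>M. \<forall>i\<in>E. coord_sum N' co ps i = Inl (t [^] e \<otimes> co m'' i)"
    using ps(1)
  proof (induction ps)
    case Nil
    show ?case by (intro bexI[of _ "\<zero>\<^bsub>L\<^esub>"]) (auto simp: N'_def quot.zero_closed)
  next
    case (Cons p ps)
    then obtain m'' where m'': "m'' \<in> M" "\<forall>i\<in>E. coord_sum N' co ps i = Inl (t [^] e \<otimes> co m'' i)" by auto
    obtain d k where p: "p = (Inl (t [^] e \<otimes> d), k)" "d \<in> carrier A" "k \<in> M"
      using Cons.prems by (auto simp: N'_def J_def mem_power_iff)
    have "co k i \<otimes> (t [^] e \<otimes> d) \<oplus> t [^] e \<otimes> co m'' i = t [^] e \<otimes> co (d \<odot>\<^bsub>L\<^esub> k \<oplus>\<^bsub>L\<^esub> m'') i"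
      if "i \<in> E" for i
      using that p m'' sub_carrier by (simp add: R.r_distr R.m_ac)
    then show ?case
      using p m'' by (intro bexI[of _ "d \<odot>\<^bsub>L\<^esub> k \<oplus>\<^bsub>L\<^esub> m''"]) (auto simp: N'_def intro: sub_add sub_smult)
  qed
  then obtain m'' where m'': "m'' \<in> M" "\<forall>i\<in>E. \<phi> i z = Inl (t [^] e \<otimes> co m'' i)" using ps(2) by auto
  define r where "r = rep (cls l)"
  have r: "r \<in> carrier L" "cls r = cls l" using l by (simp_all add: r_def rep)
  have co_r: "co r i \<otimes> t [^] e = t [^] e \<otimes> co m'' i" if "i \<in> E" for i
  proof -
    have "\<phi> i z = Inl (co r i \<otimes> t [^] e)"
      using D.coord_hom_of[OF \<phi> that, of "Inl (t [^] e)" "cls l"] teJ l by (simp add: z_def N'_def r_def)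
    then show ?thesis using m''(2) that by simp
  qed
  \<comment> \<open>The coordinates refer to the chosen representative \<open>r\<close> of the class
    of \<open>l\<close>; the difference lies in \<open>M\<close> and is added to
    \<open>m''\<close>.\<close>
  define d where "d = l \<ominus>\<^bsub>L\<^esub> r"
  have d: "d \<in> M" using cls_eq_iff[OF l r(1)] r(2) by (simp add: d_def)
  have dL: "d \<in> carrier L" "m'' \<in> carrier L" using d m''(1) sub_carrier by auto
  have ld: "l = r \<oplus>\<^bsub>L\<^esub> d"
    using l r(1) by (simp add: d_def M.minus_eq M.a_lcomm M.r_neg)
  have "m = t [^] e \<odot>\<^bsub>L\<^esub> (m'' \<oplus>\<^bsub>L\<^esub> d)"
  proof (rule co_inject[OF mL])
    fix i assume i: "i \<in> E"
    have "co m i = t [^] e \<otimes> co r i \<oplus> t [^] e \<otimes> co d i"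
      unfolding ml ld using i r(1) dL by (simp add: R.r_distr)
    then show "co m i = co (t [^] e \<odot>\<^bsub>L\<^esub> (m'' \<oplus>\<^bsub>L\<^esub> d)) i"
      using co_r[OF i] i dL r(1) by (simp add: R.r_distr R.m_comm)
  qed (use dL in auto)
  then show "\<exists>m'\<in>M. m = t [^] e \<odot>\<^bsub>L\<^esub> m'" using sub_add[OF m''(1) d] by blast
qed

end

section \<open>Dickson's lemma and term orders\<close>

declare split_paired_All [simp del] split_paired_Ex [simp del]

text \<open>A monotone subsequence that does not increase is decreasing, and then constant from the
  index on at which it attains its minimum.\<close>

lemma nat_mono_subseq: "\<exists>\<sigma> :: nat \<Rightarrow> nat. strict_mono \<sigma> \<and> mono (\<lambda>k. f (\<sigma> k))" for f :: "nat \<Rightarrow> nat"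
proof -
  obtain \<rho> where \<rho>: "strict_mono \<rho>" "monoseq (\<lambda>k. f (\<rho> k))" using seq_monosub[of f] by blast
  show ?thesis
  proof (cases "mono (\<lambda>k. f (\<rho> k))")
    case True
    then show ?thesis using \<rho>(1) by blast
  next
    case False
    then have dec: "f (\<rho> k) \<le> f (\<rho> j)" if "j \<le> k" for j k
      using \<rho>(2) that by (auto simp: monoseq_iff decseq_def incseq_def mono_def)
    define v where "v = (LEAST v. v \<in> range (\<lambda>k. f (\<rho> k)))"
    have "v \<in> range (\<lambda>k. f (\<rho> k))" unfolding v_def by (rule LeastI[of _ "f (\<rho> 0)"]) simp
    then obtain N where N: "f (\<rho> N) = v" by auto
    have "f (\<rho> k) = v" if "N \<le> k" for k
      using dec[OF that] N Least_le[of "\<lambda>v. v \<in> range (\<lambda>k. f (\<rho> k))" "f (\<rho> k)"] by (auto simp: v_def)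
    then have "mono (\<lambda>k. f (\<rho> (k + N)))" by (simp add: mono_def)
    moreover have "strict_mono (\<lambda>k. \<rho> (k + N))" using \<rho>(1) by (simp add: strict_mono_def)
    ultimately show ?thesis by blast
  qed
qed

lemma simultaneous_mono_subseq:
  "finite \<F> \<Longrightarrow> \<exists>\<sigma> :: nat \<Rightarrow> nat. strict_mono \<sigma> \<and> (\<forall>f\<in>\<F>. mono (\<lambda>k. f (s (\<sigma> k)) :: nat))"
proof (induction \<F> rule: finite_induct)
  case empty
  show ?case by (intro exI[of _ id]) (auto simp: strict_mono_def)
next
  case (insert f \<F>)
  then obtain \<sigma> :: "nat \<Rightarrow> nat" where \<sigma>: "strict_mono \<sigma>" "\<forall>f\<in>\<F>. mono (\<lambda>k. f (s (\<sigma> k)))" by blast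
  obtain \<tau> :: "nat \<Rightarrow> nat" where \<tau>: "strict_mono \<tau>" "mono (\<lambda>k. f (s (\<sigma> (\<tau> k))))"
    using nat_mono_subseq[of "\<lambda>k. f (s (\<sigma> k))"] by blast
  have "mono (\<lambda>k. g (s (\<sigma> (\<tau> k))))" if "g \<in> \<F>" for g
    using \<sigma>(2) that strict_mono_mono[OF \<tau>(1)] by (auto simp: mono_def)
  moreover have "strict_mono (\<lambda>k. \<sigma> (\<tau> k))" using \<sigma>(1) \<tau>(1) by (simp add: strict_mono_def)
  ultimately show ?case using \<tau>(2) by (intro exI[of _ "\<lambda>k. \<sigma> (\<tau> k)"]) auto
qed

lemma dickson:
  fixes s :: "nat \<Rightarrow> mterm \<times> nat"
  assumes "\<And>k. fst (s k) \<in> mterms n r"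
  shows "\<exists>p q. p < q \<and> mterm_dvd n (fst (s p)) (fst (s q)) \<and> snd (s p) \<le> snd (s q)"
proof -
  \<comment> \<open>If an index \<open>l\<close> and also \<open>r - l\<close> increase weakly, the
    index is constant, as divisibility of terms demands. The last function is the number attached to
    the term, later a valuation.\<close>
  define \<F> where "\<F> = (\<lambda>x (X :: mterm \<times> nat). count (fst (fst X)) x) ` {1..n} \<union>
    {\<lambda>X. snd (fst X), \<lambda>X. r - snd (fst X), snd}"
  obtain \<sigma> :: "nat \<Rightarrow> nat" where \<sigma>: "strict_mono \<sigma>" "\<forall>f\<in>\<F>. mono (\<lambda>k. f (s (\<sigma> k)))"
    using simultaneous_mono_subseq[of \<F> s] by (auto simp: \<F>_def)
  let ?X = "s (\<sigma> 0)" and ?Y = "s (\<sigma> 1)"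
  have le: "f ?X \<le> f ?Y" if "f \<in> \<F>" for f using \<sigma>(2) that by (auto simp: mono_def)
  have XY: "fst ?X \<in> mterms n r" "fst ?Y \<in> mterms n r" using assms by auto
  have "count (fst (fst ?X)) x \<le> count (fst (fst ?Y)) x" for x
  proof (cases "x \<in> {1..n}")
    case True
    then show ?thesis using le[of "\<lambda>X. count (fst (fst X)) x"] by (auto simp: \<F>_def)
  next
    case False
    then have "x \<notin># fst (fst ?X)" using XY(1) by (auto simp: mterms_def monomials_def)
    then show ?thesis by (simp add: not_in_iff)
  qed
  then have sub: "fst (fst ?X) \<subseteq># fst (fst ?Y)" by (simp add: subseteq_mset_def)
  have "snd (fst ?X) \<le> snd (fst ?Y)" "r - snd (fst ?X) \<le> r - snd (fst ?Y)"
    using le[of "\<lambda>X. snd (fst X)"] le[of "\<lambda>X. r - snd (fst X)"] by (auto simp: \<F>_def)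
  then have "snd (fst ?X) = snd (fst ?Y)" using XY by (auto simp: mterms_def)
  moreover have "fst (fst ?Y) - fst (fst ?X) \<in> monomials n"
    using XY(2) by (auto simp: mterms_def monomials_def subset_iff dest!: in_diffD)
  ultimately have "mterm_dvd n (fst ?X) (fst ?Y)"
    using sub by (auto simp: mterm_dvd_def mterm_mult_def prod_eq_iff intro!: bexI[of _ "fst (fst ?Y) - fst (fst ?X)"])
  moreover have "snd ?X \<le> snd ?Y" using le[of snd] by (auto simp: \<F>_def)
  moreover have "\<sigma> 0 < \<sigma> 1" using \<sigma>(1) by (simp add: strict_mono_def)
  ultimately show ?thesis by blast
qed

section \<open>Divisibility of terms, term orders and leading terms\<close>

lemma mterm_mult_mem: "u \<in> monomials n \<Longrightarrow> X \<in> mterms n r \<Longrightarrow> mterm_mult u X \<in> mterms n r"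
  by (auto simp: mterm_mult_def mterms_def monomials_def)

lemma empty_monomial [simp]: "{#} \<in> monomials n"
  by (simp add: monomials_def)

lemma mterm_mult_empty [simp]: "mterm_mult {#} X = X"
  by (simp add: mterm_mult_def)

lemma mterm_dvd_refl: "mterm_dvd n X X"
  unfolding mterm_dvd_def by (intro bexI[of _ "{#}"]) auto

lemma mterm_dvd_trans: "mterm_dvd n X Y \<Longrightarrow> mterm_dvd n Y Z \<Longrightarrow> mterm_dvd n X Z"
proof -
  assume "mterm_dvd n X Y" "mterm_dvd n Y Z"
  then obtain u w where "u \<in> monomials n" "Y = mterm_mult u X" "w \<in> monomials n" "Z = mterm_mult w Y"
    by (auto simp: mterm_dvd_def)
  then have "Z = mterm_mult (w + u) X" "w + u \<in> monomials n"
    by (auto simp: mterm_mult_def monomials_def add_ac)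
  then show ?thesis by (auto simp: mterm_dvd_def)
qed

locale ordered_terms =
  fixes n r :: nat and ord :: "mterm rel"
  assumes term_order: "term_order n r ord"
begin

lemma ord_mem: "(X, Y) \<in> ord \<Longrightarrow> X \<in> mterms n r \<and> Y \<in> mterms n r"
  using term_order by (auto simp: term_order_def)

lemma ord_trans: "(X, Y) \<in> ord \<Longrightarrow> (Y, Z) \<in> ord \<Longrightarrow> (X, Z) \<in> ord"
  using term_order by (auto simp: term_order_def strict_linear_order_on_def dest: transD)

lemma ord_irrefl: "(X, X) \<notin> ord"
  using term_order by (auto simp: term_order_def strict_linear_order_on_def irrefl_def)

lemma ord_total: "X \<in> mterms n r \<Longrightarrow> Y \<in> mterms n r \<Longrightarrow> X \<noteq> Y \<Longrightarrow> (X, Y) \<in> ord \<or> (Y, X) \<in> ord"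
  using term_order by (auto simp: term_order_def strict_linear_order_on_def total_on_def)

lemma ord_mult: "(X, Y) \<in> ord \<Longrightarrow> u \<in> monomials n \<Longrightarrow> (mterm_mult u X, mterm_mult u Y) \<in> ord"
  using term_order by (auto simp: term_order_def)

lemma ord_dvd: "mterm_dvd n X Y \<Longrightarrow> X \<in> mterms n r \<Longrightarrow> X = Y \<or> (X, Y) \<in> ord"
  using term_order by (fastforce simp: term_order_def mterm_dvd_def)

text \<open>In a descending sequence Dickson's lemma finds an earlier term dividing a later one,
  which is then at least as large.\<close>

lemma wf_ord: "wf ord"
  unfolding wf_iff_no_infinite_down_chain
proof
  assume "\<exists>s. \<forall>i. (s (Suc i), s i) \<in> ord"
  then obtain s where s: "\<And>i. (s (Suc i), s i) \<in> ord" by blast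
  have desc: "(s q, s p) \<in> ord" if "p < q" for p q
    using that s by (induction q) (auto simp: less_Suc_eq intro: ord_trans)
  have mem: "s i \<in> mterms n r" for i using s ord_mem by blast
  then obtain p q where pq: "p < q" "mterm_dvd n (s p) (s q)"
    using dickson[of "\<lambda>k. (s k, 0)" n r] by auto
  then have "s p = s q \<or> (s p, s q) \<in> ord" using ord_dvd mem by blast
  then show False using desc[OF pq(1)] ord_trans ord_irrefl by metis
qed

text \<open>Stated for a set of terms so as to serve both the support of an element over gr(A) and
  the support modulo \<open>t^(i+1)\<close> of an element over \<open>A\<close>.\<close>

definition is_lead :: "mterm set \<Rightarrow> mterm \<Rightarrow> bool" where
  "is_lead S X \<longleftrightarrow> X \<in> S \<and> (\<forall>Y\<in>S. Y \<noteq> X \<longrightarrow> (Y, X) \<in> ord)"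

lemma is_lead_unique: "is_lead S X \<Longrightarrow> is_lead S Y \<Longrightarrow> X = Y"
  unfolding is_lead_def using ord_trans ord_irrefl by metis

lemma is_lead_exists: "finite S \<Longrightarrow> S \<noteq> {} \<Longrightarrow> S \<subseteq> mterms n r \<Longrightarrow> \<exists>X. is_lead S X"
proof (induction S rule: finite_ne_induct)
  case (singleton X)
  then show ?case by (auto simp: is_lead_def)
next
  case (insert Y S)
  then obtain X where X: "is_lead S X" by auto
  then have "(X, Y) \<in> ord \<or> (Y, X) \<in> ord" using insert ord_total[of X Y] by (auto simp: is_lead_def)
  then show ?case
  proof
    assume "(X, Y) \<in> ord"
    then have "is_lead (insert Y S) Y" using X ord_trans unfolding is_lead_def by (metis insert_iff)
    then show ?thesis by blast
  next
    assume "(Y, X) \<in> ord"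
    then have "is_lead (insert Y S) X" using X by (auto simp: is_lead_def)
    then show ?thesis by blast
  qed
qed

lemma lp_eq: "is_lead (support B n r f) X \<Longrightarrow> lp B n r ord f = X"
  unfolding lp_def using is_lead_unique[of "support B n r f"]
  by (intro the_equality) (auto simp: is_lead_def)

end

section \<open>Free modules over polynomial rings\<close>

text \<open>
  A substitute for rings without associativity and distributivity, which arguments about leading
  terms do not need; so they need not be verified for the quotients of powers in \<^const>\<open>gr_ring\<close>.
\<close>

locale coefficient_ring = abelian_group B for B (structure) +
  assumes m_closed [simp, intro]: "x \<in> carrier B \<Longrightarrow> y \<in> carrier B \<Longrightarrow> x \<otimes> y \<in> carrier B"
    and l_null [simp]: "x \<in> carrier B \<Longrightarrow> \<zero> \<otimes> x = \<zero>"
    and r_null [simp]: "x \<in> carrier B \<Longrightarrow> x \<otimes> \<zero> = \<zero>"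

lemma (in ring) coefficient_ring: "coefficient_ring R"
  by unfold_locales auto

lemma finite_submultisets: "finite {u. u \<subseteq># (w :: 'b multiset)}"
proof (induction w)
  case (add x w)
  have "{u. u \<subseteq># add_mset x w} \<subseteq> {u. u \<subseteq># w} \<union> add_mset x ` {u. u \<subseteq># w}"
  proof
    fix u assume "u \<in> {u. u \<subseteq># add_mset x w}"
    then show "u \<in> {u. u \<subseteq># w} \<union> add_mset x ` {u. u \<subseteq># w}"
    proof (cases "x \<in># u")
      case False
      then have "count u y \<le> count w y" for y
        using mset_subset_eq_count[of u "add_mset x w" y] \<open>u \<in> _\<close> by (cases "y = x") (auto simp: not_in_iff)
      then show ?thesis by (simp add: subseteq_mset_def)
    qed (use \<open>u \<in> _\<close> in \<open>auto dest!: multi_member_split\<close>)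
  qed
  then show ?case using add finite_subset by blast
qed auto

lemma mcoeff_ext: "(\<And>X. mcoeff f X = mcoeff g X) \<Longrightarrow> f = g"
proof (intro ext)
  fix l u assume "\<And>X. mcoeff f X = mcoeff g X"
  from this[of "(u, l)"] show "f l u = g l u" by (simp add: mcoeff_def)
qed

lemma mcoeff_zero [simp]: "mcoeff \<zero>\<^bsub>free_poly_module B n r\<^esub> X = \<zero>\<^bsub>B\<^esub>"
  by (simp add: mcoeff_def free_poly_module_def free_module_def mpoly_ring_def)

lemma mcoeff_add [simp]:
  "mcoeff (f \<oplus>\<^bsub>free_poly_module B n r\<^esub> g) X = mcoeff f X \<oplus>\<^bsub>B\<^esub> mcoeff g X"
  by (simp add: mcoeff_def free_poly_module_def free_module_def mpoly_ring_def)

lemma mcoeff_smult: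
  "mcoeff (p \<odot>\<^bsub>free_poly_module B n r\<^esub> f) (w, l) = (\<Oplus>\<^bsub>B\<^esub>u\<in>{u. u \<subseteq># w}. p u \<otimes>\<^bsub>B\<^esub> mcoeff f (w - u, l))"
  by (simp add: mcoeff_def free_poly_module_def free_module_def mpoly_ring_def)

lemma mcoeff_scaled_term: "mcoeff (scaled_term B c X) Y = (if Y = X then c else \<zero>\<^bsub>B\<^esub>)"
  by (simp add: mcoeff_def scaled_term_def)

text \<open>Flattens a family of polynomials to a single finitely supported function on terms, the
  form in which elements are handled below.\<close>

lemma (in coefficient_ring) carrier_free_poly_module:
  "f \<in> carrier (free_poly_module B n r) \<longleftrightarrow>
    (\<forall>X. mcoeff f X \<in> carrier B) \<and> (\<forall>X. X \<notin> mterms n r \<longrightarrow> mcoeff f X = \<zero>) \<and> finite {X. mcoeff f X \<noteq> \<zero>}"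
  (is "?L \<longleftrightarrow> ?R")
proof
  assume ?L
  then have f: "\<And>l u. l \<in> {1..r} \<Longrightarrow> f l u \<in> carrier B" "\<And>l. l \<in> {1..r} \<Longrightarrow> finite {u. f l u \<noteq> \<zero>}"
    "\<And>l u. l \<in> {1..r} \<Longrightarrow> u \<notin> monomials n \<Longrightarrow> f l u = \<zero>" "\<And>l u. l \<notin> {1..r} \<Longrightarrow> f l u = \<zero>"
    by (auto simp: free_poly_module_def free_module_def mpoly_ring_def)
  have "{X. mcoeff f X \<noteq> \<zero>} \<subseteq> (\<Union>l\<in>{1..r}. (\<lambda>u. (u, l)) ` {u. f l u \<noteq> \<zero>})"
    using f(4) by (fastforce simp: mcoeff_def)
  moreover have "finite (\<Union>l\<in>{1..r}. (\<lambda>u. (u, l)) ` {u. f l u \<noteq> \<zero>})" using f(2) by auto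
  ultimately have "finite {X. mcoeff f X \<noteq> \<zero>}" by (rule finite_subset)
  moreover have "mcoeff f X \<in> carrier B" for X
    using f(1,4) by (cases "snd X \<in> {1..r}") (auto simp: mcoeff_def)
  moreover have "mcoeff f X = \<zero>" if "X \<notin> mterms n r" for X
    using that f(3,4) by (cases X) (auto simp: mcoeff_def mterms_def)
  ultimately show ?R by blast
next
  assume R: ?R
  have e: "f l u = mcoeff f (u, l)" for l u by (simp add: mcoeff_def)
  have "finite {u. f l u \<noteq> \<zero>}" for l
  proof -
    have "{u. f l u \<noteq> \<zero>} \<subseteq> fst ` {X. mcoeff f X \<noteq> \<zero>}" by (force simp: e)
    then show ?thesis using R finite_surj by blast
  qed
  moreover have "f l = (\<lambda>u. \<zero>)" if "l \<notin> {1..r}" for l using R that by (auto simp: e mterms_def)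
  ultimately show ?L using R by (auto simp: free_poly_module_def free_module_def mpoly_ring_def e mterms_def)
qed

context coefficient_ring
begin

lemma mcoeff_closed [simp]: "f \<in> carrier (free_poly_module B n r) \<Longrightarrow> mcoeff f X \<in> carrier B"
  by (simp add: carrier_free_poly_module)

lemma mcoeff_finite: "f \<in> carrier (free_poly_module B n r) \<Longrightarrow> finite {X. mcoeff f X \<noteq> \<zero>}"
  by (simp add: carrier_free_poly_module)

lemma mcoeff_outside: "f \<in> carrier (free_poly_module B n r) \<Longrightarrow> X \<notin> mterms n r \<Longrightarrow> mcoeff f X = \<zero>"
  by (simp add: carrier_free_poly_module)

lemma mcoeff_finsum_closed:
  "(\<And>u. p u \<in> carrier B) \<Longrightarrow> f \<in> carrier (free_poly_module B n r) \<Longrightarrow>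
    mcoeff (p \<odot>\<^bsub>free_poly_module B n r\<^esub> f) X \<in> carrier B"
  by (cases X) (auto simp: mcoeff_smult intro!: finsum_closed)

lemma free_poly_module_abelian: "abelian_group (free_poly_module B n r)"
proof (rule abelian_groupI)
  let ?F = "free_poly_module B n r"
  show "f \<oplus>\<^bsub>?F\<^esub> g \<in> carrier ?F" if "f \<in> carrier ?F" "g \<in> carrier ?F" for f g
  proof -
    have "{X. mcoeff f X \<oplus> mcoeff g X \<noteq> \<zero>} \<subseteq> {X. mcoeff f X \<noteq> \<zero>} \<union> {X. mcoeff g X \<noteq> \<zero>}" by auto
    then have "finite {X. mcoeff f X \<oplus> mcoeff g X \<noteq> \<zero>}"
      by (rule finite_subset) (use that in \<open>simp add: carrier_free_poly_module\<close>)
    then show ?thesis using that by (simp add: carrier_free_poly_module)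
  qed
  show "\<zero>\<^bsub>?F\<^esub> \<in> carrier ?F" by (simp add: carrier_free_poly_module)
  show "\<exists>g\<in>carrier ?F. g \<oplus>\<^bsub>?F\<^esub> f = \<zero>\<^bsub>?F\<^esub>" if f: "f \<in> carrier ?F" for f
  proof (rule bexI[of _ "\<lambda>l u. \<ominus> f l u"])
    have m: "mcoeff (\<lambda>l u. \<ominus> f l u) X = \<ominus> mcoeff f X" for X by (simp add: mcoeff_def)
    show "(\<lambda>l u. \<ominus> f l u) \<oplus>\<^bsub>?F\<^esub> f = \<zero>\<^bsub>?F\<^esub>"
      using f by (intro mcoeff_ext) (simp add: m l_neg)
    have "{X. \<ominus> mcoeff f X \<noteq> \<zero>} \<subseteq> {X. mcoeff f X \<noteq> \<zero>}" by auto
    then show "(\<lambda>l u. \<ominus> f l u) \<in> carrier ?F"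
      using f finite_subset unfolding carrier_free_poly_module m by fastforce
  qed
qed (auto intro!: mcoeff_ext simp: a_ac)

lemma mcoeff_a_inv [simp]:
  assumes "f \<in> carrier (free_poly_module B n r)"
  shows "mcoeff (\<ominus>\<^bsub>free_poly_module B n r\<^esub> f) X = \<ominus> mcoeff f X"
proof -
  interpret F: abelian_group "free_poly_module B n r" by (rule free_poly_module_abelian)
  have "mcoeff (\<ominus>\<^bsub>free_poly_module B n r\<^esub> f \<oplus>\<^bsub>free_poly_module B n r\<^esub> f) X = \<zero>"
    using assms by (simp add: F.l_neg del: mcoeff_add)
  then show ?thesis
    using minus_equality[of "mcoeff (\<ominus>\<^bsub>free_poly_module B n r\<^esub> f) X" "mcoeff f X"]
      mcoeff_closed[OF assms] mcoeff_closed[OF F.a_inv_closed[OF assms]] by simp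
qed

lemma mcoeff_diff [simp]:
  assumes "f \<in> carrier (free_poly_module B n r)" "g \<in> carrier (free_poly_module B n r)"
  shows "mcoeff (f \<ominus>\<^bsub>free_poly_module B n r\<^esub> g) X = mcoeff f X \<ominus> mcoeff g X"
  using assms by (simp add: a_minus_def)

lemma scaled_term_closed:
  "c \<in> carrier B \<Longrightarrow> X \<in> mterms n r \<Longrightarrow> scaled_term B c X \<in> carrier (free_poly_module B n r)"
  using finite_subset[of "{Y. mcoeff (scaled_term B c X) Y \<noteq> \<zero>}" "{X}"]
  by (auto simp: carrier_free_poly_module mcoeff_scaled_term)

lemma poly_monom_smult_mcoeff:
  assumes "c \<in> carrier B" "f \<in> carrier (free_poly_module B n r)"
  shows "mcoeff (poly_monom B c u \<odot>\<^bsub>free_poly_module B n r\<^esub> f) (w, l) =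
    (if u \<subseteq># w then c \<otimes> mcoeff f (w - u, l) else \<zero>)"
proof -
  have "(\<Oplus>v\<in>{v. v \<subseteq># w}. poly_monom B c u v \<otimes> mcoeff f (w - v, l)) =
    (\<Oplus>v\<in>{v. v \<subseteq># w}. if u = v then c \<otimes> mcoeff f (w - v, l) else \<zero>)"
    using assms by (intro finsum_cong') (auto simp: poly_monom_def)
  also have "\<dots> = (if u \<subseteq># w then c \<otimes> mcoeff f (w - u, l) else \<zero>)"
  proof (cases "u \<subseteq># w")
    case True
    then show ?thesis
      using finsum_singleton[of u "{v. v \<subseteq># w}" "\<lambda>v. c \<otimes> mcoeff f (w - v, l)"] assms
      by (simp add: finite_submultisets Pi_iff)
  next
    case False
    then have "(\<Oplus>v\<in>{v. v \<subseteq># w}. if u = v then c \<otimes> mcoeff f (w - v, l) else \<zero>) = (\<Oplus>v\<in>{v. v \<subseteq># w}. \<zero>)"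
      by (intro finsum_cong') auto
    then show ?thesis using False by simp
  qed
  finally show ?thesis by (simp add: mcoeff_smult)
qed

lemma poly_monom_smult_mcoeff_mult:
  assumes "c \<in> carrier B" "f \<in> carrier (free_poly_module B n r)"
  shows "mcoeff (poly_monom B c u \<odot>\<^bsub>free_poly_module B n r\<^esub> f) (mterm_mult u X) = c \<otimes> mcoeff f X"
  using poly_monom_smult_mcoeff[OF assms, of u "u + fst X" "snd X"] by (simp add: mterm_mult_def)

lemma poly_monom_smult_mcoeff_cases:
  assumes "c \<in> carrier B" "f \<in> carrier (free_poly_module B n r)"
  shows "mcoeff (poly_monom B c u \<odot>\<^bsub>free_poly_module B n r\<^esub> f) Y = \<zero> \<or> (\<exists>X. Y = mterm_mult u X \<and> mcoeff f X \<noteq> \<zero>)"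
proof (cases "u \<subseteq># fst Y \<and> mcoeff f (fst Y - u, snd Y) \<noteq> \<zero>")
  case True
  then show ?thesis by (intro disjI2 exI[of _ "(fst Y - u, snd Y)"]) (simp add: mterm_mult_def)
next
  case False
  then show ?thesis using poly_monom_smult_mcoeff[OF assms, of u "fst Y" "snd Y"] assms by auto
qed

lemma poly_const_smult_mcoeff [simp]:
  assumes "c \<in> carrier B" "f \<in> carrier (free_poly_module B n r)"
  shows "mcoeff (poly_const B c \<odot>\<^bsub>free_poly_module B n r\<^esub> f) X = c \<otimes> mcoeff f X"
  using poly_monom_smult_mcoeff[OF assms, of "{#}" "fst X" "snd X"] by (simp add: poly_const_def)

lemma poly_monom_closed: "c \<in> carrier B \<Longrightarrow> u \<in> monomials n \<Longrightarrow> poly_monom B c u \<in> carrier (mpoly_ring B n)"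
  using finite_subset[of "{v. poly_monom B c u v \<noteq> \<zero>}" "{u}"]
  by (auto simp: mpoly_ring_def poly_monom_def)

lemma smult_support:
  assumes "\<And>u. p u \<in> carrier B" "f \<in> carrier (free_poly_module B n r)"
    "mcoeff (p \<odot>\<^bsub>free_poly_module B n r\<^esub> f) X \<noteq> \<zero>"
  shows "\<exists>u Y. p u \<noteq> \<zero> \<and> mcoeff f Y \<noteq> \<zero> \<and> X = mterm_mult u Y"
proof (rule ccontr)
  assume *: "\<not> ?thesis"
  have "p u \<otimes> mcoeff f (fst X - u, snd X) = \<zero>" if "u \<subseteq># fst X" for u
  proof -
    have "X = mterm_mult u (fst X - u, snd X)" using that by (simp add: mterm_mult_def)
    then have "p u = \<zero> \<or> mcoeff f (fst X - u, snd X) = \<zero>" using * by blast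
    then show ?thesis using assms by auto
  qed
  then have "mcoeff (p \<odot>\<^bsub>free_poly_module B n r\<^esub> f) (fst X, snd X) = (\<Oplus>u\<in>{u. u \<subseteq># fst X}. \<zero>)"
    unfolding mcoeff_smult by (intro finsum_cong') auto
  then show False using assms(3) by simp
qed

lemma poly_smult_closed:
  assumes p: "p \<in> carrier (mpoly_ring B n)" and f: "f \<in> carrier (free_poly_module B n r)"
  shows "p \<odot>\<^bsub>free_poly_module B n r\<^esub> f \<in> carrier (free_poly_module B n r)"
  unfolding carrier_free_poly_module
proof (intro conjI allI impI)
  have p': "\<And>u. p u \<in> carrier B" "finite {u. p u \<noteq> \<zero>}" "\<And>u. u \<notin> monomials n \<Longrightarrow> p u = \<zero>"
    using p by (auto simp: mpoly_ring_def)
  show "mcoeff (p \<odot>\<^bsub>free_poly_module B n r\<^esub> f) X \<in> carrier B" for X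
    using p'(1) f by (rule mcoeff_finsum_closed)
  show "mcoeff (p \<odot>\<^bsub>free_poly_module B n r\<^esub> f) X = \<zero>" if X: "X \<notin> mterms n r" for X
  proof (rule ccontr)
    assume "\<not> ?thesis"
    then obtain u Y where "p u \<noteq> \<zero>" "mcoeff f Y \<noteq> \<zero>" "X = mterm_mult u Y"
      using smult_support[where p = p and f = f and X = X, OF p'(1) f] by blast
    then show False using X p'(3) mcoeff_outside[OF f] mterm_mult_mem by metis
  qed
  have "{X. mcoeff (p \<odot>\<^bsub>free_poly_module B n r\<^esub> f) X \<noteq> \<zero>} \<subseteq>
    (\<lambda>(u, Y). mterm_mult u Y) ` ({u. p u \<noteq> \<zero>} \<times> {Y. mcoeff f Y \<noteq> \<zero>})"
  proof
    fix X assume "X \<in> {X. mcoeff (p \<odot>\<^bsub>free_poly_module B n r\<^esub> f) X \<noteq> \<zero>}"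
    then obtain u Y where "p u \<noteq> \<zero>" "mcoeff f Y \<noteq> \<zero>" "X = mterm_mult u Y"
      using smult_support[where p = p and f = f and X = X, OF p'(1) f] by blast
    then show "X \<in> (\<lambda>(u, Y). mterm_mult u Y) ` ({u. p u \<noteq> \<zero>} \<times> {Y. mcoeff f Y \<noteq> \<zero>})" by force
  qed
  then show "finite {X. mcoeff (p \<odot>\<^bsub>free_poly_module B n r\<^esub> f) X \<noteq> \<zero>}"
    using p'(2) mcoeff_finite[OF f] finite_subset by blast
qed

text \<open>If \<open>X = u Y\<close> does not satisfy \<open>D\<close>, neither does
  \<open>Y\<close>, since \<open>D\<close> passes to multiples; so every summand of a coefficient of
  \<open>p f\<close> at such an \<open>X\<close> lies in \<open>J\<close>. These submodules serve as
  upper bounds for \<open>Lt\<close>.\<close>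

lemma coefficient_submodule:
  assumes J: "\<zero> \<in> J" "\<And>x y. x \<in> J \<Longrightarrow> y \<in> J \<Longrightarrow> x \<oplus> y \<in> J" "\<And>x. x \<in> J \<Longrightarrow> \<ominus> x \<in> J"
      "\<And>c x. c \<in> carrier B \<Longrightarrow> x \<in> J \<Longrightarrow> x \<in> carrier B \<Longrightarrow> c \<otimes> x \<in> J"
    and D: "\<And>u X. u \<in> monomials n \<Longrightarrow> D X \<Longrightarrow> D (mterm_mult u X)"
  shows "submodule {f \<in> carrier (free_poly_module B n r). \<forall>X\<in>mterms n r. \<not> D X \<longrightarrow> mcoeff f X \<in> J}
    (mpoly_ring B n) (free_poly_module B n r)" (is "submodule ?H _ ?F")
proof -
  interpret F: abelian_group ?F by (rule free_poly_module_abelian)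
  have "subgroup ?H (add_monoid ?F)"
  proof (rule group.subgroupI)
    show "group (add_monoid ?F)" by (rule F.a_group)
    have "\<zero>\<^bsub>?F\<^esub> \<in> ?H" using J(1) by simp
    then show "?H \<noteq> {}" by blast
  next
    fix f assume "f \<in> ?H"
    then have "\<ominus>\<^bsub>?F\<^esub> f \<in> ?H" using J(3) by auto
    then show "inv\<^bsub>add_monoid ?F\<^esub> f \<in> ?H" by (simp add: a_inv_def)
  qed (use J(2) in auto)
  moreover have "p \<odot>\<^bsub>?F\<^esub> f \<in> ?H" if p: "p \<in> carrier (mpoly_ring B n)" and f: "f \<in> ?H" for p f
  proof -
    have p': "\<And>u. p u \<in> carrier B" "\<And>u. u \<notin> monomials n \<Longrightarrow> p u = \<zero>" using p by (auto simp: mpoly_ring_def)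
    have fF: "f \<in> carrier ?F" using f by simp
    have "mcoeff (p \<odot>\<^bsub>?F\<^esub> f) X \<in> J" if X: "\<not> D X" for X
    proof -
      have tm: "p u \<otimes> mcoeff f (fst X - u, snd X) \<in> J \<inter> carrier B" if u: "u \<subseteq># fst X" for u
      proof (cases "u \<in> monomials n \<and> (fst X - u, snd X) \<in> mterms n r")
        case True
        have "X = mterm_mult u (fst X - u, snd X)" using u by (simp add: mterm_mult_def)
        then have "\<not> D (fst X - u, snd X)" using D True X by metis
        then have "mcoeff f (fst X - u, snd X) \<in> J" using f True by blast
        then show ?thesis using J(4) p'(1) fF by simp
      next
        case False
        then have "p u = \<zero> \<or> mcoeff f (fst X - u, snd X) = \<zero>" using p'(2) mcoeff_outside[OF fF] by blast
        then show ?thesis using J(1) p'(1) fF by auto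
      qed
      have "(\<Oplus>u\<in>U. p u \<otimes> mcoeff f (fst X - u, snd X)) \<in> J \<inter> carrier B"
        if "finite U" "U \<subseteq> {u. u \<subseteq># fst X}" for U
        using that
      proof (induction U rule: finite_induct)
        case (insert u U)
        then show ?case using tm J(2) p'(1) fF by (simp add: Pi_iff)
      qed (simp add: J(1))
      from this[OF finite_submultisets order_refl] show ?thesis
        using mcoeff_smult[where B = B and n = n and r = r and p = p and f = f and w = "fst X" and l = "snd X"] by simp
    qed
    then show ?thesis using poly_smult_closed[OF p fF] by simp
  qed
  ultimately show ?thesis by (simp add: submodule_def submodule_axioms_def)
qed

end

section \<open>Restriction of scalars from polynomials to coefficients\<close>

lemma restrict_scalars_simps [simp]:
  "carrier (restrict_scalars h N) = carrier N"
  "\<zero>\<^bsub>restrict_scalars h N\<^esub> = \<zero>\<^bsub>N\<^esub>"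
  "add (restrict_scalars h N) = add N"
  "a \<odot>\<^bsub>restrict_scalars h N\<^esub> x = h a \<odot>\<^bsub>N\<^esub> x"
  by (simp_all add: restrict_scalars_def)

text \<open>The flatness in question is that of the quotient with scalars restricted afterwards,
  whereas the flatness criterion expects a quotient of modules over \<open>A\<close>. The cosets
  agree because they involve addition only.\<close>

lemma quotient_restrict_scalars:
  "quotient_module (restrict_scalars h L) M = restrict_scalars h (quotient_module L M)"
  by (simp add: quotient_module_def restrict_scalars_def A_RCOSETS_def RCOSETS_def set_add_def set_mult_def
      a_r_coset_def r_coset_def fun_eq_iff)

lemma abelian_group_restrict_scalars: "abelian_group N \<Longrightarrow> abelian_group (restrict_scalars h N)"
proof -
  assume "abelian_group N"
  then interpret abelian_group N .
  show ?thesis by (rule abelian_groupI) (auto simp: a_ac intro: bexI[of _ "\<ominus>\<^bsub>N\<^esub> _"] l_neg)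
qed

context cring
begin

interpretation coefficient_ring R by (rule coefficient_ring)

lemma poly_const_closed: "c \<in> carrier R \<Longrightarrow> poly_const R c \<in> carrier (mpoly_ring R n)"
  by (simp add: poly_const_def poly_monom_closed)

lemma free_poly_module_restrict: "module R (restrict_scalars (poly_const R) (free_poly_module R n r))"
proof -
  interpret F: abelian_group "free_poly_module R n r" by (rule free_poly_module_abelian)
  show ?thesis
    by (rule moduleI)
      (auto intro!: mcoeff_ext abelian_group_restrict_scalars free_poly_module_abelian
        simp: cring_axioms l_distr r_distr m_assoc poly_smult_closed[OF poly_const_closed]
          poly_const_smult_mcoeff)
qed

lemma free_poly_module_coordinates:
  "coordinate_module R (restrict_scalars (poly_const R) (free_poly_module R n r)) (mterms n r) (scaled_term R \<one>) mcoeff"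
proof -
  let ?L = "restrict_scalars (poly_const R) (free_poly_module R n r)"
  interpret L: module R ?L by (rule free_poly_module_restrict)
  interpret F: abelian_group "free_poly_module R n r" by (rule free_poly_module_abelian)
  show ?thesis
  proof unfold_locales
    fix x F assume x: "x \<in> carrier ?L" "finite F" "{i \<in> mterms n r. mcoeff x i \<noteq> \<zero>} \<subseteq> F" "F \<subseteq> mterms n r"
    let ?s = "\<lambda>F. \<Oplus>\<^bsub>?L\<^esub>i\<in>F. mcoeff x i \<odot>\<^bsub>?L\<^esub> scaled_term R \<one> i"
    have cl: "mcoeff x i \<odot>\<^bsub>?L\<^esub> scaled_term R \<one> i \<in> carrier ?L" if "i \<in> mterms n r" for i
      using x(1) that by (intro L.smult_closed) (auto intro: scaled_term_closed)
    have *: "mcoeff (?s F) Y = (if Y \<in> F then mcoeff x Y else \<zero>)" if "F \<subseteq> mterms n r" for Y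
      using x(2) that
    proof (induction F rule: finite_induct)
      case (insert i F)
      have "?s (insert i F) = mcoeff x i \<odot>\<^bsub>?L\<^esub> scaled_term R \<one> i \<oplus>\<^bsub>?L\<^esub> ?s F"
        using insert cl by (intro L.M.finsum_insert) auto
      then show ?case
        using insert x(1) scaled_term_closed[of \<one> i n r]
        by (auto simp: mcoeff_scaled_term poly_const_smult_mcoeff)
    qed simp
    have "mcoeff (?s F) Y = mcoeff x Y" for Y
    proof (cases "Y \<in> F")
      case False
      then have "mcoeff x Y = \<zero>" using x mcoeff_outside[of x n r Y] by (cases "Y \<in> mterms n r") auto
      then show ?thesis using *[OF x(4)] False by simp
    qed (use *[OF x(4)] in simp)
    then show "x = ?s F" by (intro mcoeff_ext) simp
  next
    fix x assume "x \<in> carrier ?L"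
    then have "finite {X. mcoeff x X \<noteq> \<zero>}" by (simp add: mcoeff_finite)
    then show "finite {i \<in> mterms n r. mcoeff x i \<noteq> \<zero>}" by (rule rev_finite_subset) auto
  qed (auto simp: scaled_term_closed poly_const_smult_mcoeff)
qed

end

section \<open>Submodules of a free module over a polynomial ring over a uniserial ring\<close>

locale uniserial_polynomials = uniserial_ring A t + ordered_terms n r ord
  for A (structure) and t and n r ord
begin

sublocale coefficient_ring A by (rule coefficient_ring)

abbreviation "L \<equiv> free_poly_module A n r"

sublocale L: abelian_group L by (rule free_poly_module_abelian)

sublocale coordinate_module A "restrict_scalars (poly_const A) L" "mterms n r" "scaled_term A \<one>" mcoeff
  by (rule free_poly_module_coordinates)

definition term_mult where "term_mult c u f = poly_monom A c u \<odot>\<^bsub>L\<^esub> f"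

abbreviation scale where "scale c f \<equiv> term_mult c {#} f"

lemma scale_eq: "scale c f = poly_const A c \<odot>\<^bsub>L\<^esub> f"
  by (simp add: term_mult_def poly_const_def)

lemma term_mult_closed [simp]:
  "c \<in> carrier A \<Longrightarrow> u \<in> monomials n \<Longrightarrow> f \<in> carrier L \<Longrightarrow> term_mult c u f \<in> carrier L"
  unfolding term_mult_def by (intro poly_smult_closed poly_monom_closed)

lemma mcoeff_L [simp]: "f \<in> carrier L \<Longrightarrow> mcoeff f X \<in> carrier A"
  by (rule mcoeff_closed)

lemma mcoeff_term_mult:
  "c \<in> carrier A \<Longrightarrow> f \<in> carrier L \<Longrightarrow> mcoeff (term_mult c u f) (w, l) = (if u \<subseteq># w then c \<otimes> mcoeff f (w - u, l) else \<zero>)"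
  unfolding term_mult_def by (rule poly_monom_smult_mcoeff)

lemma mcoeff_term_mult_mult:
  "c \<in> carrier A \<Longrightarrow> f \<in> carrier L \<Longrightarrow> mcoeff (term_mult c u f) (mterm_mult u X) = c \<otimes> mcoeff f X"
  unfolding term_mult_def by (rule poly_monom_smult_mcoeff_mult)

lemma mcoeff_scale [simp]:
  "c \<in> carrier A \<Longrightarrow> f \<in> carrier L \<Longrightarrow> mcoeff (scale c f) X = c \<otimes> mcoeff f X"
  using mcoeff_term_mult_mult[of c f "{#}" X] by simp

lemma mcoeff_term_mult_cases:
  assumes "c \<in> carrier A" "f \<in> carrier L"
  obtains "mcoeff (term_mult c u f) Y = \<zero>" | X where "Y = mterm_mult u X" "mcoeff (term_mult c u f) Y = c \<otimes> mcoeff f X"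
proof (cases "u \<subseteq># fst Y")
  case True
  then have "Y = mterm_mult u (fst Y - u, snd Y)" by (simp add: mterm_mult_def)
  then show ?thesis using that(2) mcoeff_term_mult_mult[OF assms] by metis
next
  case False
  then show ?thesis using that(1) mcoeff_term_mult[OF assms, of u "fst Y" "snd Y"] by simp
qed

lemma term_mult_scale:
  assumes "c \<in> carrier A" "d \<in> carrier A" "f \<in> carrier L" "u \<in> monomials n"
  shows "term_mult c u (scale d f) = scale d (term_mult c u f)"
proof (rule mcoeff_ext)
  fix X show "mcoeff (term_mult c u (scale d f)) X = mcoeff (scale d (term_mult c u f)) X"
    using assms mcoeff_term_mult[of c "scale d f" u "fst X" "snd X"] mcoeff_term_mult[of c f u "fst X" "snd X"]
    by (simp add: m_lcomm)
qed

lemma scale_scale: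
  "c \<in> carrier A \<Longrightarrow> d \<in> carrier A \<Longrightarrow> f \<in> carrier L \<Longrightarrow> scale c (scale d f) = scale (c \<otimes> d) f"
  by (intro mcoeff_ext) (simp add: m_assoc)

lemma scale_add:
  "c \<in> carrier A \<Longrightarrow> f \<in> carrier L \<Longrightarrow> g \<in> carrier L \<Longrightarrow> scale c (f \<oplus>\<^bsub>L\<^esub> g) = scale c f \<oplus>\<^bsub>L\<^esub> scale c g"
  by (intro mcoeff_ext) (simp add: r_distr)

lemma scale_diff:
  "c \<in> carrier A \<Longrightarrow> f \<in> carrier L \<Longrightarrow> g \<in> carrier L \<Longrightarrow> scale c (f \<ominus>\<^bsub>L\<^esub> g) = scale c f \<ominus>\<^bsub>L\<^esub> scale c g"
  by (intro mcoeff_ext) (simp add: mcoeff_diff r_distr r_minus a_minus_def)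

text \<open>The submodule \<open>t^i L\<close>, described by coefficients;
  \<open>madic_fil_eq\<close> identifies it with the filtration that defines gr(L).\<close>

definition fil where "fil (i::nat) = {f \<in> carrier L. \<forall>X. mcoeff f X \<in> PIdl (t [^] i)}"

lemma filI: "f \<in> carrier L \<Longrightarrow> (\<And>X. X \<in> mterms n r \<Longrightarrow> mcoeff f X \<in> PIdl (t [^] i)) \<Longrightarrow> f \<in> fil i"
proof -
  assume f: "f \<in> carrier L" "\<And>X. X \<in> mterms n r \<Longrightarrow> mcoeff f X \<in> PIdl (t [^] i)"
  have "mcoeff f X \<in> PIdl (t [^] i)" for X
    using f(2)[of X] mcoeff_outside[OF f(1), of X] by (cases "X \<in> mterms n r") simp_all
  then show ?thesis using f(1) by (simp add: fil_def)
qed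

lemma fil_carrier: "f \<in> fil i \<Longrightarrow> f \<in> carrier L"
  by (simp add: fil_def)

lemma fil_divide:
  assumes "f \<in> fil i"
  obtains g where "g \<in> carrier L" "f = scale (t [^] i) g"
proof -
  have f: "f \<in> carrier L" using assms by (rule fil_carrier)
  \<comment> \<open>For nilpotent \<open>t\<close> the equation \<open>t^i c = 0\<close> does not
    give \<open>c = 0\<close>; choosing \<open>c = 0\<close> at the vanishing coefficients keeps the
    support of the quotient finite.\<close>
  have "\<forall>X. \<exists>c\<in>carrier A. mcoeff f X = t [^] i \<otimes> c \<and> (mcoeff f X = \<zero> \<longrightarrow> c = \<zero>)"
  proof
    fix X
    show "\<exists>c\<in>carrier A. mcoeff f X = t [^] i \<otimes> c \<and> (mcoeff f X = \<zero> \<longrightarrow> c = \<zero>)"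
    proof (cases "mcoeff f X = \<zero>")
      case False
      then show ?thesis using assms by (auto simp: fil_def mem_power_iff)
    qed (auto intro!: bexI[of _ \<zero>])
  qed
  then obtain c where c: "\<And>X. c X \<in> carrier A" "\<And>X. mcoeff f X = t [^] i \<otimes> c X" "\<And>X. mcoeff f X = \<zero> \<Longrightarrow> c X = \<zero>"
    by metis
  define g where "g = (\<lambda>l u. c (u, l))"
  have g: "mcoeff g X = c X" for X by (simp add: g_def mcoeff_def)
  have "{X. c X \<noteq> \<zero>} \<subseteq> {X. mcoeff f X \<noteq> \<zero>}" using c(3) by auto
  then have "g \<in> carrier L"
    using c mcoeff_finite[OF f] mcoeff_outside[OF f] finite_subset by (auto simp: carrier_free_poly_module g)
  then show ?thesis using that[of g] c(2) by (metis g mcoeff_ext mcoeff_scale nat_pow_closed t_closed)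
qed

text \<open>The closure properties on which reduction relies. They are needed for \<open>M\<close>
  and for the sets of all \<open>y\<close> with \<open>t^k y \<in> M\<close>.\<close>

definition term_closed where
  "term_closed T \<longleftrightarrow> T \<subseteq> carrier L \<and> \<zero>\<^bsub>L\<^esub> \<in> T \<and> (\<forall>f\<in>T. \<forall>g\<in>T. f \<oplus>\<^bsub>L\<^esub> g \<in> T \<and> f \<ominus>\<^bsub>L\<^esub> g \<in> T) \<and>
     (\<forall>c\<in>carrier A. \<forall>u\<in>monomials n. \<forall>f\<in>T. term_mult c u f \<in> T)"

lemma term_closedD:
  assumes "term_closed T"
  shows "f \<in> T \<Longrightarrow> f \<in> carrier L" "\<zero>\<^bsub>L\<^esub> \<in> T" "f \<in> T \<Longrightarrow> g \<in> T \<Longrightarrow> f \<oplus>\<^bsub>L\<^esub> g \<in> T"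
    "f \<in> T \<Longrightarrow> g \<in> T \<Longrightarrow> f \<ominus>\<^bsub>L\<^esub> g \<in> T"
    "c \<in> carrier A \<Longrightarrow> u \<in> monomials n \<Longrightarrow> f \<in> T \<Longrightarrow> term_mult c u f \<in> T"
  using assms unfolding term_closed_def by blast+

lemma submodule_term_closed:
  assumes "submodule M (mpoly_ring A n) L"
  shows "term_closed M"
proof -
  interpret M: submodule M "mpoly_ring A n" L by fact
  have "f \<ominus>\<^bsub>L\<^esub> g \<in> M" if "f \<in> M" "g \<in> M" for f g
    using that M.m_closed M.m_inv_closed by (simp add: a_minus_def a_inv_def)
  then show ?thesis
    using M.subset M.one_closed M.m_closed M.smult_closed[OF poly_monom_closed]
    by (auto simp: term_closed_def term_mult_def)
qed

subsection \<open>The ascending chain condition\<close>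

text \<open>
  The possibility \<open>t\<^sup>j = 0\<close> is not excluded: this makes the set closed under multiples of \<open>(X, j)\<close>
  even if \<open>t\<close> is nilpotent.
\<close>

definition lead_data where
  "lead_data T = {(X, j::nat). X \<in> mterms n r \<and>
     (\<exists>y\<in>T. mcoeff y X = t [^] j \<and> (\<forall>Y. mcoeff y Y \<noteq> \<zero> \<longrightarrow> Y = X \<or> (Y, X) \<in> ord))}"

lemma lead_data_up:
  assumes "term_closed T" "(X, j) \<in> lead_data T" "mterm_dvd n X X'" "j \<le> j'"
  shows "(X', j') \<in> lead_data T"
proof -
  obtain y where y: "y \<in> T" "mcoeff y X = t [^] j" "\<And>Y. mcoeff y Y \<noteq> \<zero> \<Longrightarrow> Y = X \<or> (Y, X) \<in> ord"
    and X: "X \<in> mterms n r" using assms(2) by (auto simp: lead_data_def)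
  obtain u where u: "u \<in> monomials n" "X' = mterm_mult u X" using assms(3) by (auto simp: mterm_dvd_def)
  have yL: "y \<in> carrier L" using y(1) term_closedD[OF assms(1)] by blast
  let ?y = "term_mult (t [^] (j' - j)) u y"
  have "mcoeff ?y X' = t [^] j'"
    using assms(4) yL by (simp add: u(2) mcoeff_term_mult_mult y(2) nat_pow_mult)
  moreover have "Y = X' \<or> (Y, X') \<in> ord" if Y: "mcoeff ?y Y \<noteq> \<zero>" for Y
  proof (rule mcoeff_term_mult_cases[of "t [^] (j' - j)" y u Y])
    fix Z assume Z: "Y = mterm_mult u Z" "mcoeff ?y Y = t [^] (j' - j) \<otimes> mcoeff y Z"
    then have "mcoeff y Z \<noteq> \<zero>" using Y by auto
    then show ?thesis using y(3) Z(1) u ord_mult by blast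
  qed (use yL Y in auto)
  moreover have "?y \<in> T" using term_closedD(5)[OF assms(1)] u(1) y(1) by auto
  ultimately show ?thesis using mterm_mult_mem[OF u(1) X] u(2) unfolding lead_data_def by blast
qed

text \<open>Otherwise a pair that is new at some later index can be chosen again and again. By
  Dickson's lemma an earlier one of these pairs divides a later one, which by
  \<open>lead_data_up\<close> had then been present already.\<close>

lemma lead_data_chain:
  assumes T: "\<And>k. term_closed (T k)" "\<And>k. T k \<subseteq> T (Suc k)"
  shows "\<exists>K. \<forall>k\<ge>K. lead_data (T k) = lead_data (T K)"
proof (rule ccontr)
  assume contra: "\<not> ?thesis"
  have T_mono: "T k \<subseteq> T l" if "k \<le> l" for k l using lift_Suc_mono_le[of T, OF T(2) that] .
  have mono: "lead_data (T k) \<subseteq> lead_data (T l)" if "k \<le> l" for k l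
    using T_mono[OF that] by (auto simp: lead_data_def)
  have "\<forall>K. \<exists>k z. K \<le> k \<and> z \<in> lead_data (T k) \<and> z \<notin> lead_data (T K)"
    using contra mono by blast
  then obtain nx z where nx: "\<And>K. K \<le> nx K" "\<And>K. z K \<in> lead_data (T (nx K))" "\<And>K. z K \<notin> lead_data (T K)"
    by metis
  define k where "k p = (nx ^^ p) 0" for p
  have k_Suc: "k (Suc p) = nx (k p)" for p by (simp add: k_def)
  have k_mono: "k p \<le> k q" if "p \<le> q" for p q
    using lift_Suc_mono_le[of k p q, OF _ that] nx(1) unfolding k_Suc by blast
  have "fst (z (k p)) \<in> mterms n r" for p using nx(2)[of "k p"] by (auto simp: lead_data_def)
  then obtain p q where pq: "p < q" "mterm_dvd n (fst (z (k p))) (fst (z (k q)))" "snd (z (k p)) \<le> snd (z (k q))"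
    using dickson[of "\<lambda>p. z (k p)"] by blast
  have "z (k p) \<in> lead_data (T (k q))"
    using nx(2)[of "k p"] mono[OF k_mono[OF Suc_leI[OF pq(1)]]] unfolding k_Suc by (rule subsetD[rotated])
  then have "(fst (z (k q)), snd (z (k q))) \<in> lead_data (T (k q))"
    by (intro lead_data_up[OF T(1) _ pq(2,3)]) simp
  then have "z (k q) \<in> lead_data (T (k q))" by simp
  then show False using nx(3) by blast
qed

lemma finite_coeff_set: "f \<in> carrier L \<Longrightarrow> finite {X \<in> mterms n r. mcoeff f X \<notin> PIdl (t [^] (i::nat))}"
proof -
  assume f: "f \<in> carrier L"
  have "{X \<in> mterms n r. mcoeff f X \<notin> PIdl (t [^] i)} \<subseteq> {X. mcoeff f X \<noteq> \<zero>}" by auto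
  then show ?thesis using mcoeff_finite[OF f] finite_subset by blast
qed

text \<open>The leading term of \<open>y \<in> T\<close> is cancelled by a unit multiple of an
  element of \<open>T'\<close>; the difference stays in \<open>T\<close> and has a smaller leading
  power product, so well-founded induction applies.\<close>

lemma subset_if_lead_data_subset:
  assumes T: "term_closed T" "term_closed T'" "T' \<subseteq> T" "lead_data T \<subseteq> lead_data T'"
  shows "T \<subseteq> T'"
proof -
  have "y \<in> T'" if "y \<in> T" "is_lead {X \<in> mterms n r. mcoeff y X \<noteq> \<zero>} X" for X y
    using wf_ord that
  proof (induction X arbitrary: y rule: wf_induct_rule)
    case (less X)
    have yL: "y \<in> carrier L" using less.prems(1) term_closedD[OF T(1)] by blast
    have X: "X \<in> mterms n r" "mcoeff y X \<noteq> \<zero>"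
      and Xlead: "\<And>Y. mcoeff y Y \<noteq> \<zero> \<Longrightarrow> Y = X \<or> (Y, X) \<in> ord"
      using less.prems(2) mcoeff_outside[OF yL] by (auto simp: is_lead_def)
    obtain j :: nat and v where v: "v \<in> Units A" "mcoeff y X = t [^] j \<otimes> v"
      using factor[of "mcoeff y X"] X(2) yL by auto
    have vA: "v \<in> carrier A" "inv v \<in> carrier A" "inv v \<otimes> v = \<one>" using v(1) by auto
    \<comment> \<open>The unit part of the leading coefficient is divided out, because
      \<open>lead_data\<close> records pure powers of \<open>t\<close>.\<close>
    have "scale (inv v) y \<in> T" using term_closedD(5)[OF T(1)] vA less.prems(1) by simp
    moreover have "mcoeff (scale (inv v) y) X = t [^] j" using vA yL v(2) m_lcomm[of "inv v" "t [^] j" v] by simp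
    moreover have "Y = X \<or> (Y, X) \<in> ord" if "mcoeff (scale (inv v) y) Y \<noteq> \<zero>" for Y
      using that vA yL Xlead[of Y] by (cases "mcoeff y Y = \<zero>") auto
    ultimately have "(X, j) \<in> lead_data T" using X(1) unfolding lead_data_def by blast
    then obtain z where z: "z \<in> T'" "mcoeff z X = t [^] j" "\<And>Y. mcoeff z Y \<noteq> \<zero> \<Longrightarrow> Y = X \<or> (Y, X) \<in> ord"
      using subsetD[OF T(4)] unfolding lead_data_def by blast
    have zL: "z \<in> carrier L" using z(1) term_closedD[OF T(2)] by blast
    have vz: "scale v z \<in> T'" using term_closedD(5)[OF T(2)] vA z(1) by simp
    define w where "w = y \<ominus>\<^bsub>L\<^esub> scale v z"
    have wT: "w \<in> T" unfolding w_def using term_closedD(4)[OF T(1) less.prems(1)] vz T(3) by blast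
    have wc: "mcoeff w Y = mcoeff y Y \<ominus> v \<otimes> mcoeff z Y" for Y
      using yL zL vA by (simp add: w_def mcoeff_diff)
    have wX: "mcoeff w X = \<zero>" using vA by (simp add: wc v(2) z(2) m_comm r_right_minus_eq)
    have w_lt: "(Y, X) \<in> ord" if "mcoeff w Y \<noteq> \<zero>" for Y
    proof -
      have "mcoeff y Y \<noteq> \<zero> \<or> mcoeff z Y \<noteq> \<zero>" using that vA by (auto simp: wc minus_eq)
      moreover have "Y \<noteq> X" using that wX by auto
      ultimately show ?thesis using Xlead z(3) by blast
    qed
    have "w \<in> T'"
    proof (cases "w = \<zero>\<^bsub>L\<^esub>")
      case True
      then show ?thesis using term_closedD(2)[OF T(2)] by simp
    next
      case False
      have wL: "w \<in> carrier L" using wT term_closedD[OF T(1)] by blast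
      have "{X \<in> mterms n r. mcoeff w X \<noteq> \<zero>} \<noteq> {}"
      proof
        assume "{X \<in> mterms n r. mcoeff w X \<noteq> \<zero>} = {}"
        then have "mcoeff w X = \<zero>" for X using mcoeff_outside[OF wL, of X] by blast
        then have "w = \<zero>\<^bsub>L\<^esub>" by (intro mcoeff_ext) simp
        then show False using False by simp
      qed
      moreover have "finite {X \<in> mterms n r. mcoeff w X \<noteq> \<zero>}" using mcoeff_finite[OF wL] by simp
      ultimately obtain Y where Y: "is_lead {X \<in> mterms n r. mcoeff w X \<noteq> \<zero>} Y"
        using is_lead_exists[of "{X \<in> mterms n r. mcoeff w X \<noteq> \<zero>}"] by blast
      then have "(Y, X) \<in> ord" using w_lt by (auto simp: is_lead_def)
      then show ?thesis using less.IH wT Y by blast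
    qed
    then have "w \<oplus>\<^bsub>L\<^esub> scale v z \<in> T'" using vz term_closedD(3)[OF T(2)] by blast
    moreover have "w \<oplus>\<^bsub>L\<^esub> scale v z = y"
      using yL zL vA by (simp add: w_def L.minus_eq L.a_assoc L.l_neg)
    ultimately show ?case by simp
  qed
  moreover have "\<exists>X. is_lead {X \<in> mterms n r. mcoeff y X \<noteq> \<zero>} X" if "y \<in> T" "y \<noteq> \<zero>\<^bsub>L\<^esub>" for y
  proof -
    have yL: "y \<in> carrier L" using that(1) term_closedD[OF T(1)] by blast
    have "\<exists>X. mcoeff y X \<noteq> \<zero>" using that(2) mcoeff_ext[of y "\<zero>\<^bsub>L\<^esub>"] by fastforce
    then have "{X \<in> mterms n r. mcoeff y X \<noteq> \<zero>} \<noteq> {}" using mcoeff_outside[OF yL] by blast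
    then show ?thesis using mcoeff_finite[OF yL] by (intro is_lead_exists) auto
  qed
  ultimately show ?thesis using term_closedD(2)[OF T(2)] by blast
qed

lemma term_closed_chain_stable:
  assumes "\<And>k. term_closed (T k)" "\<And>k. T k \<subseteq> T (Suc k)"
  shows "\<exists>K. \<forall>k\<ge>K. T k = T K"
proof -
  obtain K where "\<forall>k\<ge>K. lead_data (T k) = lead_data (T K)" using lead_data_chain[of T, OF assms] by blast
  moreover have "T K \<subseteq> T k" if "K \<le> k" for k using lift_Suc_mono_le[of T, OF assms(2) that] .
  ultimately show ?thesis using subset_if_lead_data_subset[OF assms(1) assms(1)] by blast
qed

end

subsection \<open>Purity and leading terms\<close>

context uniserial_polynomials
begin

text \<open>The support of the class of \<open>f \<in> t\<^sup>i L\<close> in \<open>t\<^sup>i L / t\<^sup>i\<^sup>+\<^sup>1 L\<close>.\<close>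

definition gsupp where "gsupp i f = {X \<in> mterms n r. mcoeff f X \<notin> PIdl (t [^] Suc i)}"

lemma gsupp_iff: "X \<in> gsupp i f \<longleftrightarrow> X \<in> mterms n r \<and> mcoeff f X \<notin> PIdl (t [^] Suc i)"
  by (simp only: gsupp_def mem_Collect_eq)

lemma gsupp_0_iff: "f \<in> carrier L \<Longrightarrow> X \<in> gsupp 0 f \<longleftrightarrow> X \<in> mterms n r \<and> mcoeff f X \<in> Units A"
  by (simp add: gsupp_iff unit_iff)

lemma gsupp_finite: "f \<in> carrier L \<Longrightarrow> finite (gsupp i f)"
  unfolding gsupp_def by (rule finite_coeff_set)

lemma gsupp_lead_exists:
  assumes "f \<in> carrier L" "gsupp i f \<noteq> {}"
  shows "\<exists>X. is_lead (gsupp i f) X"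
  using gsupp_finite[OF assms(1)] assms(2) by (rule is_lead_exists) (auto simp: gsupp_def)

lemma gsupp_empty: "f \<in> carrier L \<Longrightarrow> gsupp i f = {} \<Longrightarrow> f \<in> fil (Suc i)"
  by (rule filI) (auto simp: gsupp_def)

lemma gsupp_diff_scale:
  assumes "f \<in> carrier L" "g \<in> carrier L" "X \<in> gsupp i (f \<ominus>\<^bsub>L\<^esub> scale (t [^] i) g)"
  shows "X \<in> gsupp i f \<or> X \<in> gsupp 0 g"
proof (rule ccontr)
  assume neg: "\<not> ?thesis"
  have X: "X \<in> mterms n r" using assms(3) by (simp add: gsupp_iff)
  then have f: "mcoeff f X \<in> PIdl (t [^] Suc i)" and g: "mcoeff g X \<in> PIdl (t [^] Suc 0)"
    using neg unfolding gsupp_iff by blast+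
  have "t [^] i \<otimes> mcoeff g X \<in> PIdl (t [^] (i + Suc 0))"
    using g by (intro power_mult_mem) (auto simp: cgenideal_self)
  then have tg: "t [^] i \<otimes> mcoeff g X \<in> PIdl (t [^] Suc i)" by (simp only: add_Suc_right add_0_right)
  have "mcoeff (f \<ominus>\<^bsub>L\<^esub> scale (t [^] i) g) X = mcoeff f X \<oplus> \<ominus> (t [^] i \<otimes> mcoeff g X)"
    using assms(1,2) by (simp add: mcoeff_diff a_minus_def)
  also have "\<dots> \<in> PIdl (t [^] Suc i)" using f tg by (intro power_add_mem power_minus_mem)
  finally show False using assms(3) unfolding gsupp_iff by blast
qed

text \<open>Multiplication by \<open>t^i\<close> maps \<open>L / t L\<close> injectively to
  \<open>t^i L / t^(i+1) L\<close>, unless \<open>t^i = 0\<close>.\<close>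

lemma gsupp_scale:
  assumes "g \<in> carrier L" "t [^] i \<noteq> \<zero>"
  shows "gsupp i (scale (t [^] i) g) = gsupp 0 g"
proof -
  have "t [^] i \<otimes> mcoeff g X \<notin> PIdl (t [^] Suc i) \<longleftrightarrow> mcoeff g X \<in> Units A" for X
    using unit_if_not_mem[of "mcoeff g X" i] unit_times_not_mem[OF _ assms(2)] assms(1) mcoeff_L by blast
  then show ?thesis
    using gsupp_0_iff[OF assms(1)] assms(1) by (auto simp del: nat_pow_Suc simp: gsupp_def)
qed

end

locale polynomial_submodule = uniserial_polynomials A t n r ord
  for A (structure) and t and n r ord +
  fixes M
  assumes submodule_poly: "submodule M (mpoly_ring A n) (free_poly_module A n r)"
begin

sublocale UQ: uniserial_coordinate_quotient A "restrict_scalars (poly_const A) L" "mterms n r" "scaled_term A \<one>" mcoeff M t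
proof -
  interpret M: submodule M "mpoly_ring A n" L by (rule submodule_poly)
  have "subgroup M (add_monoid (restrict_scalars (poly_const A) L))"
    using M.subgroup_axioms by (subst subgroup_add_monoid_cong[where N' = L]) auto
  then have "submodule M A (restrict_scalars (poly_const A) L)"
    by (simp add: submodule_def submodule_axioms_def poly_const_closed)
  then show "uniserial_coordinate_quotient A (restrict_scalars (poly_const A) L) (mterms n r) (scaled_term A \<one>) mcoeff M t"
    by (intro uniserial_coordinate_quotient.intro coordinate_quotient.intro module_with_submodule.intro
        module_with_submodule_axioms.intro coordinate_module_axioms free_poly_module_restrict uniserial_ring_axioms)
qed

lemmas M_term_closed = submodule_term_closed[OF submodule_poly]

lemmas M_closed = term_closedD[OF M_term_closed]

lemma pure_iff: "UQ.pure \<longleftrightarrow> (\<forall>i. \<forall>f\<in>M \<inter> fil i. \<exists>m\<in>M. f = scale (t [^] i) m)"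
proof -
  have "(\<forall>X\<in>mterms n r. mcoeff f X \<in> PIdl (t [^] i)) \<longleftrightarrow> f \<in> fil i" if "f \<in> M" for f i
    using filI[of f i] M_closed(1)[OF that] by (auto simp: fil_def)
  then show ?thesis unfolding UQ.pure_def by (auto simp: scale_eq)
qed

text \<open>Condition (c) expressed by elements of \<open>M\<close>, without a Groebner basis: every
  leading power product of a homogeneous element of gr(M) is divisible by one that occurs in degree
  0.\<close>

definition unit_leading where
  "unit_leading \<longleftrightarrow> (\<forall>i. \<forall>f\<in>M \<inter> fil i. \<forall>X. is_lead (gsupp i f) X \<longrightarrow>
     (\<exists>h\<in>M. \<exists>X'. is_lead (gsupp 0 h) X' \<and> mterm_dvd n X' X))"

lemma pure_imp_same_lead:
  assumes "UQ.pure" "f \<in> M" "f \<in> fil i" "is_lead (gsupp i f) X"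
  shows "\<exists>h\<in>M. is_lead (gsupp 0 h) X"
proof -
  obtain m where m: "m \<in> M" "f = scale (t [^] i) m" using assms pure_iff by blast
  have mL: "m \<in> carrier L" using m(1) M_closed(1) by blast
  have "mcoeff f X \<notin> PIdl (t [^] Suc i)" using assms(4) unfolding is_lead_def gsupp_iff by blast
  then have "mcoeff f X \<noteq> \<zero>" using zero_mem_power by metis
  then have "t [^] i \<noteq> \<zero>" using m(2) mL by auto
  then show ?thesis using assms(4) gsupp_scale[OF mL] m by auto
qed

text \<open>
  Subtracting multiples of the elements provided by \<open>unit_leading\<close>, an element of
  \<open>M \<inter> t\<^sup>i L\<close> is reduced modulo \<open>t\<^sup>i\<^sup>+\<^sup>1 L\<close> to zero.
\<close>

lemma unit_leading_step:
  assumes "unit_leading" "f \<in> M" "f \<in> fil i"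
  shows "\<exists>m\<in>M. f \<ominus>\<^bsub>L\<^esub> scale (t [^] i) m \<in> fil (Suc i)"
proof -
  have "\<exists>m\<in>M. f \<ominus>\<^bsub>L\<^esub> scale (t [^] i) m \<in> fil (Suc i)"
    if "f \<in> M" "f \<in> fil i" "is_lead (gsupp i f) X" for X f
    using wf_ord that
  proof (induction X arbitrary: f rule: wf_induct_rule)
    case (less X)
    have fL: "f \<in> carrier L" using less.prems(1) M_closed(1) by blast
    obtain h X' where h: "h \<in> M" "is_lead (gsupp 0 h) X'" "mterm_dvd n X' X"
      using assms(1) less.prems unfolding unit_leading_def by blast
    have hL: "h \<in> carrier L" using h(1) M_closed(1) by blast
    obtain u where u: "u \<in> monomials n" "X = mterm_mult u X'" using h(3) by (auto simp: mterm_dvd_def)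
    obtain c where c: "c \<in> carrier A" "mcoeff f X = t [^] i \<otimes> c"
      using less.prems(2) by (auto simp: fil_def mem_power_iff)
    define w where "w = mcoeff h X'"
    have "w \<in> Units A" using h(2) gsupp_0_iff[OF hL] by (simp add: is_lead_def w_def)
    then have w: "w \<in> carrier A" "inv w \<in> carrier A" "inv w \<otimes> w = \<one>" by auto
    \<comment> \<open>The monomial \<open>u\<close> moves the leading term of \<open>h\<close> to
      \<open>X\<close>, and division by the unit \<open>w\<close> makes the coefficient of
      \<open>m\<close> there equal to \<open>c\<close>; thus \<open>t^i m\<close> cancels the
      leading term of \<open>f\<close>.\<close>
    define m where "m = term_mult (c \<otimes> inv w) u h"
    have m: "m \<in> M" "m \<in> carrier L" using M_closed(5) u(1) c(1) w h(1) hL by (auto simp: m_def)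
    define g where "g = f \<ominus>\<^bsub>L\<^esub> scale (t [^] i) m"
    have gM: "g \<in> M" using M_closed(4,5) less.prems(1) m(1) by (simp add: g_def)
    have gL: "g \<in> carrier L" using gM M_closed(1) by blast
    have g_coeff: "mcoeff g Y = mcoeff f Y \<ominus> t [^] i \<otimes> mcoeff m Y" for Y
      using fL m(2) by (simp add: g_def mcoeff_diff)
    have g_fil: "g \<in> fil i"
    proof (rule filI[OF gL])
      fix Y
      have "mcoeff f Y \<in> PIdl (t [^] i)" using less.prems(2) by (simp add: fil_def)
      moreover have "t [^] i \<otimes> mcoeff m Y \<in> PIdl (t [^] i)" using m(2) by (auto simp: mem_power_iff)
      ultimately show "mcoeff g Y \<in> PIdl (t [^] i)"
        unfolding g_coeff a_minus_def by (intro power_add_mem power_minus_mem)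
    qed
    have "mcoeff m X = c"
      using mcoeff_term_mult_mult[of "c \<otimes> inv w" h u X'] c(1) w hL by (simp add: m_def u(2) w_def[symmetric] m_assoc)
    then have "mcoeff g X = \<zero>" using c by (simp add: g_coeff r_right_minus_eq)
    then have gX: "X \<notin> gsupp i g" unfolding gsupp_iff by (simp only: zero_mem_power simp_thms)
    have m_lt: "Y = X \<or> (Y, X) \<in> ord" if "Y \<in> gsupp 0 m" for Y
    proof -
      have Ym: "mcoeff m Y \<notin> PIdl (t [^] Suc 0)" using that unfolding gsupp_iff by blast
      show ?thesis
      proof (rule mcoeff_term_mult_cases[of "c \<otimes> inv w" h u Y])
        assume "mcoeff (term_mult (c \<otimes> inv w) u h) Y = \<zero>"
        then show ?thesis using Ym unfolding m_def by (metis zero_mem_power)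
      next
        fix Z assume Z: "Y = mterm_mult u Z" "mcoeff (term_mult (c \<otimes> inv w) u h) Y = c \<otimes> inv w \<otimes> mcoeff h Z"
        have "mcoeff h Z \<notin> PIdl (t [^] Suc 0)"
        proof
          assume "mcoeff h Z \<in> PIdl (t [^] Suc 0)"
          then have "c \<otimes> inv w \<otimes> mcoeff h Z \<in> PIdl (t [^] Suc 0)" using c(1) w by (intro power_mult_l) auto
          then show False using Ym Z(2) unfolding m_def by metis
        qed
        moreover have "Z \<in> mterms n r"
        proof (rule ccontr)
          assume "Z \<notin> mterms n r"
          then show False using mcoeff_outside[OF hL] calculation zero_mem_power by metis
        qed
        ultimately have "Z \<in> gsupp 0 h" unfolding gsupp_iff by blast
        then show ?thesis using h(2) u ord_mult Z(1) unfolding is_lead_def by metis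
      qed (use c(1) w hL in auto)
    qed
    have g_lt: "(Y, X) \<in> ord" if Y: "Y \<in> gsupp i g" for Y
    proof -
      have "Y \<noteq> X" using gX Y by blast
      moreover have "Y \<in> gsupp i f \<or> Y \<in> gsupp 0 m"
        using gsupp_diff_scale[OF fL m(2)] Y unfolding g_def by blast
      ultimately show ?thesis using m_lt less.prems(3) unfolding is_lead_def by blast
    qed
    show ?case
    proof (cases "gsupp i g = {}")
      case True
      then show ?thesis using gsupp_empty[OF gL] m(1) unfolding g_def by blast
    next
      case False
      then obtain Y where Y: "is_lead (gsupp i g) Y" using gsupp_lead_exists[OF gL] by blast
      then have "(Y, X) \<in> ord" using g_lt unfolding is_lead_def by blast
      from less.IH[OF this gM g_fil Y] obtain m' where m': "m' \<in> M" "g \<ominus>\<^bsub>L\<^esub> scale (t [^] i) m' \<in> fil (Suc i)"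
        by blast
      have m'L: "m' \<in> carrier L" using m'(1) M_closed(1) by blast
      have "g \<ominus>\<^bsub>L\<^esub> scale (t [^] i) m' = f \<ominus>\<^bsub>L\<^esub> scale (t [^] i) (m \<oplus>\<^bsub>L\<^esub> m')"
        using fL m(2) m'L by (simp add: g_def scale_add L.minus_eq L.minus_add L.a_assoc)
      then show ?thesis using m' m(1) M_closed(3) by metis
    qed
  qed
  moreover have fL: "f \<in> carrier L" using assms(2) M_closed(1) by blast
  moreover have "f \<ominus>\<^bsub>L\<^esub> scale (t [^] i) \<zero>\<^bsub>L\<^esub> \<in> fil (Suc i)" if "gsupp i f = {}"
  proof -
    have "f \<ominus>\<^bsub>L\<^esub> scale (t [^] i) \<zero>\<^bsub>L\<^esub> = f" using fL by (intro mcoeff_ext) (simp add: mcoeff_diff a_minus_def)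
    then show ?thesis using gsupp_empty[OF fL that] by metis
  qed
  ultimately show ?thesis using gsupp_lead_exists[OF fL, of i] assms(2,3) M_closed(2) by blast
qed

text \<open>The single step is applied in degree \<open>i + d\<close>, and its correction
  \<open>t^(i+d) m'\<close> is absorbed as \<open>t^i (t^d m')\<close>.\<close>

lemma unit_leading_steps:
  assumes "unit_leading" "f \<in> M" "f \<in> fil i"
  shows "\<exists>m\<in>M. f \<ominus>\<^bsub>L\<^esub> scale (t [^] i) m \<in> fil (i + d)"
proof (induction d)
  case 0
  have "f \<ominus>\<^bsub>L\<^esub> scale (t [^] i) \<zero>\<^bsub>L\<^esub> = f"
    using M_closed(1)[OF assms(2)] by (intro mcoeff_ext) (simp add: mcoeff_diff a_minus_def)
  then show ?case using assms(3) M_closed(2) by (intro bexI[of _ "\<zero>\<^bsub>L\<^esub>"]) simp_all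
next
  case (Suc d)
  then obtain m where m: "m \<in> M" "f \<ominus>\<^bsub>L\<^esub> scale (t [^] i) m \<in> fil (i + d)" by blast
  define g where "g = f \<ominus>\<^bsub>L\<^esub> scale (t [^] i) m"
  have "g \<in> M" using M_closed(4,5) assms(2) m(1) by (simp add: g_def)
  from unit_leading_step[OF assms(1) this] m(2)
  obtain m' where m': "m' \<in> M" "g \<ominus>\<^bsub>L\<^esub> scale (t [^] (i + d)) m' \<in> fil (Suc (i + d))" by (auto simp: g_def)
  have L: "f \<in> carrier L" "m \<in> carrier L" "m' \<in> carrier L" using assms(2) m(1) m'(1) M_closed(1) by auto
  have "g \<ominus>\<^bsub>L\<^esub> scale (t [^] (i + d)) m' = f \<ominus>\<^bsub>L\<^esub> scale (t [^] i) (m \<oplus>\<^bsub>L\<^esub> scale (t [^] d) m')"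
    using L by (simp add: g_def scale_add scale_scale nat_pow_mult L.minus_eq L.minus_add L.a_assoc)
  moreover have "m \<oplus>\<^bsub>L\<^esub> scale (t [^] d) m' \<in> M" using m(1) m'(1) M_closed(3,5) by simp
  ultimately show ?case using m'(2) by (intro bexI[of _ "m \<oplus>\<^bsub>L\<^esub> scale (t [^] d) m'"]) simp_all
qed

text \<open>
  Since \<open>A\<close> need not be complete, the previous lemma cannot be iterated infinitely often; instead the
  chain of the submodules \<open>M : t\<^sup>k\<close> is used.
\<close>

lemma unit_leading_imp_pure:
  assumes "unit_leading"
  shows "UQ.pure"
  unfolding pure_iff
proof (intro allI ballI)
  fix i f assume f: "f \<in> M \<inter> fil i"
  define T where "T k = {y \<in> carrier L. scale (t [^] k) y \<in> M}" for k :: nat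
  have "term_closed (T k)" for k
    unfolding term_closed_def T_def
    using M_closed(2-5) by (auto simp: scale_add scale_diff term_mult_scale[symmetric] mcoeff_ext[of "scale (t [^] k) \<zero>\<^bsub>L\<^esub>" "\<zero>\<^bsub>L\<^esub>"])
  moreover have "T k \<subseteq> T (Suc k)" for k
  proof
    fix y assume y: "y \<in> T k"
    then have "scale t (scale (t [^] k) y) \<in> M" using M_closed(5) by (simp add: T_def)
    moreover have "scale t (scale (t [^] k) y) = scale (t [^] Suc k) y"
      using y by (simp add: T_def scale_scale m_comm)
    ultimately show "y \<in> T (Suc k)" using y by (simp add: T_def)
  qed
  \<comment> \<open>The chain depends on \<open>M\<close> only, so approximating \<open>f\<close> by
    \<open>K\<close> further degrees will be enough.\<close>
  ultimately obtain K where K: "\<And>k. k \<ge> K \<Longrightarrow> T k = T K" using term_closed_chain_stable[of T] by blast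
  obtain m where m: "m \<in> M" "f \<ominus>\<^bsub>L\<^esub> scale (t [^] i) m \<in> fil (i + K)"
    using unit_leading_steps[OF assms, of f i K] f by blast
  define g where "g = f \<ominus>\<^bsub>L\<^esub> scale (t [^] i) m"
  have gM: "g \<in> M" using M_closed(4,5) f m(1) by (simp add: g_def)
  obtain y where y: "y \<in> carrier L" "g = scale (t [^] (i + K)) y"
    using fil_divide m(2) unfolding g_def by blast
  \<comment> \<open>From \<open>t^(i+K) y \<in> M\<close> stationarity yields
    \<open>t^K y \<in> M\<close>; so the remainder \<open>t^(i+K) y\<close> is \<open>t^i\<close>
    times an element of \<open>M\<close>.\<close>
  have "y \<in> T (i + K)" using y gM by (simp add: T_def)
  then have ty: "scale (t [^] K) y \<in> M" using K[of "i + K"] unfolding T_def by auto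
  have L: "f \<in> carrier L" "m \<in> carrier L" using f m(1) M_closed(1) by auto
  have "f = scale (t [^] i) m \<oplus>\<^bsub>L\<^esub> g" using L by (simp add: g_def L.minus_eq L.a_lcomm L.r_neg)
  also have "\<dots> = scale (t [^] i) (m \<oplus>\<^bsub>L\<^esub> scale (t [^] K) y)"
    using L y by (simp add: scale_add scale_scale nat_pow_mult)
  finally show "\<exists>m\<in>M. f = scale (t [^] i) m" using M_closed(3)[OF m(1) ty] by blast
qed

end

section \<open>The associated graded ring\<close>

context uniserial_ring
begin

definition tpow :: "nat \<Rightarrow> 'a set" where "tpow i = PIdl (t [^] i)"

lemma ideal_power_tpow: "ideal_power A (PIdl t) = tpow"
  by (rule ext) (simp only: ideal_power_eq tpow_def)

lemma tpow_ideal: "ideal (tpow i) A"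
  unfolding tpow_def by (rule power_ideal)

sublocale tp: abelian_subgroup "tpow i" A for i
  using tpow_ideal[of i] by (intro abelian_subgroupI3) (auto simp: ideal_def abelian_group_axioms)

lemma tpow_carrier [simp]: "x \<in> tpow i \<Longrightarrow> x \<in> carrier A"
  unfolding tpow_def by (rule power_mem_carrier)

lemma tpow_0 [simp]: "tpow 0 = carrier A"
proof
  show "tpow 0 \<subseteq> carrier A" using tpow_carrier by blast
  show "carrier A \<subseteq> tpow 0"
  proof
    fix x assume "x \<in> carrier A"
    then show "x \<in> tpow 0" unfolding tpow_def mem_power_iff by (intro bexI[of _ x]) simp_all
  qed
qed

lemma tpow_antimono: "i \<le> j \<Longrightarrow> tpow j \<subseteq> tpow i"
  unfolding tpow_def by (rule power_antimono)

lemma tpow_mult: "x \<in> tpow i \<Longrightarrow> y \<in> tpow j \<Longrightarrow> x \<otimes> y \<in> tpow (i + j)"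
  unfolding tpow_def by (rule power_mult_mem)

lemma tpow_finsum: "(\<And>i. i \<in> F \<Longrightarrow> f i \<in> tpow j) \<Longrightarrow> finsum A f F \<in> tpow j"
proof (induction F rule: infinite_finite_induct)
  case (insert i F)
  have "finsum A f (insert i F) = f i \<oplus> finsum A f F"
    using insert by (intro finsum_insert) (auto intro: tpow_carrier)
  then show ?case using insert by simp
qed auto

lemma tpow_finsum_diff:
  assumes "finite F" "\<And>i. i \<in> F \<Longrightarrow> f i \<in> carrier A" "\<And>i. i \<in> F \<Longrightarrow> g i \<in> carrier A"
    "\<And>i. i \<in> F \<Longrightarrow> f i \<ominus> g i \<in> tpow j"
  shows "finsum A f F \<ominus> finsum A g F \<in> tpow j"
proof -
  have "finsum A f F = finsum A (\<lambda>i. (f i \<ominus> g i) \<oplus> g i) F"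
    using assms by (intro finsum_cong') (auto simp: minus_eq a_assoc l_neg)
  also have "\<dots> = finsum A (\<lambda>i. f i \<ominus> g i) F \<oplus> finsum A g F"
    using assms by (intro finsum_addf) auto
  finally have "finsum A f F \<ominus> finsum A g F = finsum A (\<lambda>i. f i \<ominus> g i) F \<oplus> finsum A g F \<ominus> finsum A g F"
    by (rule arg_cong)
  moreover have "x \<oplus> y \<ominus> y = x" if "x \<in> carrier A" "y \<in> carrier A" for x y
    using that by (simp add: minus_eq a_assoc r_neg)
  moreover have "finsum A (\<lambda>i. f i \<ominus> g i) F \<in> carrier A" "finsum A g F \<in> carrier A"
    using assms by (auto intro!: finsum_closed)
  ultimately have "finsum A f F \<ominus> finsum A g F = finsum A (\<lambda>i. f i \<ominus> g i) F" by simp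
  then show ?thesis using tpow_finsum[of F "\<lambda>i. f i \<ominus> g i", OF assms(4)] by simp
qed

lemma tpow_coset_eq_iff: "x \<in> carrier A \<Longrightarrow> y \<in> carrier A \<Longrightarrow> tpow j +> x = tpow j +> y \<longleftrightarrow> x \<ominus> y \<in> tpow j"
proof -
  assume xy: "x \<in> carrier A" "y \<in> carrier A"
  show ?thesis
    using tp.a_rcos_module[OF xy(2,1), of j] tp.a_rcos_self[OF xy(1), of j] tp.a_repr_independence'[OF _ xy(2), of x j]
    by (auto simp: minus_eq)
qed

lemma tpow_coset_eq_self_iff: "x \<in> carrier A \<Longrightarrow> tpow j +> x = tpow j \<longleftrightarrow> x \<in> tpow j"
  using tpow_coset_eq_iff[of x \<zero> j] tp.a_subset[of j] by (simp add: minus_eq)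

definition gr_of where "gr_of x = (\<lambda>i. tpow (Suc i) +> x i)"

text \<open>Finiteness is imposed on the classes; the representatives themselves may be non-zero in
  infinitely many degrees.\<close>

definition gr_rep where "gr_rep x \<longleftrightarrow> (\<forall>i. x i \<in> tpow i) \<and> finite {i. x i \<notin> tpow (Suc i)}"

abbreviation B where "B \<equiv> gr_ring A (PIdl t)"

lemma gr_rep_carrier: "gr_rep x \<Longrightarrow> x i \<in> carrier A"
  using tpow_carrier[of "x i" i] by (simp add: gr_rep_def)

lemma gr_rep_mem: "gr_rep x \<Longrightarrow> x i \<in> tpow i"
  by (simp add: gr_rep_def)

lemma gr_ring_carrier: "\<xi> \<in> carrier B \<longleftrightarrow> (\<exists>x. gr_rep x \<and> \<xi> = gr_of x)"
proof
  assume "\<xi> \<in> carrier B"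
  then have \<xi>: "\<forall>i. \<exists>x\<in>tpow i. \<xi> i = tpow (Suc i) +> x" "finite {i. \<xi> i \<noteq> tpow (Suc i)}"
    by (auto simp: gr_ring_def gr_carrier_def ideal_power_tpow simp del: ideal_power.simps)
  then obtain x where x: "\<And>i. x i \<in> tpow i" "\<And>i. \<xi> i = tpow (Suc i) +> x i" by metis
  have "gr_rep x" using x \<xi>(2) by (simp add: gr_rep_def tpow_coset_eq_self_iff tpow_carrier[OF x(1)])
  moreover have "\<xi> = gr_of x" using x(2) by (auto simp: gr_of_def)
  ultimately show "\<exists>x. gr_rep x \<and> \<xi> = gr_of x" by blast
next
  assume "\<exists>x. gr_rep x \<and> \<xi> = gr_of x"
  then obtain x where x: "gr_rep x" "\<xi> = gr_of x" by blast
  have "finite {i. gr_of x i \<noteq> tpow (Suc i)}"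
    using x(1) gr_rep_carrier[OF x(1)] by (simp add: gr_of_def gr_rep_def tpow_coset_eq_self_iff)
  then show "\<xi> \<in> carrier B"
    using gr_rep_mem[OF x(1)] by (auto simp: x(2) gr_ring_def gr_carrier_def ideal_power_tpow gr_of_def simp del: ideal_power.simps)
qed

lemma gr_of_closed: "gr_rep x \<Longrightarrow> gr_of x \<in> carrier B"
  by (auto simp: gr_ring_carrier)

lemma gr_zero: "\<zero>\<^bsub>B\<^esub> = (\<lambda>i. tpow (Suc i))"
  by (simp add: gr_ring_def ideal_power_tpow del: ideal_power.simps)

lemma gr_zero_of: "\<zero>\<^bsub>B\<^esub> = gr_of (\<lambda>i. \<zero>)"
proof
  fix i show "\<zero>\<^bsub>B\<^esub> i = gr_of (\<lambda>i. \<zero>) i"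
    using tpow_coset_eq_self_iff[of \<zero> "Suc i"] by (simp add: gr_zero gr_of_def)
qed

lemma gr_one_of: "\<one>\<^bsub>B\<^esub> = gr_of (\<lambda>i. if i = 0 then \<one> else \<zero>)"
  by (simp add: gr_ring_def ideal_power_tpow gr_of_def del: ideal_power.simps)

lemma gr_add_of: "gr_rep x \<Longrightarrow> gr_rep y \<Longrightarrow> gr_of x \<oplus>\<^bsub>B\<^esub> gr_of y = gr_of (\<lambda>i. x i \<oplus> y i)"
  using tp.a_rcos_sum gr_rep_carrier by (simp add: gr_ring_def gr_of_def)

lemma gr_rep_zero [simp]: "gr_rep (\<lambda>i. \<zero>)"
  by (simp add: gr_rep_def)

lemma gr_rep_add: "gr_rep x \<Longrightarrow> gr_rep y \<Longrightarrow> gr_rep (\<lambda>i. x i \<oplus> y i)"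
proof -
  assume *: "gr_rep x" "gr_rep y"
  have "{i. x i \<oplus> y i \<notin> tpow (Suc i)} \<subseteq> {i. x i \<notin> tpow (Suc i)} \<union> {i. y i \<notin> tpow (Suc i)}" by auto
  then have "finite {i. x i \<oplus> y i \<notin> tpow (Suc i)}"
    by (rule finite_subset) (use * in \<open>auto simp: gr_rep_def\<close>)
  then show ?thesis using * by (simp add: gr_rep_def)
qed

lemma gr_rep_uminus: "gr_rep x \<Longrightarrow> gr_rep (\<lambda>i. \<ominus> x i)"
proof -
  assume *: "gr_rep x"
  have "{i. \<ominus> x i \<notin> tpow (Suc i)} \<subseteq> {i. x i \<notin> tpow (Suc i)}" by auto
  then have "finite {i. \<ominus> x i \<notin> tpow (Suc i)}"
    by (rule finite_subset) (use * in \<open>auto simp: gr_rep_def\<close>)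
  then show ?thesis using * by (simp add: gr_rep_def)
qed

lemma gr_uminus_of: "gr_rep x \<Longrightarrow> gr_of (\<lambda>i. \<ominus> x i) \<oplus>\<^bsub>B\<^esub> gr_of x = \<zero>\<^bsub>B\<^esub>"
  using gr_rep_carrier gr_rep_uminus by (simp add: gr_add_of gr_zero_of l_neg)

definition conv where "conv x y = (\<lambda>k::nat. \<Oplus>i\<in>{..k}. x i \<otimes> y (k - i))"

text \<open>In degree \<open>k \<ge> Nx + Ny\<close> each product
  \<open>x i \<otimes> y (k - i)\<close> has a factor beyond its bound, which puts the product one
  step deeper into the filtration.\<close>

lemma gr_rep_conv:
  assumes "gr_rep x" "gr_rep y"
  shows "gr_rep (conv x y)"
proof -
  note xm = gr_rep_mem[OF assms(1)] and ym = gr_rep_mem[OF assms(2)]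
  obtain Nx where Nx: "\<And>i. Nx \<le> i \<Longrightarrow> x i \<in> tpow (Suc i)"
    using assms(1) finite_nat_set_iff_bounded[of "{i. x i \<notin> tpow (Suc i)}"] by (auto simp: gr_rep_def) (meson not_le)
  obtain Ny where Ny: "\<And>i. Ny \<le> i \<Longrightarrow> y i \<in> tpow (Suc i)"
    using assms(2) finite_nat_set_iff_bounded[of "{i. y i \<notin> tpow (Suc i)}"] by (auto simp: gr_rep_def) (meson not_le)
  have mem: "conv x y k \<in> tpow k" for k
  proof -
    have "x i \<otimes> y (k - i) \<in> tpow k" if "i \<in> {..k}" for i
      using tpow_mult[OF xm[of i] ym[of "k - i"]] that by simp
    then show ?thesis unfolding conv_def by (intro tpow_finsum)
  qed
  have "conv x y k \<in> tpow (Suc k)" if k: "Nx + Ny \<le> k" for k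
  proof -
    have "x i \<otimes> y (k - i) \<in> tpow (Suc k)" if "i \<in> {..k}" for i
    proof (cases "Nx \<le> i")
      case True
      then show ?thesis using tpow_mult[OF Nx[OF True] ym[of "k - i"]] that by simp
    next
      case False
      then have "Ny \<le> k - i" using k by simp
      then show ?thesis using tpow_mult[OF xm[of i] Ny[of "k - i"]] that by simp
    qed
    then show ?thesis unfolding conv_def by (intro tpow_finsum)
  qed
  then have "{k. conv x y k \<notin> tpow (Suc k)} \<subseteq> {..<Nx + Ny}" using not_le by auto
  then have "finite {k. conv x y k \<notin> tpow (Suc k)}" by (rule finite_subset) simp
  then show ?thesis using mem by (simp add: gr_rep_def)
qed

text \<open>The product is a union over all representatives. Independence of their choice follows
  from \<open>x' y' - x y = (x' - x) y' + x (y' - y)\<close>, where in degree \<open>k\<close> both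
  summands lie in \<open>t^(k+1) A\<close>.\<close>

lemma gr_mult_of:
  assumes "gr_rep x" "gr_rep y"
  shows "gr_of x \<otimes>\<^bsub>B\<^esub> gr_of y = gr_of (conv x y)"
proof
  fix k
  let ?S = "{tpow (Suc k) +> (\<Oplus>i\<in>{..k}. x' i \<otimes> y' (k - i)) | x' y'.
    (\<forall>i. x' i \<in> gr_of x i) \<and> (\<forall>i. y' i \<in> gr_of y i)}"
  have "tpow (Suc k) +> (\<Oplus>i\<in>{..k}. x' i \<otimes> y' (k - i)) = gr_of (conv x y) k"
    if x': "\<forall>i. x' i \<in> gr_of x i" and y': "\<forall>i. y' i \<in> gr_of y i" for x' y'
  proof -
    have coset: "z \<in> tpow i \<and> z \<ominus> w i \<in> tpow (Suc i)" if "z \<in> gr_of w i" "gr_rep w" for z w i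
    proof -
      have w: "w i \<in> tpow i" "w i \<in> carrier A" using gr_rep_mem gr_rep_carrier that(2) by auto
      have z: "z \<in> carrier A" using that(1) w(2) tp.a_elemrcos_carrier unfolding gr_of_def by blast
      have zw: "z \<ominus> w i \<in> tpow (Suc i)"
        using that(1) tp.a_rcos_module[OF w(2) z, of "Suc i"] by (simp add: gr_of_def minus_eq)
      have "z = (z \<ominus> w i) \<oplus> w i" using w z by (simp add: minus_eq a_assoc l_neg)
      then show ?thesis using zw w(1) tpow_antimono[of i "Suc i"] tp.a_closed by (metis le_SucI order_refl subsetD)
    qed
    have xc: "x' i \<in> tpow i" "x' i \<ominus> x i \<in> tpow (Suc i)" for i using coset x' assms(1) by auto
    have yc: "y' i \<in> tpow i" "y' i \<ominus> y i \<in> tpow (Suc i)" for i using coset y' assms(2) by auto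
    have c: "x i \<in> carrier A" "y i \<in> carrier A" "x' i \<in> carrier A" "y' i \<in> carrier A" for i
      using gr_rep_carrier assms tpow_carrier[OF xc(1)] tpow_carrier[OF yc(1)] by auto
    have "(\<Oplus>i\<in>{..k}. x' i \<otimes> y' (k - i)) \<ominus> (\<Oplus>i\<in>{..k}. x i \<otimes> y (k - i)) \<in> tpow (Suc k)"
    proof (rule tpow_finsum_diff)
      fix i assume i: "i \<in> {..k}"
      have "(x' i \<ominus> x i) \<otimes> y' (k - i) \<in> tpow (Suc k)"
        using tpow_mult[OF xc(2)[of i] yc(1)[of "k - i"]] i by simp
      moreover have "x i \<otimes> (y' (k - i) \<ominus> y (k - i)) \<in> tpow (Suc k)"
        using tpow_mult[OF gr_rep_mem[OF assms(1), of i] yc(2)[of "k - i"]] i by simp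
      moreover have "x' i \<otimes> y' (k - i) \<ominus> x i \<otimes> y (k - i) =
          (x' i \<ominus> x i) \<otimes> y' (k - i) \<oplus> x i \<otimes> (y' (k - i) \<ominus> y (k - i))"
        using c[of i] c[of "k - i"] by (simp add: minus_eq l_distr r_distr l_minus r_minus a_assoc r_neg1)
      ultimately show "x' i \<otimes> y' (k - i) \<ominus> x i \<otimes> y (k - i) \<in> tpow (Suc k)" by simp
    qed (use c in auto)
    then show ?thesis unfolding gr_of_def conv_def using c by (subst tpow_coset_eq_iff) (auto intro!: finsum_closed)
  qed
  moreover have "?S \<noteq> {}"
  proof -
    have "x i \<in> gr_of x i" "y i \<in> gr_of y i" for i
      using tp.a_rcos_self gr_rep_carrier assms by (auto simp: gr_of_def)
    then show ?thesis by blast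
  qed
  ultimately have "\<Union>?S = gr_of (conv x y) k" by blast
  then show "(gr_of x \<otimes>\<^bsub>B\<^esub> gr_of y) k = gr_of (conv x y) k"
    by (simp add: gr_ring_def ideal_power_tpow del: ideal_power.simps)
qed

lemma gr_ring_coefficient_ring: "coefficient_ring B"
proof -
  have "abelian_group B"
  proof (rule abelian_groupI)
    fix \<xi> \<eta> \<zeta> assume "\<xi> \<in> carrier B" "\<eta> \<in> carrier B" "\<zeta> \<in> carrier B"
    then obtain x y z where x: "gr_rep x" "\<xi> = gr_of x" "gr_rep y" "\<eta> = gr_of y" "gr_rep z" "\<zeta> = gr_of z"
      by (auto simp: gr_ring_carrier)
    show "\<xi> \<oplus>\<^bsub>B\<^esub> \<eta> \<in> carrier B"
      using x by (simp add: gr_add_of gr_of_closed gr_rep_add)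
    show "\<xi> \<oplus>\<^bsub>B\<^esub> \<eta> \<oplus>\<^bsub>B\<^esub> \<zeta> = \<xi> \<oplus>\<^bsub>B\<^esub> (\<eta> \<oplus>\<^bsub>B\<^esub> \<zeta>)"
      using x gr_rep_carrier by (simp add: gr_add_of gr_rep_add a_assoc)
    show "\<xi> \<oplus>\<^bsub>B\<^esub> \<eta> = \<eta> \<oplus>\<^bsub>B\<^esub> \<xi>"
      using x gr_rep_carrier by (simp add: gr_add_of a_comm)
    show "\<zero>\<^bsub>B\<^esub> \<oplus>\<^bsub>B\<^esub> \<xi> = \<xi>"
      using x gr_rep_carrier by (simp add: gr_add_of gr_zero_of)
    show "\<exists>\<eta>\<in>carrier B. \<eta> \<oplus>\<^bsub>B\<^esub> \<xi> = \<zero>\<^bsub>B\<^esub>"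
      using x gr_rep_uminus by (intro bexI[of _ "gr_of (\<lambda>i. \<ominus> x i)"]) (simp_all add: gr_uminus_of gr_of_closed)
  qed (simp add: gr_zero_of gr_of_closed)
  moreover have "\<xi> \<otimes>\<^bsub>B\<^esub> \<eta> \<in> carrier B" if "\<xi> \<in> carrier B" "\<eta> \<in> carrier B" for \<xi> \<eta>
  proof -
    obtain x y where "gr_rep x" "\<xi> = gr_of x" "gr_rep y" "\<eta> = gr_of y"
      using \<open>\<xi> \<in> _\<close> \<open>\<eta> \<in> _\<close> by (auto simp: gr_ring_carrier)
    then show ?thesis by (simp add: gr_mult_of gr_of_closed gr_rep_conv)
  qed
  moreover have "\<zero>\<^bsub>B\<^esub> \<otimes>\<^bsub>B\<^esub> \<xi> = \<zero>\<^bsub>B\<^esub>" "\<xi> \<otimes>\<^bsub>B\<^esub> \<zero>\<^bsub>B\<^esub> = \<zero>\<^bsub>B\<^esub>" if "\<xi> \<in> carrier B" for \<xi>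
  proof -
    obtain x where x: "gr_rep x" "\<xi> = gr_of x" using \<open>\<xi> \<in> _\<close> by (auto simp: gr_ring_carrier)
    then have "conv (\<lambda>i. \<zero>) x = (\<lambda>i. \<zero>)" "conv x (\<lambda>i. \<zero>) = (\<lambda>i. \<zero>)"
      using gr_rep_carrier by (auto simp: conv_def)
    then show "\<zero>\<^bsub>B\<^esub> \<otimes>\<^bsub>B\<^esub> \<xi> = \<zero>\<^bsub>B\<^esub>" "\<xi> \<otimes>\<^bsub>B\<^esub> \<zero>\<^bsub>B\<^esub> = \<zero>\<^bsub>B\<^esub>"
      using x by (simp_all add: gr_zero_of gr_mult_of)
  qed
  ultimately show ?thesis by (simp add: coefficient_ring_def coefficient_ring_axioms_def)
qed

section \<open>Homogeneous elements of the associated graded ring\<close>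

definition homog where "homog i c = gr_of (\<lambda>k. if k = i then c else \<zero>)"

lemma homog_rep: "c \<in> tpow i \<Longrightarrow> gr_rep (\<lambda>k. if k = i then c else \<zero>)"
proof -
  assume "c \<in> tpow i"
  moreover have "finite {k. (if k = i then c else \<zero>) \<notin> tpow (Suc k)}"
    by (rule finite_subset[of _ "{i}"]) (auto split: if_splits)
  ultimately show ?thesis by (simp add: gr_rep_def)
qed

lemma homog_closed: "c \<in> tpow i \<Longrightarrow> homog i c \<in> carrier B"
  unfolding homog_def by (intro gr_of_closed homog_rep)

lemma homog_component: "c \<in> tpow i \<Longrightarrow> homog i c k = tpow (Suc k) \<longleftrightarrow> k \<noteq> i \<or> c \<in> tpow (Suc i)"
  using tpow_coset_eq_self_iff[of c "Suc i"] tpow_coset_eq_self_iff[of \<zero> "Suc k"]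
  by (auto simp: homog_def gr_of_def)

lemma homog_zero [simp]: "homog i \<zero> = \<zero>\<^bsub>B\<^esub>"
  by (simp add: homog_def gr_zero_of)

lemma homog_eq_zero_iff: "c \<in> tpow i \<Longrightarrow> homog i c = \<zero>\<^bsub>B\<^esub> \<longleftrightarrow> c \<in> tpow (Suc i)"
  using homog_component[of c i] by (auto simp: gr_zero fun_eq_iff)

lemma homog_val: "c \<in> tpow i \<Longrightarrow> c \<notin> tpow (Suc i) \<Longrightarrow> gr_val A (PIdl t) (homog i c) = i"
  using homog_component[of c i] unfolding gr_val_def ideal_power_tpow by (intro the_equality) auto

text \<open>The convolution has a single term if one factor has degree 0. This case is enough for
  reduction, where division is by leading coefficients of degree 0.\<close>

lemma homog_mult_0: "c \<in> tpow i \<Longrightarrow> d \<in> carrier A \<Longrightarrow> homog i c \<otimes>\<^bsub>B\<^esub> homog 0 d = homog i (c \<otimes> d)"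
proof -
  assume c: "c \<in> tpow i" and d: "d \<in> carrier A"
  let ?x = "\<lambda>k. if k = i then c else \<zero>" and ?y = "\<lambda>k::nat. if k = 0 then d else \<zero>"
  have "conv ?x ?y k = (if k = i then c \<otimes> d else \<zero>)" for k
  proof -
    have "conv ?x ?y k = (\<Oplus>j\<in>{..k}. if k = j then ?x j \<otimes> d else \<zero>)"
      unfolding conv_def using c d by (intro finsum_cong') auto
    also have "\<dots> = ?x k \<otimes> d"
      using c d by (intro finsum_singleton) auto
    finally show ?thesis using c d by simp
  qed
  then have "conv ?x ?y = (\<lambda>k. if k = i then c \<otimes> d else \<zero>)" by auto
  then show ?thesis
    using gr_mult_of[OF homog_rep[OF c] homog_rep[of d 0]] d by (simp add: homog_def)
qed

lemma homog_one: "homog 0 \<one> = \<one>\<^bsub>B\<^esub>"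
  by (simp add: homog_def gr_one_of)

text \<open>For \<open>i \<noteq> 0\<close> every multiple of the element has zero component in
  degree 0, unlike \<open>1\<close>. For \<open>i = 0\<close> the element \<open>c\<close> is a unit
  of \<open>A\<close>, and the class of its inverse is an inverse.\<close>

lemma homog_unit_iff:
  assumes "c \<in> tpow i" "c \<notin> tpow (Suc i)"
  shows "homog i c \<in> Units B \<longleftrightarrow> i = 0"
proof
  assume "homog i c \<in> Units B"
  then obtain \<eta> where \<eta>: "\<eta> \<in> carrier B" "homog i c \<otimes>\<^bsub>B\<^esub> \<eta> = \<one>\<^bsub>B\<^esub>" by (auto simp: Units_def)
  then obtain y where y: "gr_rep y" "\<eta> = gr_of y" by (auto simp: gr_ring_carrier)
  show "i = 0"
  proof (rule ccontr)
    assume "i \<noteq> 0"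
    then have "conv (\<lambda>k. if k = i then c else \<zero>) y 0 = \<zero>"
      using gr_rep_carrier[OF y(1)] by (simp add: conv_def)
    then have "(homog i c \<otimes>\<^bsub>B\<^esub> \<eta>) 0 = tpow (Suc 0) +> \<zero>"
      unfolding homog_def y(2) gr_mult_of[OF homog_rep[OF assms(1)] y(1)] by (simp add: gr_of_def)
    also have "\<dots> = tpow (Suc 0)" using tpow_coset_eq_self_iff[of \<zero>] by simp
    finally have "homog 0 \<one> 0 = tpow (Suc 0)" unfolding homog_one \<eta>(2) .
    then have "\<one> \<in> tpow (Suc 0)" using homog_component[of \<one> 0 0] by simp
    then show False using one_notin by (simp add: tpow_def)
  qed
next
  assume i: "i = 0"
  then have "c \<in> Units A" using assms(2) tpow_carrier[OF assms(1)] unit_iff by (simp add: tpow_def)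
  then have "homog 0 c \<otimes>\<^bsub>B\<^esub> homog 0 (inv c) = \<one>\<^bsub>B\<^esub>" "homog 0 (inv c) \<otimes>\<^bsub>B\<^esub> homog 0 c = \<one>\<^bsub>B\<^esub>"
    by (simp_all add: homog_mult_0 homog_one Units_closed)
  then show "homog i c \<in> Units B"
    using i \<open>c \<in> Units A\<close> by (auto simp: Units_def[of B] homog_closed intro!: bexI[of _ "homog 0 (inv c)"])
qed

end

section \<open>Groebner bases of homogeneous elements\<close>

text \<open>\<open>Lt(G)\<close> lies in the submodule of the elements whose coefficients belong to
  \<open>J\<close> outside the multiples of those \<open>lp(g)\<close> with
  \<open>lc(g) \<notin> J\<close>, and \<open>lt(f)\<close> belongs to \<open>Lt(N) = Lt(G)\<close>.
  The set \<open>J\<close>, closed like an ideal, consists of the coefficients to be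
  ignored.\<close>

lemma (in coefficient_ring) groebner_lead_dvd:
  assumes J: "\<zero> \<in> J" "\<And>x y. x \<in> J \<Longrightarrow> y \<in> J \<Longrightarrow> x \<oplus> y \<in> J" "\<And>x. x \<in> J \<Longrightarrow> \<ominus> x \<in> J"
      "\<And>c x. c \<in> carrier B \<Longrightarrow> x \<in> J \<Longrightarrow> x \<in> carrier B \<Longrightarrow> c \<otimes> x \<in> J"
    and G: "groebner_basis B n r ord N G"
    and G_lt: "\<And>g. g \<in> G \<Longrightarrow> lc B n r ord g \<in> carrier B \<and> lp B n r ord g \<in> mterms n r"
    and f: "f \<in> N" "f \<noteq> \<zero>\<^bsub>free_poly_module B n r\<^esub>" "lp B n r ord f \<in> mterms n r" "lc B n r ord f \<notin> J"
  shows "\<exists>g\<in>G. lc B n r ord g \<notin> J \<and> mterm_dvd n (lp B n r ord g) (lp B n r ord f)"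
proof -
  define D where "D X \<longleftrightarrow> (\<exists>g\<in>G. lc B n r ord g \<notin> J \<and> mterm_dvd n (lp B n r ord g) X)" for X
  have D_mult: "D (mterm_mult u X)" if "u \<in> monomials n" "D X" for u X
  proof -
    have "mterm_dvd n X (mterm_mult u X)" using that(1) by (auto simp: mterm_dvd_def)
    then show ?thesis using that(2) mterm_dvd_trans unfolding D_def by blast
  qed
  define K where "K = {h \<in> carrier (free_poly_module B n r). \<forall>X\<in>mterms n r. \<not> D X \<longrightarrow> mcoeff h X \<in> J}"
  have "submodule K (mpoly_ring B n) (free_poly_module B n r)"
    unfolding K_def by (rule coefficient_submodule[where J = J and D = D and n = n, OF J D_mult])
  moreover have "lt B n r ord ` (G - {\<zero>\<^bsub>free_poly_module B n r\<^esub>}) \<subseteq> K"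
  proof
    fix h assume "h \<in> lt B n r ord ` (G - {\<zero>\<^bsub>free_poly_module B n r\<^esub>})"
    then obtain g where g: "g \<in> G" "h = lt B n r ord g" by blast
    have "D (lp B n r ord g)" if "lc B n r ord g \<notin> J"
      using that g(1) mterm_dvd_refl unfolding D_def by blast
    then have "mcoeff h X \<in> J" if "\<not> D X" for X
      using that J(1) unfolding g(2) lt_def mcoeff_scaled_term by metis
    moreover have "h \<in> carrier (free_poly_module B n r)"
      unfolding g(2) lt_def using G_lt[OF g(1)] by (intro scaled_term_closed) auto
    ultimately show "h \<in> K" by (simp add: K_def)
  qed
  ultimately have "Lt B n r ord G \<subseteq> K"
    unfolding Lt_def module_span_def by (intro hull_minimal)
  moreover have "lt B n r ord f \<in> Lt B n r ord N"
    unfolding Lt_def module_span_def using f(1,2) by (intro hull_inc) auto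
  ultimately have "lt B n r ord f \<in> K" using G by (auto simp: groebner_basis_def)
  moreover have "mcoeff (lt B n r ord f) (lp B n r ord f) = lc B n r ord f"
    by (simp add: lt_def mcoeff_scaled_term)
  ultimately have "D (lp B n r ord f)" using f(3,4) unfolding K_def by (metis (mono_tags, lifting) mem_Collect_eq)
  then show ?thesis unfolding D_def .
qed

text \<open>One reduction step suffices: it uses \<open>g'\<close> alone, all other coefficients
  being zero, and removes the leading term of \<open>g\<close>.\<close>

lemma (in ordered_terms) strictly_reducible_by_element:
  fixes B :: "('b, 'd) ring_scheme" (structure)
  assumes B: "coefficient_ring B" and S: "finite S" "S \<subseteq> carrier (free_poly_module B n r)" "g' \<in> S"
    and g: "g \<in> carrier (free_poly_module B n r)"
    and lead: "is_lead (support B n r g) X" "is_lead (support B n r g') X'"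
    and u: "u \<in> monomials n" "X = mterm_mult u X'"
    and c: "c \<in> carrier B" "c \<otimes> mcoeff g' X' = mcoeff g X"
  shows "strictly_reducible B n r ord S g"
proof -
  interpret coefficient_ring B by (rule B)
  let ?F = "free_poly_module B n r"
  interpret F: abelian_group ?F by (rule free_poly_module_abelian)
  have g': "g' \<in> carrier ?F" using S by blast
  define cc where "cc s = (if s = g' then c else \<zero>)" for s
  define uu where "uu s = (if s = g' then u else {#})" for s
  have lp: "lp B n r ord g = X" "lp B n r ord g' = X'" using lead lp_eq by blast+
  have X: "X \<in> mterms n r" "mcoeff g X \<noteq> \<zero>" "X' \<in> mterms n r"
    using lead by (auto simp: is_lead_def support_def)
  have monom: "poly_monom B c u \<odot>\<^bsub>?F\<^esub> f \<in> carrier ?F" if "f \<in> carrier ?F" for f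
    using that c(1) u(1) by (intro poly_smult_closed poly_monom_closed)
  have zero: "poly_monom B \<zero> {#} \<odot>\<^bsub>?F\<^esub> f = \<zero>\<^bsub>?F\<^esub>" if "f \<in> carrier ?F" for f
  proof (rule mcoeff_ext)
    fix Y show "mcoeff (poly_monom B \<zero> {#} \<odot>\<^bsub>?F\<^esub> f) Y = mcoeff \<zero>\<^bsub>?F\<^esub> Y"
      using poly_monom_smult_mcoeff[OF _ that, of \<zero> "{#}" "fst Y" "snd Y"] mcoeff_closed[OF that, of Y] by simp
  qed
  have sum: "(\<Oplus>\<^bsub>?F\<^esub>s\<in>S. poly_monom B (cc s) (uu s) \<odot>\<^bsub>?F\<^esub> h s) = poly_monom B c u \<odot>\<^bsub>?F\<^esub> h g'"
    if h: "h g' \<in> carrier ?F" "\<And>s. s \<in> S \<Longrightarrow> h s \<in> carrier ?F" for h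
  proof -
    have "(\<Oplus>\<^bsub>?F\<^esub>s\<in>S. poly_monom B (cc s) (uu s) \<odot>\<^bsub>?F\<^esub> h s) =
      (\<Oplus>\<^bsub>?F\<^esub>s\<in>S. if g' = s then poly_monom B c u \<odot>\<^bsub>?F\<^esub> h g' else \<zero>\<^bsub>?F\<^esub>)"
      using h monom[OF h(1)] zero by (intro F.finsum_cong') (auto simp: cc_def uu_def)
    also have "\<dots> = poly_monom B c u \<odot>\<^bsub>?F\<^esub> h g'"
      using S monom[OF h(1)] F.finsum_singleton[of g' S "\<lambda>_. poly_monom B c u \<odot>\<^bsub>?F\<^esub> h g'"] by auto
    finally show ?thesis .
  qed
  \<comment> \<open>A zero element of \<open>S\<close> has an unspecified leading power product; its
    leading term is zero nevertheless, because all its coefficients are.\<close>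
  have lt_closed: "lt B n r ord s \<in> carrier ?F" if s: "s \<in> S" for s
  proof (cases "s = \<zero>\<^bsub>?F\<^esub>")
    case True
    have "lt B n r ord s = \<zero>\<^bsub>?F\<^esub>"
      unfolding lt_def lc_def True by (intro mcoeff_ext) (simp add: mcoeff_scaled_term)
    then show ?thesis by simp
  next
    case False
    have sF: "s \<in> carrier ?F" using s S by blast
    have "\<exists>Y. mcoeff s Y \<noteq> \<zero>" using False mcoeff_ext[of s "\<zero>\<^bsub>?F\<^esub>"] by fastforce
    then have "support B n r s \<noteq> {}" using mcoeff_outside[OF sF] by (auto simp: support_def)
    moreover have "finite (support B n r s)"
      using mcoeff_finite[OF sF] by (rule rev_finite_subset) (auto simp: support_def)
    ultimately obtain Y where Y: "is_lead (support B n r s) Y"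
      using is_lead_exists[of "support B n r s"] by (auto simp: support_def)
    then have "lp B n r ord s = Y" by (rule lp_eq)
    moreover have "Y \<in> mterms n r" using Y by (simp add: is_lead_def support_def)
    ultimately show ?thesis using sF unfolding lt_def lc_def by (intro scaled_term_closed) simp_all
  qed
  define h where "h = g \<ominus>\<^bsub>?F\<^esub> (poly_monom B c u \<odot>\<^bsub>?F\<^esub> g')"
  have hF: "h \<in> carrier ?F" using g monom[OF g'] by (simp add: h_def)
  have h_coeff: "mcoeff h Y = mcoeff g Y \<ominus> mcoeff (poly_monom B c u \<odot>\<^bsub>?F\<^esub> g') Y" for Y
    unfolding h_def using g monom[OF g'] by (rule mcoeff_diff)
  have hX: "mcoeff h X = \<zero>"
    using poly_monom_smult_mcoeff_mult[OF c(1) g', of u X'] mcoeff_closed[OF g, of X]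
    by (simp add: h_coeff c(2) flip: u(2)) (simp add: minus_eq r_neg)
  have lt_eq: "lt B n r ord g = poly_monom B c u \<odot>\<^bsub>?F\<^esub> lt B n r ord g'"
  proof (rule mcoeff_ext)
    fix Y
    have lt': "lt B n r ord g' \<in> carrier ?F" using lt_closed S(3) by blast
    have eq: "mcoeff (lt B n r ord g') Z = (if Z = X' then mcoeff g' X' else \<zero>)" for Z
      by (simp add: lt_def lc_def lp mcoeff_scaled_term)
    show "mcoeff (lt B n r ord g) Y = mcoeff (poly_monom B c u \<odot>\<^bsub>?F\<^esub> lt B n r ord g') Y"
    proof (cases "Y = X")
      case True
      then show ?thesis
        using poly_monom_smult_mcoeff_mult[OF c(1) lt', of u X'] u(2) c(2)
        by (simp add: eq lt_def lc_def lp mcoeff_scaled_term)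
    next
      case False
      then have "mcoeff (poly_monom B c u \<odot>\<^bsub>?F\<^esub> lt B n r ord g') Y = \<zero>"
        using poly_monom_smult_mcoeff_cases[OF c(1) lt', of u Y] u(2) unfolding eq by metis
      then show ?thesis using False by (simp add: lt_def lp mcoeff_scaled_term)
    qed
  qed
  have "reduces_to B n r ord S g h"
    unfolding reduces_to_def Let_def
  proof (intro conjI exI[of _ cc] exI[of _ uu])
    show "g \<noteq> \<zero>\<^bsub>?F\<^esub>" using X(2) by auto
    show "\<forall>s\<in>S. cc s \<in> carrier B \<and> uu s \<in> monomials n \<and>
      (cc s \<noteq> \<zero> \<longrightarrow> lp B n r ord g = mterm_mult (uu s) (lp B n r ord s))"
      using c(1) u by (auto simp: cc_def uu_def lp)
    show "lt B n r ord g = (\<Oplus>\<^bsub>?F\<^esub>s\<in>S. poly_monom B (cc s) (uu s) \<odot>\<^bsub>?F\<^esub> lt B n r ord s)"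
      using sum[of "lt B n r ord"] lt_closed S(3) lt_eq by auto
    show "h = g \<ominus>\<^bsub>?F\<^esub> (\<Oplus>\<^bsub>?F\<^esub>s\<in>S. poly_monom B (cc s) (uu s) \<odot>\<^bsub>?F\<^esub> s)"
      using sum[of "\<lambda>s. s", OF g' subsetD[OF S(2)]] by (simp add: h_def)
  qed (rule g)
  moreover have "h = \<zero>\<^bsub>?F\<^esub> \<or> (lp B n r ord h, lp B n r ord g) \<in> ord"
  proof (cases "support B n r h = {}")
    case True
    then have "mcoeff h Y = \<zero>" for Y using mcoeff_outside[OF hF, of Y] by (auto simp: support_def)
    then have "h = \<zero>\<^bsub>?F\<^esub>" by (intro mcoeff_ext) simp
    then show ?thesis by blast
  next
    case False
    have "finite (support B n r h)"
      using mcoeff_finite[OF hF] by (rule rev_finite_subset) (auto simp: support_def)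
    then obtain Y where Y: "is_lead (support B n r h) Y"
      using False is_lead_exists[of "support B n r h"] by (auto simp: support_def)
    then have hY: "Y \<in> mterms n r" "mcoeff h Y \<noteq> \<zero>" by (simp_all add: is_lead_def support_def)
    have "Y \<noteq> X" using hX hY(2) by blast
    \<comment> \<open>A term of \<open>h\<close> comes from \<open>g\<close> or is \<open>u\<close>
      times a term of \<open>g'\<close>, and neither kind exceeds \<open>X\<close>.\<close>
    moreover have "Y = X \<or> (Y, X) \<in> ord"
    proof (cases "mcoeff g Y = \<zero>")
      case True
      then have "mcoeff (poly_monom B c u \<odot>\<^bsub>?F\<^esub> g') Y \<noteq> \<zero>" using hY(2) by (auto simp: h_coeff minus_eq)
      then obtain Z where Z: "Y = mterm_mult u Z" "mcoeff g' Z \<noteq> \<zero>"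
        using poly_monom_smult_mcoeff_cases[OF c(1) g'] by blast
      then have "Z \<in> support B n r g'" using mcoeff_outside[OF g', of Z] unfolding support_def by blast
      then have "Z = X' \<or> (Z, X') \<in> ord" using lead(2) unfolding is_lead_def by metis
      then show ?thesis using Z(1) u ord_mult by metis
    next
      case False
      then have "Y \<in> support B n r g" using hY(1) by (simp add: support_def)
      then show ?thesis using lead(1) unfolding is_lead_def by metis
    qed
    ultimately show ?thesis using lp_eq[OF Y] lp(1) by metis
  qed
  ultimately show ?thesis unfolding strictly_reducible_def by blast
qed

section \<open>The associated graded module in terms of coefficients\<close>

context uniserial_polynomials
begin

sublocale gr: coefficient_ring "gr_ring A (PIdl t)" by (rule gr_ring_coefficient_ring)

lemma fil_tpow: "fil i = {f \<in> carrier L. \<forall>X. mcoeff f X \<in> tpow i}"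
  by (simp add: fil_def tpow_def)

lemma gsupp_tpow: "gsupp i f = {X \<in> mterms n r. mcoeff f X \<notin> tpow (Suc i)}"
  by (simp only: gsupp_def tpow_def)

lemma zero_fil: "\<zero>\<^bsub>L\<^esub> \<in> fil i"
  by (simp add: fil_def)

lemma fil_submodule: "submodule (fil i) A (restrict_scalars (poly_const A) L)"
proof -
  have inv: "\<ominus>\<^bsub>restrict_scalars (poly_const A) L\<^esub> f = \<ominus>\<^bsub>L\<^esub> f" for f
    by (simp add: a_inv_def m_inv_def restrict_scalars_def)
  show ?thesis
    by (rule submoduleI) (auto simp: inv fil_tpow power_mult_l tpow_def power_add_mem power_minus_mem
        poly_smult_closed[OF poly_const_closed])
qed

text \<open>Each element of \<open>t^i L\<close> is a single product of \<open>t^i\<close> with an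
  element of \<open>L\<close>, so it already belongs to the generating set.\<close>

lemma madic_fil_eq: "madic_fil A (PIdl t) n r = fil"
proof
  fix i
  let ?L = "restrict_scalars (poly_const A) L"
  let ?S = "{a \<odot>\<^bsub>?L\<^esub> x | a x. a \<in> tpow i \<and> x \<in> carrier ?L}"
  have "(\<lambda>H. submodule H A ?L) hull ?S \<subseteq> fil i"
  proof (rule hull_minimal)
    show "?S \<subseteq> fil i"
    proof
      fix f assume "f \<in> ?S"
      then obtain a x where ax: "f = poly_const A a \<odot>\<^bsub>L\<^esub> x" "a \<in> tpow i" "x \<in> carrier L" by auto
      have "mcoeff f X \<in> tpow i" for X
        using ax tpow_carrier[OF ax(2)] mcoeff_L[OF ax(3), of X] power_mult_r by (simp add: tpow_def)
      then show "f \<in> fil i"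
        using ax tpow_carrier[OF ax(2)] by (simp add: fil_tpow poly_smult_closed[OF poly_const_closed])
    qed
  qed (rule fil_submodule)
  moreover have "fil i \<subseteq> (\<lambda>H. submodule H A ?L) hull ?S"
  proof
    fix f assume "f \<in> fil i"
    then obtain g where g: "g \<in> carrier L" "f = scale (t [^] i) g" by (rule fil_divide)
    have "t [^] i \<in> tpow i" by (simp add: tpow_def cgenideal_self)
    then have "f \<in> ?S" using g by (auto simp: scale_eq)
    then show "f \<in> (\<lambda>H. submodule H A ?L) hull ?S" by (rule hull_inc)
  qed
  ultimately show "madic_fil A (PIdl t) n r i = fil i"
    by (simp add: madic_fil_def ideal_smult_def module_span_def ideal_power_tpow)
qed

text \<open>Every element of the right-hand coset is reached by adding a single term at
  \<open>X\<close> to \<open>x\<close>. Hence the coefficients formed by \<open>gr_ident\<close> are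
  full cosets.\<close>

lemma fil_coset_mcoeff:
  assumes "x \<in> carrier L" "X \<in> mterms n r"
  shows "(\<lambda>f. mcoeff f X) ` (fil j +>\<^bsub>L\<^esub> x) = tpow j +> mcoeff x X"
proof
  show "(\<lambda>f. mcoeff f X) ` (fil j +>\<^bsub>L\<^esub> x) \<subseteq> tpow j +> mcoeff x X"
    by (auto simp: a_r_coset_def' fil_tpow)
  show "tpow j +> mcoeff x X \<subseteq> (\<lambda>f. mcoeff f X) ` (fil j +>\<^bsub>L\<^esub> x)"
  proof
    fix y assume "y \<in> tpow j +> mcoeff x X"
    then obtain c where c: "c \<in> tpow j" "y = c \<oplus> mcoeff x X" by (auto simp: a_r_coset_def')
    have "scaled_term A c X \<in> fil j"
      using c(1) assms(2) scaled_term_closed[of c X n r] tpow_carrier[OF c(1)] by (auto simp: fil_tpow mcoeff_scaled_term)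
    then have "scaled_term A c X \<oplus>\<^bsub>L\<^esub> x \<in> fil j +>\<^bsub>L\<^esub> x" by (auto simp: a_r_coset_def')
    moreover have "mcoeff (scaled_term A c X \<oplus>\<^bsub>L\<^esub> x) X = y" by (simp add: c(2) mcoeff_scaled_term)
    ultimately show "y \<in> (\<lambda>f. mcoeff f X) ` (fil j +>\<^bsub>L\<^esub> x)" by blast
  qed
qed

lemma fil_coset_zero [simp]: "fil j +>\<^bsub>L\<^esub> \<zero>\<^bsub>L\<^esub> = fil j"
  by (rule L.a_coset_add_zero) (auto simp: fil_def)

lemma mcoeff_gr_ident:
  "mcoeff (gr_ident A (PIdl t) n r \<xi>) X =
    (if X \<in> mterms n r then (\<lambda>i. (\<lambda>f. mcoeff f X) ` \<xi> i) else \<zero>\<^bsub>B\<^esub>)"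
  by (simp add: gr_ident_def mcoeff_def)

text \<open>The class of \<open>f \<in> t\<^sup>i L\<close> in \<open>t\<^sup>i L / t\<^sup>i\<^sup>+\<^sup>1 L\<close>, as an element of the free module over \<open>gr(A)[x\<^sub>1, \<dots>, x\<^sub>n]\<close>.\<close>

definition gcls where "gcls i f = (\<lambda>l u. homog i (f l u))"

lemma mcoeff_gcls: "mcoeff (gcls i f) X = homog i (mcoeff f X)"
  by (simp add: gcls_def mcoeff_def)

lemma gcls_closed: "f \<in> fil i \<Longrightarrow> gcls i f \<in> carrier (free_poly_module B n r)"
proof -
  assume f: "f \<in> fil i"
  then have fL: "f \<in> carrier L" by (rule fil_carrier)
  have "{X. mcoeff (gcls i f) X \<noteq> \<zero>\<^bsub>B\<^esub>} \<subseteq> {X. mcoeff f X \<noteq> \<zero>}" by (auto simp: mcoeff_gcls)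
  then have "finite {X. mcoeff (gcls i f) X \<noteq> \<zero>\<^bsub>B\<^esub>}" using mcoeff_finite[OF fL] finite_subset by blast
  moreover have "mcoeff (gcls i f) X \<in> carrier B" for X
    using f by (simp add: mcoeff_gcls homog_closed fil_tpow)
  moreover have "mcoeff (gcls i f) X = \<zero>\<^bsub>B\<^esub>" if "X \<notin> mterms n r" for X
    using mcoeff_outside[OF fL that] by (simp add: mcoeff_gcls)
  ultimately show ?thesis using gr.carrier_free_poly_module by blast
qed

text \<open>This transfers leading power products over gr(A) to elements of
  \<open>L\<close>.\<close>

lemma support_gcls: "f \<in> fil i \<Longrightarrow> support B n r (gcls i f) = gsupp i f"
  by (auto simp: support_def gsupp_tpow mcoeff_gcls homog_eq_zero_iff fil_tpow)

lemma gcls_lead: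
  assumes "f \<in> fil i" "is_lead (gsupp i f) X"
  shows "lp B n r ord (gcls i f) = X" "lc B n r ord (gcls i f) = homog i (mcoeff f X)"
    "mcoeff f X \<in> tpow i" "mcoeff f X \<notin> tpow (Suc i)" "X \<in> mterms n r"
    "gcls i f \<noteq> \<zero>\<^bsub>free_poly_module B n r\<^esub>"
proof -
  show lp: "lp B n r ord (gcls i f) = X"
    using assms support_gcls lp_eq by metis
  then show "lc B n r ord (gcls i f) = homog i (mcoeff f X)" by (simp add: lc_def mcoeff_gcls)
  show X: "mcoeff f X \<in> tpow i" "mcoeff f X \<notin> tpow (Suc i)" "X \<in> mterms n r"
    using assms by (simp_all add: fil_tpow is_lead_def gsupp_tpow)
  then show "gcls i f \<noteq> \<zero>\<^bsub>free_poly_module B n r\<^esub>"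
    using homog_eq_zero_iff[OF X(1)] mcoeff_gcls[of i f X] by auto
qed

end

context polynomial_submodule
begin

abbreviation grM where "grM \<equiv> gr_submodule A (PIdl t) n r M"

lemma gcls_mem_gr:
  assumes "f \<in> M" "f \<in> fil i"
  shows "gcls i f \<in> grM"
proof -
  define x where "x k = (if k = i then f else \<zero>\<^bsub>L\<^esub>)" for k
  define \<xi> where "\<xi> k = fil (Suc k) +>\<^bsub>L\<^esub> x k" for k
  have x: "x k \<in> M \<inter> fil k" for k using assms zero_fil M_closed(2) by (simp add: x_def)
  have xL: "x k \<in> carrier L" for k using x fil_carrier by blast
  have "{k. \<xi> k \<noteq> fil (Suc k)} \<subseteq> {i}" by (auto simp: \<xi>_def x_def)
  then have "finite {k. \<xi> k \<noteq> fil (Suc k)}" by (rule finite_subset) simp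
  then have "\<xi> \<in> gr_sub L fil M"
    using x by (auto simp: gr_sub_def gr_carrier_def \<xi>_def)
  moreover have "gr_ident A (PIdl t) n r \<xi> = gcls i f"
  proof (rule mcoeff_ext)
    fix X
    show "mcoeff (gr_ident A (PIdl t) n r \<xi>) X = mcoeff (gcls i f) X"
    proof (cases "X \<in> mterms n r")
      case True
      then have "(\<lambda>k. (\<lambda>f. mcoeff f X) ` \<xi> k) = (\<lambda>k. tpow (Suc k) +> mcoeff (x k) X)"
        using fil_coset_mcoeff[OF xL True] by (simp add: \<xi>_def)
      also have "\<dots> = homog i (mcoeff f X)"
        unfolding homog_def gr_of_def by (rule ext) (simp add: x_def)
      finally show ?thesis using True by (simp add: mcoeff_gr_ident mcoeff_gcls)
    next
      case False
      then show ?thesis using mcoeff_outside[OF M_closed(1)[OF assms(1)] False] by (simp add: mcoeff_gr_ident mcoeff_gcls)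
    qed
  qed
  ultimately show ?thesis unfolding gr_submodule_def madic_fil_eq by (metis imageI)
qed

text \<open>The two memberships supply two preimages, one with representatives in \<open>M\<close>
  and one concentrated in a single degree \<open>i\<close>. Comparing coefficients degree by degree
  shows that only the component \<open>x i\<close> of the first one contributes.\<close>

lemma gr_homogeneousE:
  assumes "g \<in> grM" "g \<in> gr_free_homogeneous A (PIdl t) n r"
  obtains i f where "f \<in> M" "f \<in> fil i" "g = gcls i f"
proof -
  obtain \<xi> where \<xi>: "\<xi> \<in> gr_sub L fil M" "g = gr_ident A (PIdl t) n r \<xi>"
    using assms(1) unfolding gr_submodule_def madic_fil_eq by blast
  obtain \<eta> where \<eta>: "\<eta> \<in> gr_homogeneous L fil" "g = gr_ident A (PIdl t) n r \<eta>"
    using assms(2) unfolding gr_free_homogeneous_def madic_fil_eq by blast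
  have "\<forall>k. \<exists>x\<in>M \<inter> fil k. \<xi> k = fil (Suc k) +>\<^bsub>L\<^esub> x" using \<xi>(1) by (auto simp: gr_sub_def)
  then obtain x where x: "\<And>k. x k \<in> M \<inter> fil k" "\<And>k. \<xi> k = fil (Suc k) +>\<^bsub>L\<^esub> x k" by metis
  have xL: "x k \<in> carrier L" for k using x(1) fil_carrier by blast
  obtain i where i: "\<And>k. k \<noteq> i \<Longrightarrow> \<eta> k = fil (Suc k)" using \<eta>(1) by (auto simp: gr_homogeneous_def)
  have "g = gcls i (x i)"
  proof (rule mcoeff_ext)
    fix X
    show "mcoeff g X = mcoeff (gcls i (x i)) X"
    proof (cases "X \<in> mterms n r")
      case True
      have comp: "mcoeff g X k = tpow (Suc k) +> mcoeff (x k) X" for k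
        using True fil_coset_mcoeff[OF xL True] by (simp add: \<xi>(2) mcoeff_gr_ident x(2))
      have "mcoeff g X k = tpow (Suc k) +> \<zero>" if "k \<noteq> i" for k
        using True fil_coset_mcoeff[OF L.zero_closed True, of "Suc k"] i[OF that] by (simp add: \<eta>(2) mcoeff_gr_ident)
      then have "mcoeff g X = homog i (mcoeff (x i) X)"
        using comp unfolding homog_def gr_of_def by (intro ext) simp
      then show ?thesis by (simp add: mcoeff_gcls)
    next
      case False
      then show ?thesis
        using mcoeff_outside[OF xL False] by (simp add: \<xi>(2) mcoeff_gr_ident mcoeff_gcls)
    qed
  qed
  then show ?thesis using that x(1) by blast
qed

end

section \<open>The equivalence of the conditions\<close>

locale homogeneous_groebner_basis = polynomial_submodule A t n r ord M
  for A (structure) and t and n r ord and M +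
  fixes G
  assumes groebner: "groebner_basis B n r ord grM G"
    and homogeneous: "G \<subseteq> gr_free_homogeneous A (PIdl t) n r"
begin

abbreviation lcB where "lcB \<equiv> lc B n r ord"
abbreviation lpB where "lpB \<equiv> lp B n r ord"
abbreviation deg where "deg g \<equiv> gr_val A (PIdl t) (lcB g)"

lemma basis_element:
  assumes "g \<in> G"
  obtains i f X where "f \<in> M" "f \<in> fil i" "g = gcls i f" "is_lead (gsupp i f) X"
proof -
  have g: "g \<in> grM" "g \<noteq> \<zero>\<^bsub>free_poly_module B n r\<^esub>"
    using groebner assms by (auto simp: groebner_basis_def)
  obtain i f where f: "f \<in> M" "f \<in> fil i" "g = gcls i f"
    using gr_homogeneousE[OF g(1)] homogeneous assms by blast
  have fL: "f \<in> carrier L" using f(2) by (rule fil_carrier)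
  have "gsupp i f \<noteq> {}"
  proof
    assume "gsupp i f = {}"
    then have "f \<in> fil (Suc i)" using gsupp_empty[OF fL] by blast
    then have "mcoeff g X = \<zero>\<^bsub>B\<^esub>" for X
      using f(2) by (simp add: f(3) mcoeff_gcls homog_eq_zero_iff fil_tpow)
    then have "g = \<zero>\<^bsub>free_poly_module B n r\<^esub>" by (intro mcoeff_ext) simp
    then show False using g(2) by blast
  qed
  then show ?thesis using that f gsupp_lead_exists[OF fL] by blast
qed

text \<open>The last claim excludes that the valuation of a leading coefficient equals
  \<open>a\<close>, as \<open>t^a = 0\<close> for finite \<open>a\<close>.\<close>

lemma basis_lead:
  assumes "g \<in> G"
  shows "lcB g \<in> carrier B" "lpB g \<in> mterms n r"
    "lcB g \<in> Units B \<longleftrightarrow> deg g = 0"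
    "t [^] deg g \<noteq> \<zero>"
proof -
  obtain i f X where f: "f \<in> M" "f \<in> fil i" "g = gcls i f" "is_lead (gsupp i f) X"
    using assms by (rule basis_element)
  note lead = gcls_lead[OF f(2,4), folded f(3)]
  show "lcB g \<in> carrier B" "lpB g \<in> mterms n r"
    using lead homog_closed by simp_all
  show "lcB g \<in> Units B \<longleftrightarrow> deg g = 0"
    using lead homog_unit_iff homog_val by simp
  have "t [^] i \<noteq> \<zero>"
  proof
    assume "t [^] i = \<zero>"
    then have "mcoeff f X = \<zero>" using lead(3) unfolding tpow_def mem_power_iff by auto
    then show False using lead(4) by simp
  qed
  then show "t [^] deg g \<noteq> \<zero>" using lead homog_val by simp
qed

definition unit_divisors where
  "unit_divisors \<longleftrightarrow> (\<forall>g\<in>G. \<exists>g'\<in>G. lcB g' \<in> Units B \<and>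
     mterm_dvd n (lpB g') (lpB g))"

lemma basis_unit_lead:
  assumes "g \<in> G" "lcB g \<in> Units B"
  obtains h where "h \<in> M" "g = gcls 0 h" "is_lead (gsupp 0 h) (lpB g)"
proof -
  obtain i f X where f: "f \<in> M" "f \<in> fil i" "g = gcls i f" "is_lead (gsupp i f) X"
    using assms(1) by (rule basis_element)
  note lead = gcls_lead[OF f(2,4), folded f(3)]
  have "i = 0" using assms(2) lead homog_unit_iff[OF lead(3,4)] by simp
  then show ?thesis using that f lead(1) by metis
qed

lemma unit_divisors_imp_unit_leading:
  assumes unit_divisors
  shows unit_leading
  unfolding unit_leading_def
proof (intro allI ballI impI)
  fix i f X assume f: "f \<in> M \<inter> fil i" "is_lead (gsupp i f) X"
  then have f': "f \<in> M" "f \<in> fil i" by auto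
  note lead = gcls_lead[OF f'(2) f(2)]
  have nz: "lcB (gcls i f) \<notin> {\<zero>\<^bsub>B\<^esub>}" using lead homog_eq_zero_iff[OF lead(3)] by simp
  \<comment> \<open>Here \<open>J\<close> is the zero ideal: some leading power product divides
    \<open>X\<close>, whatever its coefficient.\<close>
  have "\<exists>g\<in>G. lcB g \<notin> {\<zero>\<^bsub>B\<^esub>} \<and> mterm_dvd n (lpB g) (lpB (gcls i f))"
    using gcls_mem_gr[OF f'] lead(1,5,6) nz basis_lead
    by (intro gr.groebner_lead_dvd[OF _ _ _ _ groebner]) auto
  then obtain g where g: "g \<in> G" "mterm_dvd n (lpB g) X" using lead(1) by auto
  obtain g' where g': "g' \<in> G" "lcB g' \<in> Units B" "mterm_dvd n (lpB g') (lpB g)"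
    using assms g(1) unfolding unit_divisors_def by blast
  obtain h where "h \<in> M" "is_lead (gsupp 0 h) (lpB g')"
    using basis_unit_lead[OF g'(1,2)] by blast
  then show "\<exists>h\<in>M. \<exists>X'. is_lead (gsupp 0 h) X' \<and> mterm_dvd n X' X"
    using mterm_dvd_trans[OF g'(3) g(2)] by blast
qed

lemma gr_component_0:
  "\<xi> \<in> carrier B \<Longrightarrow> \<eta> \<in> carrier B \<Longrightarrow> \<eta> 0 = tpow (Suc 0) \<Longrightarrow> (\<xi> \<otimes>\<^bsub>B\<^esub> \<eta>) 0 = tpow (Suc 0)"
proof -
  assume "\<xi> \<in> carrier B" "\<eta> \<in> carrier B" and 0: "\<eta> 0 = tpow (Suc 0)"
  then obtain x y where x: "gr_rep x" "\<xi> = gr_of x" and y: "gr_rep y" "\<eta> = gr_of y"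
    by (auto simp: gr_ring_carrier)
  have c: "x 0 \<in> carrier A" "y 0 \<in> carrier A" using gr_rep_carrier x(1) y(1) by auto
  have "y 0 \<in> tpow (Suc 0)" using 0 y(2) tpow_coset_eq_self_iff[OF c(2)] by (simp add: gr_of_def)
  then have "x 0 \<otimes> y 0 \<in> tpow (Suc 0)" using tpow_mult[of "x 0" 0 "y 0" "Suc 0"] c by simp
  moreover have "(\<xi> \<otimes>\<^bsub>B\<^esub> \<eta>) 0 = gr_of (conv x y) 0" by (simp add: x(2) y(2) gr_mult_of[OF x(1) y(1)])
  ultimately show ?thesis
    using c tpow_coset_eq_self_iff[of "x 0 \<otimes> y 0" "Suc 0"] by (simp add: gr_of_def conv_def)
qed

lemma pure_imp_unit_divisors:
  assumes UQ.pure
  shows unit_divisors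
  unfolding unit_divisors_def
proof
  fix g assume "g \<in> G"
  then obtain i f X where f: "f \<in> M" "f \<in> fil i" "g = gcls i f" "is_lead (gsupp i f) X"
    by (rule basis_element)
  have lpg: "lpB g = X" using gcls_lead(1)[OF f(2,4)] f(3) by simp
  obtain h where h: "h \<in> M" "is_lead (gsupp 0 h) X"
    using pure_imp_same_lead[OF assms f(1,2,4)] by blast
  have hf: "h \<in> fil 0" using M_closed(1)[OF h(1)] by (simp add: fil_tpow)
  note lead = gcls_lead[OF hf h(2)]
  \<comment> \<open>The elements without component of degree 0. A homogeneous element outside
    \<open>J\<close> has degree 0 and is therefore a unit.\<close>
  define J where "J = {\<xi> \<in> carrier B. \<xi> 0 = tpow (Suc 0)}"
  have homog_J: "homog j c \<in> J \<longleftrightarrow> j \<noteq> 0 \<or> c \<in> tpow (Suc j)" if "c \<in> tpow j" for j c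
    using homog_component[OF that, of 0] homog_closed[OF that] by (auto simp: J_def)
  have "\<exists>g'\<in>G. lcB g' \<notin> J \<and> mterm_dvd n (lpB g') (lpB (gcls 0 h))"
  proof (rule gr.groebner_lead_dvd[OF _ _ _ _ groebner])
    have z: "\<zero>\<^bsub>B\<^esub> 0 = tpow (Suc 0)" by (simp add: gr_zero)
    then show "\<zero>\<^bsub>B\<^esub> \<in> J" by (simp add: J_def)
    show add: "\<xi> \<oplus>\<^bsub>B\<^esub> \<eta> \<in> J" if "\<xi> \<in> J" "\<eta> \<in> J" for \<xi> \<eta>
    proof -
      have "(\<xi> \<oplus>\<^bsub>B\<^esub> \<eta>) 0 = (\<zero>\<^bsub>B\<^esub> \<oplus>\<^bsub>B\<^esub> \<zero>\<^bsub>B\<^esub>) 0"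
        using that z by (simp add: gr_ring_def J_def ideal_power_tpow del: ideal_power.simps gr.l_zero gr.r_zero)
      then show ?thesis using that z by (simp add: J_def)
    qed
    show mult: "\<xi> \<otimes>\<^bsub>B\<^esub> \<eta> \<in> J" if "\<xi> \<in> carrier B" "\<eta> \<in> J" "\<eta> \<in> carrier B" for \<xi> \<eta>
      using that gr_component_0 by (simp add: J_def)
    show "\<ominus>\<^bsub>B\<^esub> \<xi> \<in> J" if \<xi>: "\<xi> \<in> J" for \<xi>
    proof -
      obtain x where x: "gr_rep x" "\<xi> = gr_of x" using \<xi> by (auto simp: J_def gr_ring_carrier)
      have c: "x i \<in> carrier A" for i using gr_rep_carrier x(1) by auto
      have "\<ominus>\<^bsub>B\<^esub> \<xi> = gr_of (\<lambda>i. \<ominus> x i)"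
        using gr.minus_equality[OF gr_uminus_of[OF x(1)]] x gr_of_closed gr_rep_uminus by simp
      moreover have "x 0 \<in> tpow (Suc 0)"
        using \<xi> x(2) tpow_coset_eq_self_iff[OF c[of 0], of "Suc 0"] by (simp add: J_def gr_of_def)
      then have "gr_of (\<lambda>i. \<ominus> x i) 0 = tpow (Suc 0)"
        using c[of 0] by (simp add: gr_of_def tpow_coset_eq_self_iff)
      ultimately show ?thesis using x gr_of_closed gr_rep_uminus by (simp add: J_def)
    qed
    show "lcB (gcls 0 h) \<notin> J" using lead homog_J[OF lead(3)] by simp
  qed (use gcls_mem_gr[OF h(1) hf] lead basis_lead in auto)
  then obtain g' where g': "g' \<in> G" "lcB g' \<notin> J" "mterm_dvd n (lpB g') X"
    using lead(1) by auto
  have "lcB g' \<in> Units B"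
  proof -
    obtain j k Y where k: "k \<in> M" "k \<in> fil j" "g' = gcls j k" "is_lead (gsupp j k) Y"
      using g'(1) by (rule basis_element)
    note lead' = gcls_lead[OF k(2,4), folded k(3)]
    show ?thesis using g'(2) lead' homog_J[OF lead'(3)] homog_unit_iff[OF lead'(3,4)] by simp
  qed
  then show "\<exists>g'\<in>G. lcB g' \<in> Units B \<and> mterm_dvd n (lpB g') (lpB g)"
    using g'(1,3) lpg by auto
qed

lemma pure_iff_unit_divisors: "UQ.pure \<longleftrightarrow> unit_divisors"
  using pure_imp_unit_divisors unit_divisors_imp_unit_leading unit_leading_imp_pure by blast

section \<open>Conditions (b) and (c')\<close>

lemma min_val_le:
  assumes "g \<in> G" "mterm_dvd n (lpB g) X"
  shows "min_val A (PIdl t) a n r ord G X \<le> enat (deg g)"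
    "\<exists>g'\<in>G. mterm_dvd n (lpB g') X \<and> min_val A (PIdl t) a n r ord G X = enat (deg g')"
proof -
  let ?V = "{enat (deg g) | g. g \<in> G \<and> mterm_dvd n (lpB g) X}"
  have eq: "min_val A (PIdl t) a n r ord G X = Min ?V"
    using assms by (auto simp: min_val_def Let_def)
  have "?V \<subseteq> (\<lambda>g. enat (deg g)) ` G" by auto
  then have fin: "finite ?V" using groebner finite_surj by (auto simp: groebner_basis_def)
  have mem: "enat (deg g) \<in> ?V" using assms by blast
  show "min_val A (PIdl t) a n r ord G X \<le> enat (deg g)"
    unfolding eq using fin mem by (rule Min_le)
  have "Min ?V \<in> ?V" using fin mem by (intro Min_in) auto
  then show "\<exists>g'\<in>G. mterm_dvd n (lpB g') X \<and> min_val A (PIdl t) a n r ord G X = enat (deg g')"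
    unfolding eq by blast
qed

text \<open>At \<open>X = lp(g)\<close> the minimum is the valuation of some leading coefficient and
  thus differs from \<open>a\<close>; under (b) it is 0, so that coefficient is a unit. Conversely,
  a unit leading coefficient makes the minimum 0 wherever any leading power product divides
  \<open>X\<close>.\<close>

lemma min_val_iff_unit_divisors:
  assumes a: "\<And>i. enat i = a \<Longrightarrow> t [^] i = \<zero>"
  shows "min_val A (PIdl t) a n r ord G ` mterms n r \<subseteq> {0, a} \<longleftrightarrow> unit_divisors"
proof
  assume *: "min_val A (PIdl t) a n r ord G ` mterms n r \<subseteq> {0, a}"
  show unit_divisors
    unfolding unit_divisors_def
  proof
    fix g assume g: "g \<in> G"
    let ?X = "lpB g"
    obtain g' where g': "g' \<in> G" "mterm_dvd n (lpB g') ?X"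
      "min_val A (PIdl t) a n r ord G ?X = enat (deg g')"
      using min_val_le(2)[OF g mterm_dvd_refl] by blast
    have "enat (deg g') \<noteq> a" using a basis_lead(4)[OF g'(1)] by blast
    moreover have "min_val A (PIdl t) a n r ord G ?X \<in> {0, a}" using * basis_lead(2)[OF g] by blast
    ultimately have "deg g' = 0" using g'(3) by (simp add: zero_enat_def)
    then show "\<exists>g'\<in>G. lcB g' \<in> Units B \<and> mterm_dvd n (lpB g') ?X"
      using g' basis_lead(3)[OF g'(1)] by blast
  qed
next
  assume *: unit_divisors
  show "min_val A (PIdl t) a n r ord G ` mterms n r \<subseteq> {0, a}"
  proof (rule image_subsetI)
    fix X assume "X \<in> mterms n r"
    show "min_val A (PIdl t) a n r ord G X \<in> {0, a}"
    proof (cases "\<exists>g\<in>G. mterm_dvd n (lpB g) X")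
      case True
      then obtain g where g: "g \<in> G" "mterm_dvd n (lpB g) X" by blast
      then obtain g' where g': "g' \<in> G" "lcB g' \<in> Units B" "mterm_dvd n (lpB g') (lpB g)"
        using * unfolding unit_divisors_def by blast
      have "min_val A (PIdl t) a n r ord G X \<le> enat (deg g')"
        by (rule min_val_le(1)[OF g'(1) mterm_dvd_trans[OF g'(3) g(2)]])
      then show ?thesis using g'(2) basis_lead(3)[OF g'(1)] by (simp add: zero_enat_def[symmetric])
    next
      case False
      then show ?thesis by (simp add: min_val_def)
    qed
  qed
qed

text \<open>If \<open>g' \<noteq> g\<close> has a unit leading coefficient and its leading power
  product divides that of \<open>g\<close>, then \<open>g\<close> is strictly reducible by
  \<open>g'\<close>, against minimality.\<close>

lemma minimal_unit_divisors:
  assumes "minimal_basis B n r ord G"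
  shows "unit_divisors \<longleftrightarrow> (\<forall>g\<in>G. lcB g \<in> Units B)"
proof
  assume *: unit_divisors
  show "\<forall>g\<in>G. lcB g \<in> Units B"
  proof
    fix g assume g: "g \<in> G"
    then obtain g' where g': "g' \<in> G" "lcB g' \<in> Units B" "mterm_dvd n (lpB g') (lpB g)"
      using * unfolding unit_divisors_def by blast
    show "lcB g \<in> Units B"
    proof (cases "g' = g")
      case False
      obtain i f X where f: "f \<in> M" "f \<in> fil i" "g = gcls i f" "is_lead (gsupp i f) X"
        using g by (rule basis_element)
      note lead = gcls_lead[OF f(2,4), folded f(3)]
      let ?X' = "lpB g'"
      obtain h where h: "h \<in> M" "g' = gcls 0 h" "is_lead (gsupp 0 h) ?X'"
        using g'(1,2) by (rule basis_unit_lead)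
      have hf: "h \<in> fil 0" using M_closed(1)[OF h(1)] by (simp add: fil_tpow)
      have w: "mcoeff h ?X' \<in> Units A"
        using h(3) gsupp_0_iff[OF M_closed(1)[OF h(1)]] by (simp add: is_lead_def)
      obtain u where u: "u \<in> monomials n" "X = mterm_mult u ?X'"
        using g'(3) lead(1) by (auto simp: mterm_dvd_def)
      \<comment> \<open>The quotient of the leading coefficients is formed in \<open>A\<close>,
        where that of \<open>h\<close> is a unit; its class in degree \<open>i\<close> is the
        reduction coefficient.\<close>
      define d where "d = mcoeff f X \<otimes> inv mcoeff h ?X'"
      have d: "d \<in> tpow i" using lead(3) w power_mult_r unfolding d_def tpow_def by blast
      have dw: "d \<otimes> mcoeff h ?X' = mcoeff f X"
        using w tpow_carrier[OF lead(3)] by (simp add: d_def m_assoc Units_closed)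
      have GF: "G \<subseteq> carrier (free_poly_module B n r)"
      proof
        fix s assume "s \<in> G"
        then obtain j k Y where "k \<in> fil j" "s = gcls j k" by (rule basis_element)
        then show "s \<in> carrier (free_poly_module B n r)" using gcls_closed by blast
      qed
      have "strictly_reducible B n r ord (G - {g}) g"
      proof (rule strictly_reducible_by_element[where g' = g' and X = X and X' = ?X' and u = u and c = "homog i d"])
        show "finite (G - {g})" using groebner by (simp add: groebner_basis_def)
        show "is_lead (support B n r g) X" using f support_gcls by metis
        show "is_lead (support B n r g') ?X'" using h hf support_gcls by metis
        show "homog i d \<otimes>\<^bsub>B\<^esub> mcoeff g' ?X' = mcoeff g X"
          unfolding h(2) f(3) mcoeff_gcls using homog_mult_0[OF d Units_closed[OF w]] dw h(2) by simp
      qed (use GF g g'(1) False u homog_closed[OF d] gr_ring_coefficient_ring in auto)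
      then show ?thesis using assms g unfolding minimal_basis_def by blast
    qed (use g' in simp)
  qed
next
  assume "\<forall>g\<in>G. lcB g \<in> Units B"
  then show unit_divisors unfolding unit_divisors_def using mterm_dvd_refl by blast
qed

text \<open>Purity gives flatness for test modules in every type; the converse uses the sum type,
  which has room for copies of \<open>A\<close> and its ideals.\<close>

lemma flat_iff_unit_divisors:
  "flat_module TYPE('a + 'u) A (restrict_scalars (poly_const A) (quotient_module (free_poly_module A n r) M))
    \<longleftrightarrow> unit_divisors"
  using UQ.flat_imp_pure UQ.pure_imp_flat pure_iff_unit_divisors
  unfolding quotient_restrict_scalars by blast

end

theorem theorem4p1:
  fixes A :: "('a, 'e) ring_scheme" and \<mm> :: "'a set" and a :: enat and n r :: nat
    and M :: "(nat \<Rightarrow> nat multiset \<Rightarrow> 'a) set"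
    and ord :: "mterm rel"
    and G :: "(nat \<Rightarrow> nat multiset \<Rightarrow> (nat \<Rightarrow> 'a set)) set"
  assumes "tdvr A \<mm> a" and "r \<ge> 1"
    and "submodule M (mpoly_ring A n) (free_poly_module A n r)"
    and "M \<noteq> {\<zero>\<^bsub>free_poly_module A n r\<^esub>}"
    and "term_order n r ord"
    and "groebner_basis (gr_ring A \<mm>) n r ord (gr_submodule A \<mm> n r M) G"
    and "G \<subseteq> gr_free_homogeneous A \<mm> n r"
  shows
    "(flat_module TYPE('a + 'u) A
        (restrict_scalars (poly_const A) (quotient_module (free_poly_module A n r) M))
      \<longleftrightarrow> min_val A \<mm> a n r ord G ` mterms n r \<subseteq> {0, a}) \<and>
     (min_val A \<mm> a n r ord G ` mterms n r \<subseteq> {0, a}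
      \<longleftrightarrow> (\<forall>g\<in>G. \<exists>g'\<in>G. lc (gr_ring A \<mm>) n r ord g' \<in> Units (gr_ring A \<mm>) \<and>
             mterm_dvd n (lp (gr_ring A \<mm>) n r ord g') (lp (gr_ring A \<mm>) n r ord g))) \<and>
     (minimal_basis (gr_ring A \<mm>) n r ord G \<longrightarrow>
       (flat_module TYPE('a + 'u) A
          (restrict_scalars (poly_const A) (quotient_module (free_poly_module A n r) M))
        \<longleftrightarrow> (\<forall>g\<in>G. lc (gr_ring A \<mm>) n r ord g \<in> Units (gr_ring A \<mm>))))"
proof -
  obtain t where t: "uniserial_ring A t" "\<mm> = PIdl\<^bsub>A\<^esub> t" "\<And>i. enat i = a \<Longrightarrow> t [^]\<^bsub>A\<^esub> i = \<zero>\<^bsub>A\<^esub>"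
    using tdvr_uniserial[OF assms(1)] by blast
  interpret homogeneous_groebner_basis A t n r ord M G
    using t(1) assms(3,5,6,7) unfolding t(2)
    by (intro homogeneous_groebner_basis.intro polynomial_submodule.intro uniserial_polynomials.intro
        ordered_terms.intro polynomial_submodule_axioms.intro homogeneous_groebner_basis_axioms.intro)
  show ?thesis
    using flat_iff_unit_divisors min_val_iff_unit_divisors[OF t(3)] minimal_unit_divisors
    unfolding t(2) unit_divisors_def by blast
qed

end
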